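(* Let $J\in\mathbb{R}^{n\times n}$ and let $\Omega$ be the union of $\mathbb{R}$ and the complex unit circle minus the points $\{-1,0,1\}$. Let the Kronecker structure of the real pencil $J-\mu J^T$ be $$K_J=\big(\mathcal{L}_{s_1}\oplus\dots\oplus\mathcal{L}_{s_a}\big)\oplus\big(\mathcal{Z}_{t_1}\oplus\dots\oplus\mathcal{Z}_{t_b}\big)\oplus\big(J_{m_1}^1\oplus\dots\oplus J_{m_c}^1\big)\oplus\big(J_{n_1}^{-1}\oplus\dots\oplus J_{n_d}^{-1}\big)\oplus\big(\mathcal{J}_{p_1}^{\alpha_1}\oplus\dots\oplus\mathcal{J}_{p_e}^{\alpha_e}\big)\oplus\bigoplus_{j=1}^f\mathcal{J}_{q_j}^{\lambda_j,\mathbb{R}},$$ with $\alpha_j\in\Omega$ and with $\lambda_j\in\mathbb{C}\setminus\mathbb{R}$, $|\lambda_j|\ne1$. Write $\alpha_j\sim\alpha_k$ when $\{\alpha_j,1/\alpha_j\}=\{\alpha_k,1/\alpha_k\}$, and $\lambda_j\sim\lambda_k$ when $\{\lambda_j,\bar\lambda_j,1/\lambda_j,1/\bar\lambda_j\}=\{\lambda_k,\bar\lambda_k,1/\lambda_k,1/\bar\lambda_k\}$. Then the real dimension of the real solution set $\{X\in\mathbb{R}^{n\times n}:X^TJ+JX=0\}$ is $D_L+D_Z+D_1+D_{-1}+D_\alpha+D_P+D_I$, where \begin{align*} D_L&=\sum_{j=1}^a(s_j+1)+\sum_{j<k}\max(2s_j+1,2s_k+1)+\#\{j<k:s_j=s_k\},\\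 D_Z&=\sum_{j=1}^bt_j+\sum_{j<k}\min(2t_j,2t_k),\\ D_1&=\sum_{j=1}^c\Big\lfloor\frac{m_j}{2}\Big\rfloor+\sum_{j<k}\min(m_j,m_k),\qquad D_{-1}=\sum_{j=1}^d\Big\lceil\frac{n_j}{2}\Big\rceil+\sum_{j<k}\min(n_j,n_k),\\ D_\alpha&=\sum_{j=1}^ep_j+\sum_{j<k,\ \alpha_j\sim\alpha_k}\min(2p_j,2p_k),\\ D_P&=\sum_{j=1}^f2q_j+\sum_{j<k,\ \lambda_j\sim\lambda_k}\min(4q_j,4q_k),\\ D_I&=a\Big(n-\sum_{i=1}^a(2s_i+1)\Big). \end{align*}
   Context: The Kronecker structure of a pencil (with indeterminate $\mu$) is its Kronecker canonical form under strict equivalence $A-\mu B\mapsto P(A-\mu B)Q$ with $P,Q$ constant nonsingular complex matrices; the order of blocks is irrelevant. For finite $\lambda$, the symbol $J_r^\lambda$ in a Kronecker structure denotes the $r\times r$ Jordan block pencil with eigenvalue $\lambda$ (Jordan block minus $\mu I_r$), $J_r^\infty$ denotes the $r\times r$ block of the eigenvalue $\infty$ ($I_r-\mu N_r$, $N_r$ the nilpotent Jordan block), and $L_r$ is the $r\times(r+1)$ singular Kronecker block, with $L_r^T$ its transpose ($r\ge0$). The paired blocks are $\mathcal{L}_r=L_r\oplus L_r^T$ (size $(2r+1)\times(2r+1)$), $\mathcal{Z}_r=J_r^0\oplus J_r^\infty$ (size $2r\times2r$), $\mathcal{J}_r^\lambda=J_r^\lambda\oplus J_r^{1/\lambda}$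 (size $2r\times2r$). For $\lambda\in\mathbb{C}\setminus\mathbb{R}$, $\mathcal{J}_r^{\lambda,\mathbb{R}}=[J_r^\lambda]_{\mathbb{R}}\oplus[J_r^{1/\lambda}]_{\mathbb{R}}$ (size $4r\times4r$), where $[A]_{\mathbb{R}}=\begin{bmatrix}\operatorname{re}(A)&\operatorname{im}(A)\\-\operatorname{im}(A)&\operatorname{re}(A)\end{bmatrix}$; it represents the four Jordan blocks $J_r^\lambda,J_r^{\bar\lambda},J_r^{1/\lambda},J_r^{1/\bar\lambda}$ at once. Every pencil $J-\mu J^T$ with $J\in\mathbb{R}^{n\times n}$ has a Kronecker structure of the form displayed in the claim (any of $a,b,c,d,e,f$ may be $0$). Sums over $j<k$ run over pairs of indices of the blocks concerned. *)

theory Defs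
  imports
    "Jordan_Normal_Form.Jordan_Normal_Form"
    "Jordan_Normal_Form.VS_Connect"
begin

section \<open>Matrix pencils\<close>

text \<open>A pencil is a matrix over \<open>complex poly\<close>; the indeterminate \<open>\<mu>\<close> is \<^term>\<open>[:0, 1:]\<close>.\<close>

definition const_mat :: "complex mat \<Rightarrow> complex poly mat" where
  "const_mat A = map_mat (\<lambda>z. [:z:]) A"

definition pencil :: "complex mat \<Rightarrow> complex mat \<Rightarrow> complex poly mat" where
  "pencil A B = const_mat A - [:0, 1:] \<cdot>\<^sub>m const_mat B"

definition strictly_equivalent :: "complex poly mat \<Rightarrow> complex poly mat \<Rightarrow> bool" where
  "strictly_equivalent M N \<longleftrightarrow>
     (\<exists>P \<in> carrier_mat (dim_row M) (dim_row M). \<exists>Q \<in> carrier_mat (dim_col M) (dim_col M).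
        invertible_mat P \<and> invertible_mat Q \<and> N = const_mat P * M * const_mat Q)"


section \<open>Kronecker blocks\<close>

definition J_fin :: "nat \<Rightarrow> complex \<Rightarrow> complex poly mat" where
  "J_fin r z = pencil (jordan_block r z) (1\<^sub>m r)"

definition J_inf :: "nat \<Rightarrow> complex poly mat" where
  "J_inf r = pencil (1\<^sub>m r) (jordan_block r 0)"

text \<open>\<open>[0 I\<^sub>r] - \<mu> [I\<^sub>r 0]\<close>. For \<open>r = 0\<close> this is the \<open>0 \<times> 1\<close> matrix, so that \<open>L 0\<close> adds a zero
  column and its transpose a zero row to a direct sum.\<close>

definition L :: "nat \<Rightarrow> complex poly mat" where
  "L r = pencil (mat r (r + 1) (\<lambda>(i, j). if j = i + 1 then 1 else 0))
                (mat r (r + 1) (\<lambda>(i, j). if j = i then 1 else 0))"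

text \<open>Real and imaginary part of a pencil are taken coefficientwise, that is, \<open>\<mu>\<close> is treated as
  a real indeterminate: \<open>[A - \<mu> B]\<^sub>\<real> = [A]\<^sub>\<real> - \<mu> [B]\<^sub>\<real>\<close>.\<close>

definition re_pencil :: "complex poly mat \<Rightarrow> complex poly mat" where
  "re_pencil M = map_mat (map_poly (\<lambda>z. complex_of_real (Re z))) M"

definition im_pencil :: "complex poly mat \<Rightarrow> complex poly mat" where
  "im_pencil M = map_mat (map_poly (\<lambda>z. complex_of_real (Im z))) M"

definition realification :: "complex poly mat \<Rightarrow> complex poly mat" where
  "realification M =
     four_block_mat (re_pencil M) (im_pencil M) (- im_pencil M) (re_pencil M)"

definition paired_L :: "nat \<Rightarrow> complex poly mat" where
  "paired_L r = diag_block_mat [L r, transpose_mat (L r)]"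

definition paired_Z :: "nat \<Rightarrow> complex poly mat" where
  "paired_Z r = diag_block_mat [J_fin r 0, J_inf r]"

definition paired_J :: "nat \<Rightarrow> complex \<Rightarrow> complex poly mat" where
  "paired_J r z = diag_block_mat [J_fin r z, J_fin r (1 / z)]"

definition paired_J_real :: "nat \<Rightarrow> complex \<Rightarrow> complex poly mat" where
  "paired_J_real r z =
     diag_block_mat [realification (J_fin r z), realification (J_fin r (1 / z))]"

definition Omega :: "complex set" where
  "Omega = (\<real> \<union> {z. cmod z = 1}) - {-1, 0, 1}"

text \<open>Blocks of each kind are indexed from \<open>0\<close>.\<close>

definition K_pencil ::
  "nat \<Rightarrow> (nat \<Rightarrow> nat) \<Rightarrow> nat \<Rightarrow> (nat \<Rightarrow> nat) \<Rightarrow> nat \<Rightarrow> (nat \<Rightarrow> nat) \<Rightarrow> nat \<Rightarrow> (nat \<Rightarrow> nat) \<Rightarrow>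
   nat \<Rightarrow> (nat \<Rightarrow> nat) \<Rightarrow> (nat \<Rightarrow> complex) \<Rightarrow> nat \<Rightarrow> (nat \<Rightarrow> nat) \<Rightarrow> (nat \<Rightarrow> complex) \<Rightarrow>
   complex poly mat" where
  "K_pencil a s b t c m d n' e p \<alpha> f q lam = diag_block_mat
     (map (\<lambda>j. paired_L (s j)) [0..<a] @
      map (\<lambda>j. paired_Z (t j)) [0..<b] @
      map (\<lambda>j. J_fin (m j) 1) [0..<c] @
      map (\<lambda>j. J_fin (n' j) (-1)) [0..<d] @
      map (\<lambda>j. paired_J (p j) (\<alpha> j)) [0..<e] @
      map (\<lambda>j. paired_J_real (q j) (lam j)) [0..<f])"


section \<open>The solution space\<close>

definition solutions :: "nat \<Rightarrow> real mat \<Rightarrow> real mat set" where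
  "solutions n J = {X \<in> carrier_mat n n. transpose_mat X * J + J * X = 0\<^sub>m n n}"

definition solutions_dim :: "nat \<Rightarrow> real mat \<Rightarrow> nat" where
  "solutions_dim n J =
     vectorspace.dim class_ring (module_mat TYPE(real) n n\<lparr>carrier := solutions n J\<rparr>)"


section \<open>The dimension count\<close>

definition alpha_equiv :: "complex \<Rightarrow> complex \<Rightarrow> bool" where
  "alpha_equiv x y \<longleftrightarrow> {x, 1 / x} = {y, 1 / y}"

definition lambda_equiv :: "complex \<Rightarrow> complex \<Rightarrow> bool" where
  "lambda_equiv x y \<longleftrightarrow> {x, cnj x, 1 / x, 1 / cnj x} = {y, cnj y, 1 / y, 1 / cnj y}"

definition D_L :: "nat \<Rightarrow> (nat \<Rightarrow> nat) \<Rightarrow> int" where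
  "D_L a s = (\<Sum>j<a. int (s j + 1))
     + (\<Sum>(j, k) \<in> {(j, k). j < k \<and> k < a}. int (max (2 * s j + 1) (2 * s k + 1)))
     + int (card {(j, k). j < k \<and> k < a \<and> s j = s k})"

definition D_Z :: "nat \<Rightarrow> (nat \<Rightarrow> nat) \<Rightarrow> int" where
  "D_Z b t = (\<Sum>j<b. int (t j))
     + (\<Sum>(j, k) \<in> {(j, k). j < k \<and> k < b}. int (min (2 * t j) (2 * t k)))"

definition D_plus1 :: "nat \<Rightarrow> (nat \<Rightarrow> nat) \<Rightarrow> int" where
  "D_plus1 c m = (\<Sum>j<c. \<lfloor>real (m j) / 2\<rfloor>)
     + (\<Sum>(j, k) \<in> {(j, k). j < k \<and> k < c}. int (min (m j) (m k)))"

definition D_minus1 :: "nat \<Rightarrow> (nat \<Rightarrow> nat) \<Rightarrow> int" where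
  "D_minus1 d n' = (\<Sum>j<d. \<lceil>real (n' j) / 2\<rceil>)
     + (\<Sum>(j, k) \<in> {(j, k). j < k \<and> k < d}. int (min (n' j) (n' k)))"

definition D_alpha :: "nat \<Rightarrow> (nat \<Rightarrow> nat) \<Rightarrow> (nat \<Rightarrow> complex) \<Rightarrow> int" where
  "D_alpha e p \<alpha> = (\<Sum>j<e. int (p j))
     + (\<Sum>(j, k) \<in> {(j, k). j < k \<and> k < e \<and> alpha_equiv (\<alpha> j) (\<alpha> k)}.
          int (min (2 * p j) (2 * p k)))"

definition D_P :: "nat \<Rightarrow> (nat \<Rightarrow> nat) \<Rightarrow> (nat \<Rightarrow> complex) \<Rightarrow> int" where
  "D_P f q lam = (\<Sum>j<f. int (2 * q j))
     + (\<Sum>(j, k) \<in> {(j, k). j < k \<and> k < f \<and> lambda_equiv (lam j) (lam k)}.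
          int (min (4 * q j) (4 * q k)))"

definition D_I :: "nat \<Rightarrow> nat \<Rightarrow> (nat \<Rightarrow> nat) \<Rightarrow> int" where
  "D_I n a s = int a * (int n - (\<Sum>i<a. int (2 * s i + 1)))"

text \<open>\<^const>\<open>vectorspace.dim\<close> is only meaningful for vector spaces: the solution set is one.\<close>

lemma solutions_subspace:
  assumes J: "J \<in> carrier_mat n n"
  shows "VectorSpace.subspace class_ring (solutions n J) (module_mat TYPE(real) n n)"
proof -
  interpret matrix_vs n n "TYPE(real)" .
  have eq: "X \<in> solutions n J \<longleftrightarrow> X \<in> carrier_mat n n \<and> transpose_mat X * J + J * X = 0\<^sub>m n n" for X
    by (simp add: solutions_def)
  have sub: "submodule class_ring (solutions n J) (module_mat TYPE(real) n n)"
  proof (unfold_locales, unfold matrix_vs_simps)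
    show "solutions n J \<subseteq> carrier_mat n n" by (auto simp: solutions_def)
    show "0\<^sub>m n n \<in> solutions n J" using J by (auto simp: eq)
  next
    fix X Y assume "X \<in> solutions n J" "Y \<in> solutions n J"
    hence X: "X \<in> carrier_mat n n" "transpose_mat X * J + J * X = 0\<^sub>m n n"
      and Y: "Y \<in> carrier_mat n n" "transpose_mat Y * J + J * Y = 0\<^sub>m n n"
      by (auto simp: eq)
    have "transpose_mat (X + Y) * J + J * (X + Y)
        = (transpose_mat X * J + J * X) + (transpose_mat Y * J + J * Y)"
      using X(1) Y(1) J
      by (intro eq_matI)
        (auto simp: transpose_add[of _ n n] add_mult_distrib_mat[of _ n n] mult_add_distrib_mat[of _ n n])
    also have "\<dots> = 0\<^sub>m n n" using X Y by auto
    finally show "X + Y \<in> solutions n J" using X(1) Y(1) by (simp add: eq)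
  next
    fix c :: real and X assume "X \<in> solutions n J"
    hence X: "X \<in> carrier_mat n n" "transpose_mat X * J + J * X = 0\<^sub>m n n"
      by (auto simp: eq)
    have tr: "transpose_mat (c \<cdot>\<^sub>m X) = c \<cdot>\<^sub>m transpose_mat X" by (intro eq_matI) auto
    have "transpose_mat (c \<cdot>\<^sub>m X) * J + J * (c \<cdot>\<^sub>m X) = c \<cdot>\<^sub>m (transpose_mat X * J + J * X)"
      unfolding tr using X(1) J
      by (subst add_smult_distrib_left_mat[of _ n n]) auto
    also have "\<dots> = 0\<^sub>m n n" using X by auto
    finally show "c \<cdot>\<^sub>m X \<in> solutions n J" using X(1) by (simp add: eq)
  qed
  show ?thesis
    unfolding VectorSpace.subspace_def using sub vectorspace_axioms by auto
qed

end

theory Submission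
  imports Defs "HOL-Library.Function_Algebras" "HOL-Library.Product_Plus"
begin

text \<open>Why the formula holds. Let \<open>M\<^sub>0 - \<mu> M\<^sub>1 = P (J - \<mu> J\<^sup>T) Q\<close>. The invertible linear substitution
  \<open>U = P\<^sup>-\<^sup>T X Q\<close> turns \<open>X\<^sup>T J + J X = 0\<close> into \<open>U\<^sup>T M\<^sub>0 + M\<^sub>1\<^sup>T U = 0\<close>: multiply by \<open>Q\<^sup>T\<close> from the left
  and by \<open>Q\<close> from the right, and use \<open>J = (J\<^sup>T)\<^sup>T\<close> to rewrite the second summand with \<open>M\<^sub>1\<close>. The new
  equation makes sense for every pencil, square or not, and the dimension of its solution space is
  an invariant of strict equivalence (\<open>has_dim_self_sol_equiv\<close>). So the canonical pencil may be put
  in place of \<open>J - \<mu> J\<^sup>T\<close>, although it need not have the form \<open>K - \<mu> K\<^sup>T\<close>.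

  For a direct sum of blocks, \<open>U\<close> falls apart into blocks \<open>U\<^sub>i\<^sub>j\<close>. Each diagonal block satisfies the
  same equation for its own Kronecker block, and each pair \<open>(U\<^sub>i\<^sub>j, U\<^sub>j\<^sub>i)\<close> satisfies two coupled equations
  that involve only the Kronecker blocks \<open>i\<close> and \<open>j\<close> (\<open>has_dim_self_sol_direct_sum\<close>,
  \<open>has_dim_pair_sol_direct_sum\<close>). The dimension is therefore a sum of one number for every block and
  one number for every unordered pair of blocks. For elementary blocks these numbers are found by
  solving recurrences between matrix entries:

  \<^item> A single block contributes \<open>\<lfloor>r/2\<rfloor>\<close> for \<open>J\<^sub>r\<^sup>1\<close>, \<open>\<lceil>r/2\<rceil>\<close> for \<open>J\<^sub>r\<^sup>-\<^sup>1\<close>, \<open>r\<close> for \<open>L\<^sub>r\<^sup>T\<close>, and \<open>0\<close> otherwise.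
  \<^item> Two regular blocks of sizes \<open>r\<close> and \<open>s\<close> contribute \<open>min r s\<close> if their eigenvalues are reciprocal,
    where \<open>0\<close> and \<open>\<infinity>\<close> count as reciprocal, and \<open>0\<close> otherwise.
  \<^item> \<open>L\<^sub>r\<close> and \<open>L\<^sub>s\<^sup>T\<close> contribute \<open>max 0 (r + 1 - s)\<close>, \<open>L\<^sub>r\<^sup>T\<close> and \<open>L\<^sub>s\<^sup>T\<close> contribute \<open>r + s\<close>, two blocks
    \<open>L\<close> contribute \<open>0\<close>.
  \<^item> A regular block of size \<open>r\<close> contributes \<open>r\<close> with every \<open>L\<^sub>s\<^sup>T\<close> and \<open>0\<close> with every \<open>L\<^sub>s\<close>.

  Three further points complete the argument. Real solutions and complex solutions have the same
  dimension over their fields (\<open>real_dim_eq_complex_dim\<close>). A realified block is strictly equivalent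
  to the direct sum of the block and its conjugate (\<open>realification_equiv\<close>). Finally, the table is
  summed over the blocks of \<open>K_pencil\<close> (\<open>sol_dim_all_blocks\<close>); the last bullet is the origin of \<open>D_I\<close>,
  because the sizes of the regular blocks add up to \<open>n - \<Sum>(2 s\<^sub>i + 1)\<close>.\<close>

section \<open>Dimension of complex solution spaces\<close>

text \<open>Unknowns are families of complex numbers, indexed by pairs of naturals and grouped into pairs.
  The class makes all of these types complex vector spaces at once.\<close>

class cvec = ab_group_add +
  fixes cscale :: "complex \<Rightarrow> 'a \<Rightarrow> 'a"
  assumes cscale_add_right: "cscale c (u + v) = cscale c u + cscale c v"
    and cscale_add_left: "cscale (b + c) u = cscale b u + cscale c u"
    and cscale_cscale: "cscale b (cscale c u) = cscale (b * c) u"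
    and cscale_one: "cscale 1 u = u"

instantiation complex :: cvec
begin
definition "cscale (c :: complex) z = c * z"
instance by standard (auto simp: cscale_complex_def algebra_simps)
end

instantiation "fun" :: (type, cvec) cvec
begin
definition "cscale c f = (\<lambda>x. cscale c (f x))"
instance by standard (auto simp: cscale_fun_def cscale_add_right cscale_add_left cscale_cscale cscale_one)
end

instantiation prod :: (cvec, cvec) cvec
begin
definition "cscale c p = (cscale c (fst p), cscale c (snd p))"
instance by standard (auto simp: cscale_prod_def cscale_add_right cscale_add_left cscale_cscale cscale_one)
end

lemma cscale_apply [simp]: "cscale c f x = cscale c (f x)"
  by (simp add: cscale_fun_def)

lemma cscale_complex [simp]: "cscale c (z :: complex) = c * z"
  by (simp add: cscale_complex_def)

lemma cscale_Pair [simp]: "cscale c (u, v) = (cscale c u, cscale c v)"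
  by (simp add: cscale_prod_def)

interpretation cvec: vector_space cscale
  by standard (auto simp: cscale_add_right cscale_add_left cscale_cscale cscale_one)

definition clinear_on :: "'u::cvec set \<Rightarrow> ('u \<Rightarrow> 'v::cvec) \<Rightarrow> bool" where
  "clinear_on S \<phi> \<longleftrightarrow> (\<forall>u\<in>S. \<forall>v\<in>S. \<phi> (u + v) = \<phi> u + \<phi> v) \<and> (\<forall>u\<in>S. \<forall>c. \<phi> (cscale c u) = cscale c (\<phi> u))"

text \<open>A space has dimension \<open>d\<close> if it is linearly isomorphic to \<open>\<complex>\<^sup>d\<close>. The isomorphism need only be
  linear on the space, so it may be given by a formula that reads off some entries of a solution.\<close>

definition coords :: "nat \<Rightarrow> (nat \<Rightarrow> complex) set" where
  "coords d = {x. \<forall>k\<ge>d. x k = 0}"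

definition has_dim :: "'u::cvec set \<Rightarrow> nat \<Rightarrow> bool" where
  "has_dim S d \<longleftrightarrow> (\<exists>\<phi>. clinear_on S \<phi> \<and> bij_betw \<phi> S (coords d))"

lemma has_dim_bij:
  assumes \<phi>: "clinear_on S \<phi>" "bij_betw \<phi> S T" and T: "has_dim T d"
  shows "has_dim S d"
proof -
  obtain \<psi> where \<psi>: "clinear_on T \<psi>" "bij_betw \<psi> T (coords d)"
    using T by (auto simp: has_dim_def)
  have "\<phi> u \<in> T" if "u \<in> S" for u using \<phi>(2) that by (auto simp: bij_betw_def)
  then have "clinear_on S (\<psi> \<circ> \<phi>)"
    using \<phi>(1) \<psi>(1) by (auto simp: clinear_on_def)
  moreover have "bij_betw (\<psi> \<circ> \<phi>) S (coords d)"
    using \<phi>(2) \<psi>(2) by (rule bij_betw_trans)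
  ultimately show ?thesis unfolding has_dim_def by blast
qed

lemma has_dim_zero: "has_dim {0} 0"
proof -
  have "coords 0 = {0}" by (auto simp: coords_def)
  then show ?thesis unfolding has_dim_def
    by (intro exI[of _ "\<lambda>_. 0"]) (auto simp: clinear_on_def bij_betw_def)
qed

lemma has_dim_Times:
  assumes "has_dim S d" "has_dim T e"
  shows "has_dim (S \<times> T) (d + e)"
proof -
  obtain \<phi> where \<phi>: "clinear_on S \<phi>" "bij_betw \<phi> S (coords d)"
    using assms(1) by (auto simp: has_dim_def)
  obtain \<psi> where \<psi>: "clinear_on T \<psi>" "bij_betw \<psi> T (coords e)"
    using assms(2) by (auto simp: has_dim_def)
  define j :: "(nat \<Rightarrow> complex) \<times> (nat \<Rightarrow> complex) \<Rightarrow> nat \<Rightarrow> complex" where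
    "j = (\<lambda>(x, y) k. if k < d then x k else y (k - d))"
  have "bij_betw j (coords d \<times> coords e) (coords (d + e))"
    by (rule bij_betw_byWitness[where f' = "\<lambda>z. ((\<lambda>k. if k < d then z k else 0), (\<lambda>k. z (k + d)))"])
      (auto simp: j_def coords_def fun_eq_iff)
  then have "bij_betw (j \<circ> map_prod \<phi> \<psi>) (S \<times> T) (coords (d + e))"
    using bij_betw_trans bij_betw_map_prod[OF \<phi>(2) \<psi>(2)] by blast
  moreover have "clinear_on (S \<times> T) (j \<circ> map_prod \<phi> \<psi>)"
    using \<phi>(1) \<psi>(1) by (auto simp: clinear_on_def j_def fun_eq_iff)
  ultimately show ?thesis unfolding has_dim_def by blast
qed

text \<open>A linear form that takes the value \<open>1\<close> at \<open>u0\<close> splits the space into its kernel and the line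
  through \<open>u0\<close>.\<close>

lemma has_dim_Suc:
  assumes S: "cvec.subspace S" and l: "clinear_on S lf"
    and u0: "u0 \<in> S" "lf u0 = (1 :: complex)" and ker: "has_dim {u \<in> S. lf u = 0} d"
  shows "has_dim S (Suc d)"
proof -
  let ?c = "\<lambda>(z :: complex) k. if k = (0::nat) then z else 0"
  have m: "u - cscale c u0 \<in> S" "u + cscale c u0 \<in> S" if "u \<in> S" for u c
    using S u0 that cvec.subspace_add cvec.subspace_diff cvec.subspace_scale by blast+
  have ldiff: "lf (u - cscale c u0) = lf u - c" "lf (u + cscale c u0) = lf u + c" if "u \<in> S" for u c
  proof -
    have "lf (u - cscale c u0) = lf (u + cscale (-c) u0)"
      by (simp add: cvec.scale_minus_left)
    also have "\<dots> = lf u + (- c) * lf u0"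
      using l u0 that S unfolding clinear_on_def by (simp add: cvec.subspace_scale cvec.scale_minus_left[symmetric] del: cvec.scale_minus_left)
    finally show "lf (u - cscale c u0) = lf u - c" using u0 by simp
    show "lf (u + cscale c u0) = lf u + c"
      using l u0 that S unfolding clinear_on_def by (simp add: cvec.subspace_scale)
  qed
  \<comment> \<open>The projection along \<open>u0\<close> onto the kernel, together with the coordinate on the line.\<close>
  have "bij_betw (\<lambda>u. (u - cscale (lf u) u0, ?c (lf u))) S ({u \<in> S. lf u = 0} \<times> coords 1)"
    by (rule bij_betw_byWitness[where f' = "\<lambda>(u, x). u + cscale (x 0) u0"])
      (auto simp: coords_def fun_eq_iff m ldiff)
  moreover have "clinear_on S (\<lambda>u. (u - cscale (lf u) u0, ?c (lf u)))"
    using l by (auto simp: clinear_on_def fun_eq_iff cscale_add_left cvec.scale_right_diff_distrib)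
  moreover have "has_dim (coords 1) 1"
    unfolding has_dim_def by (intro exI[of _ id]) (auto simp: clinear_on_def)
  ultimately show ?thesis using has_dim_bij has_dim_Times[OF ker] by fastforce
qed

text \<open>The preimages of the unit vectors form a basis with \<open>d\<close> elements, and the exchange lemma compares it
  with any other basis. In particular \<open>d\<close> is determined by the space.\<close>

lemma has_dim_card_basis:
  assumes S: "cvec.subspace S" and d: "has_dim S d"
    and B: "cvec.independent B" "cvec.span B = S"
  shows "finite B \<and> card B = d"
proof -
  obtain \<phi> where \<phi>: "clinear_on S \<phi>" "bij_betw \<phi> S (coords d)"
    using d by (auto simp: has_dim_def)
  define e :: "nat \<Rightarrow> nat \<Rightarrow> complex" where "e = (\<lambda>k i. if i = k then 1 else 0)"
  have eC: "e k \<in> coords d" if "k < d" for k using that by (auto simp: e_def coords_def)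
  define b where "b = (\<lambda>k. the_inv_into S \<phi> (e k))"
  have inj: "inj_on \<phi> S" and im: "\<phi> ` S = coords d" using \<phi>(2) by (auto simp: bij_betw_def)
  have b: "b k \<in> S" "\<phi> (b k) = e k" if "k < d" for k
    using the_inv_into_into[OF inj, of "e k" S] f_the_inv_into_f[OF inj, of "e k"] eC[OF that] im
    by (auto simp: b_def)
  have binj: "inj_on b {..<d}"
  proof (rule inj_onI)
    fix x y assume "x \<in> {..<d}" "y \<in> {..<d}" "b x = b y"
    then have "e x x = e y x" using b by (metis lessThan_iff)
    then show "x = y" by (auto simp: e_def split: if_splits)
  qed
  have inS: "(\<Sum>k\<in>K. cscale (x k) (b k)) \<in> S" and
    \<phi>sum: "\<phi> (\<Sum>k\<in>K. cscale (x k) (b k)) = (\<lambda>i. if i \<in> K then x i else 0)" if "K \<subseteq> {..<d}" for x K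
  proof -
    have "finite K" using that finite_subset by blast
    then have "(\<Sum>k\<in>K. cscale (x k) (b k)) \<in> S \<and> \<phi> (\<Sum>k\<in>K. cscale (x k) (b k)) = (\<lambda>i. if i \<in> K then x i else 0)"
      using that
    proof (induction K rule: finite_induct)
      case empty
      have "\<phi> 0 = 0"
        using \<phi>(1) cvec.subspace_0[OF S] unfolding clinear_on_def by (metis add_cancel_right_right)
      then show ?case using cvec.subspace_0[OF S] by auto
    next
      case (insert k K)
      let ?s = "\<Sum>k\<in>K. cscale (x k) (b k)"
      have k: "b k \<in> S" "\<phi> (b k) = e k" using b insert by auto
      have "\<phi> (cscale (x k) (b k) + ?s) = cscale (x k) (e k) + \<phi> ?s"
        using \<phi>(1) k insert cvec.subspace_scale[OF S] unfolding clinear_on_def by simp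
      then show ?case using insert k cvec.subspace_scale[OF S] cvec.subspace_add[OF S]
        by (auto simp: e_def fun_eq_iff)
    qed
    then show "(\<Sum>k\<in>K. cscale (x k) (b k)) \<in> S" 
      "\<phi> (\<Sum>k\<in>K. cscale (x k) (b k)) = (\<lambda>i. if i \<in> K then x i else 0)" by auto
  qed
  let ?B = "b ` {..<d}"
  have sp: "cvec.span ?B = S"
  proof
    show "cvec.span ?B \<subseteq> S" using b S by (intro cvec.span_minimal) auto
    show "S \<subseteq> cvec.span ?B"
    proof
      fix u assume u: "u \<in> S"
      have "\<phi> u \<in> coords d" using u im by auto
      then have "\<phi> u = \<phi> (\<Sum>k<d. cscale (\<phi> u k) (b k))"
        using \<phi>sum[of "{..<d}" "\<phi> u"] by (auto simp: coords_def fun_eq_iff)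
      then have "u = (\<Sum>k<d. cscale (\<phi> u k) (b k))"
        using inj u inS[of "{..<d}" "\<phi> u"] by (meson inj_onD order_refl)
      moreover have "(\<Sum>k<d. cscale (\<phi> u k) (b k)) \<in> cvec.span ?B"
        by (intro cvec.span_sum cvec.span_scale cvec.span_base) auto
      ultimately show "u \<in> cvec.span ?B" by simp
    qed
  qed
  have ind: "cvec.independent ?B"
  proof (rule cvec.independent_if_scalars_zero)
    show "finite ?B" by simp
    fix f u assume 0: "(\<Sum>v\<in>?B. cscale (f v) v) = 0" and "u \<in> ?B"
    then obtain k where k: "k < d" "u = b k" by auto
    have "(\<Sum>k<d. cscale (f (b k)) (b k)) = 0" using 0 by (simp add: sum.reindex[OF binj])
    moreover have "\<phi> 0 = 0"
      using \<phi>(1) cvec.subspace_0[OF S] unfolding clinear_on_def by (metis add_cancel_right_right)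
    ultimately have "(\<lambda>i. if i \<in> {..<d} then f (b i) else 0) = 0"
      using \<phi>sum[of "{..<d}" "\<lambda>k. f (b k)"] by simp
    from fun_cong[OF this, of k] show "f u = 0" using k by auto
  qed
  have "finite B \<and> card B \<le> card ?B"
    using cvec.independent_span_bound[OF _ B(1), of ?B] sp B(2) cvec.span_superset[of B] by auto
  moreover from this have "card ?B \<le> card B"
    using cvec.independent_span_bound[OF _ ind, of B] sp B(2) cvec.span_superset[of ?B] by auto
  ultimately show ?thesis using card_image[OF binj] by simp
qed

section \<open>Real and complex dimension\<close>

text \<open>Matrices with unknown entries are functions on all pairs of naturals. Requiring zeros outside the
  format makes equality of such functions the same as equality of matrices.\<close>

definition supported :: "nat \<Rightarrow> nat \<Rightarrow> (nat \<Rightarrow> nat \<Rightarrow> complex) set" where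
  "supported r c = {U. \<forall>i j. \<not> (i < r \<and> j < c) \<longrightarrow> U i j = 0}"

lemma cvec_sum_apply: "(\<Sum>x\<in>A. cscale (c x) (f x)) i j = (\<Sum>x\<in>A. c x * (f x i j :: complex))"
  by (induction A rule: infinite_finite_induct) auto

definition complexification :: "nat \<Rightarrow> nat \<Rightarrow> real mat set \<Rightarrow> (nat \<Rightarrow> nat \<Rightarrow> complex) set" where
  "complexification n m S = {U \<in> supported n m.
     mat n m (\<lambda>(i, j). Re (U i j)) \<in> S \<and> mat n m (\<lambda>(i, j). Im (U i j)) \<in> S}"

text \<open>The real matrices span the complexification over \<open>\<complex>\<close>, so they contain a complex basis of it. That
  set is a real basis of the real space: it is linearly independent over \<open>\<complex>\<close>, hence over \<open>\<real>\<close>, and if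
  a real matrix is a complex combination of real matrices, then taking real parts of the coefficients
  gives a real combination with the same value.\<close>

lemma real_dim_eq_complex_dim:
  assumes S: "VectorSpace.subspace class_ring S (module_mat TYPE(real) n m)"
    and d: "has_dim (complexification n m S) d"
  shows "vectorspace.dim class_ring (module_mat TYPE(real) n m\<lparr>carrier := S\<rparr>) = d"
proof -
  let ?W = "module_mat TYPE(real) n m\<lparr>carrier := S\<rparr>" and ?C = "complexification n m S"
  interpret M: vectorspace class_ring "module_mat TYPE(real) n m" by (rule matrix_vs)
  interpret W: vectorspace class_ring ?W by (rule M.subspace_is_vs[OF S])
  have sub: "submodule class_ring S (module_mat TYPE(real) n m)"
    using S by (simp add: VectorSpace.subspace_def)
  have Sm: "S \<subseteq> carrier_mat n m" and S0: "0\<^sub>m n m \<in> S"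
    and Sa: "\<And>X Y. X \<in> S \<Longrightarrow> Y \<in> S \<Longrightarrow> X + Y \<in> S"
    and Ss: "\<And>c X. X \<in> S \<Longrightarrow> c \<cdot>\<^sub>m X \<in> S"
    using sub by (auto simp: submodule_def matrix_vs_simps)
  define emb :: "real mat \<Rightarrow> nat \<Rightarrow> nat \<Rightarrow> complex" where
    "emb X = (\<lambda>i j. if i < n \<and> j < m then of_real (X $$ (i, j)) else 0)" for X
  have inj: "inj_on emb S"
  proof (rule inj_onI)
    fix X Y assume XY: "X \<in> S" "Y \<in> S" "emb X = emb Y"
    have "X $$ (i, j) = Y $$ (i, j)" if "i < n" "j < m" for i j
      using fun_cong[OF fun_cong[OF XY(3)], of i j] that by (simp add: emb_def)
    moreover have "X \<in> carrier_mat n m" "Y \<in> carrier_mat n m" using XY Sm by auto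
    ultimately show "X = Y" by (intro eq_matI) auto
  qed
  have embC: "emb X \<in> ?C" if "X \<in> S" for X
  proof -
    have "mat n m (\<lambda>(i, j). Re (emb X i j)) = X" "mat n m (\<lambda>(i, j). Im (emb X i j)) = 0\<^sub>m n m"
      using that Sm by (auto simp: emb_def intro!: eq_matI)
    then show ?thesis using that S0 by (auto simp: complexification_def supported_def emb_def)
  qed
  have Csub: "cvec.subspace ?C"
  proof (rule cvec.subspaceI)
    have "mat n m (\<lambda>(i, j). 0 :: real) = 0\<^sub>m n m" by (intro eq_matI) auto
    then show "0 \<in> ?C" using S0 by (simp add: complexification_def supported_def)
  next
    fix U V assume "U \<in> ?C" "V \<in> ?C"
    moreover have "mat n m (\<lambda>(i, j). Re ((U + V) i j)) = mat n m (\<lambda>(i, j). Re (U i j)) + mat n m (\<lambda>(i, j). Re (V i j))"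
      "mat n m (\<lambda>(i, j). Im ((U + V) i j)) = mat n m (\<lambda>(i, j). Im (U i j)) + mat n m (\<lambda>(i, j). Im (V i j))"
      by (auto intro!: eq_matI)
    ultimately show "U + V \<in> ?C" using Sa by (auto simp: complexification_def supported_def)
  next
    fix c U assume "U \<in> ?C"
    moreover have "mat n m (\<lambda>(i, j). Re (cscale c U i j))
         = Re c \<cdot>\<^sub>m mat n m (\<lambda>(i, j). Re (U i j)) + (- Im c) \<cdot>\<^sub>m mat n m (\<lambda>(i, j). Im (U i j))"
      "mat n m (\<lambda>(i, j). Im (cscale c U i j))
         = Re c \<cdot>\<^sub>m mat n m (\<lambda>(i, j). Im (U i j)) + Im c \<cdot>\<^sub>m mat n m (\<lambda>(i, j). Re (U i j))"
      by (auto intro!: eq_matI)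
    ultimately show "cscale c U \<in> ?C" using Sa Ss by (auto simp: complexification_def supported_def)
  qed
  \<comment> \<open>A complex basis chosen among the real matrices.\<close>
  obtain B where B: "B \<subseteq> emb ` S" "cvec.independent B" "emb ` S \<subseteq> cvec.span B"
    using cvec.maximal_independent_subset by blast
  have "?C \<subseteq> cvec.span B"
  proof
    fix U assume U: "U \<in> ?C"
    let ?R = "mat n m (\<lambda>(i, j). Re (U i j))" and ?I = "mat n m (\<lambda>(i, j). Im (U i j))"
    have "U = emb ?R + cscale \<i> (emb ?I)"
      using U by (auto simp: emb_def fun_eq_iff complexification_def supported_def complex_eq_iff)
    moreover have "emb ?R \<in> cvec.span B" "emb ?I \<in> cvec.span B"
      using U B(3) by (auto simp: complexification_def)
    ultimately show "U \<in> cvec.span B"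
      by (metis cvec.span_add cvec.span_scale)
  qed
  moreover have "cvec.span B \<subseteq> ?C" using B(1) embC Csub by (intro cvec.span_minimal) auto
  ultimately have "cvec.span B = ?C" by blast
  from has_dim_card_basis[OF Csub d B(2) this] have fB: "finite B" "card B = d" by auto
  define A where "A = {X \<in> S. emb X \<in> B}"
  have AS: "A \<subseteq> S" and AB: "emb ` A = B" using B(1) by (auto simp: A_def)
  have injA: "inj_on emb A" using inj AS by (rule inj_on_subset)
  have fA: "finite A" "card A = d"
    using fB AB injA finite_image_iff card_image by metis+
  have lc: "emb (W.lincomb a K) = (\<Sum>X\<in>K. cscale (of_real (a X)) (emb X)) \<and> W.lincomb a K \<in> S"
    if "K \<subseteq> A" for a K
  proof -
    have "finite K" using that fA finite_subset by blast
    then show ?thesis using that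
    proof (induction K rule: finite_induct)
      case empty
      then show ?case using S0 by (simp add: W.lincomb_def matrix_vs_simps emb_def fun_eq_iff)
    next
      case (insert X K)
      have X: "X \<in> S" "X \<in> carrier_mat n m" using insert AS Sm by auto
      have "W.lincomb a (insert X K) = a X \<cdot>\<^sub>m X + W.lincomb a K"
        unfolding W.lincomb_def
        using insert X AS Ss
        by (subst W.finsum_insert) (auto simp: matrix_vs_simps)
      moreover have "W.lincomb a K \<in> carrier_mat n m" using insert Sm by auto
      then have "emb (a X \<cdot>\<^sub>m X + W.lincomb a K) = cscale (of_real (a X)) (emb X) + emb (W.lincomb a K)"
        using X by (auto simp: emb_def fun_eq_iff)
      ultimately show ?case using insert X Sa Ss by auto
    qed
  qed
  have "W.basis A"
  proof (subst W.basis_criterion[OF fA(1)])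
    show "A \<subseteq> carrier ?W" using AS by simp
    show "\<forall>v. v \<in> carrier ?W \<longrightarrow> (\<exists>!a. a \<in> A \<rightarrow>\<^sub>E carrier class_ring \<and> W.lincomb a A = v)"
    proof (intro allI impI)
      fix v assume "v \<in> carrier ?W"
      then have v: "v \<in> S" by simp
      then have "emb v \<in> cvec.span (emb ` A)" using B(3) AB by auto
      then obtain g where "emb v = (\<Sum>b\<in>emb ` A. cscale (g b) b)"
        using fA by (auto simp: cvec.span_finite)
      then have g: "emb v = (\<Sum>X\<in>A. cscale (g (emb X)) (emb X))"
        by (simp add: sum.reindex[OF injA])
      define a where "a = restrict (\<lambda>X. Re (g (emb X))) A"
      have "emb v i j = (\<Sum>X\<in>A. of_real (a X) * emb X i j)" for i j
      proof -
        have "emb v i j = (\<Sum>X\<in>A. g (emb X) * emb X i j)" by (simp add: g cvec_sum_apply)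
        then have "Re (emb v i j) = Re (\<Sum>X\<in>A. of_real (a X) * emb X i j)"
          by (auto simp: emb_def a_def intro!: sum.cong)
        moreover have "Im (emb v i j) = Im (\<Sum>X\<in>A. of_real (a X) * emb X i j)"
          by (auto simp: emb_def)
        ultimately show ?thesis by (rule complex_eqI)
      qed
      then have "emb v = emb (W.lincomb a A)"
        using lc[of A a] by (simp add: fun_eq_iff cvec_sum_apply)
      then have "W.lincomb a A = v" using inj v lc[of A a] by (metis inj_onD order_refl)
      moreover have "a \<in> A \<rightarrow>\<^sub>E carrier class_ring" by (auto simp: a_def matrix_vs_simps)
      moreover have "b = c" if "b \<in> A \<rightarrow>\<^sub>E carrier class_ring" "c \<in> A \<rightarrow>\<^sub>E carrier class_ring"
        "W.lincomb b A = W.lincomb c A" for b c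
      proof (rule PiE_ext[OF that(1,2)])
        fix X assume X: "X \<in> A"
        have "(\<Sum>X\<in>A. cscale (of_real (b X - c X)) (emb X)) = 0"
          using lc[of A b] lc[of A c] that(3)
          by (simp add: cvec.scale_left_diff_distrib sum_subtractf)
        then have "(\<Sum>x\<in>emb ` A. cscale (of_real (b (inv_into A emb x) - c (inv_into A emb x))) x) = 0"
          using injA by (simp add: sum.reindex)
        from cvec.independentD[OF B(2) _ _ this, of "emb X"] X fB AB injA
        show "b X = c X" by auto
      qed
      ultimately show "\<exists>!a. a \<in> A \<rightarrow>\<^sub>E carrier class_ring \<and> W.lincomb a A = v" by blast
    qed
  qed
  then show ?thesis using W.dim_basis[OF fA(1)] fA(2) by simp
qed

section \<open>The equation attached to a pencil\<close>

text \<open>\<open>const_entry M\<close> and \<open>mu_entry M\<close> are the coefficient matrices \<open>M\<^sub>0\<close> and \<open>M\<^sub>1\<close> of a pencil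
  \<open>M = M\<^sub>0 - \<mu> M\<^sub>1\<close>; the sign of the coefficient of \<open>\<mu>\<close> is absorbed in the second.\<close>

definition const_entry :: "complex poly mat \<Rightarrow> nat \<Rightarrow> nat \<Rightarrow> complex" where
  "const_entry M i j = coeff (M $$ (i, j)) 0"

definition mu_entry :: "complex poly mat \<Rightarrow> nat \<Rightarrow> nat \<Rightarrow> complex" where
  "mu_entry M i j = - coeff (M $$ (i, j)) 1"

text \<open>The entries of \<open>V\<^sup>T B\<^sub>0\<close> and of \<open>A\<^sub>1\<^sup>T U\<close>.\<close>

definition left_term :: "complex poly mat \<Rightarrow> (nat \<Rightarrow> nat \<Rightarrow> complex) \<Rightarrow> nat \<Rightarrow> nat \<Rightarrow> complex" where
  "left_term B V i j = (\<Sum>k<dim_row B. V k i * const_entry B k j)"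

definition right_term :: "complex poly mat \<Rightarrow> (nat \<Rightarrow> nat \<Rightarrow> complex) \<Rightarrow> nat \<Rightarrow> nat \<Rightarrow> complex" where
  "right_term A U i j = (\<Sum>k<dim_row A. mu_entry A k i * U k j)"

text \<open>The equations \<open>V\<^sup>T B\<^sub>0 + A\<^sub>1\<^sup>T U = 0\<close> and \<open>U\<^sup>T A\<^sub>0 + B\<^sub>1\<^sup>T V = 0\<close> for the two off-diagonal blocks of a solution
  that belongs to a direct sum of \<open>A\<close> and \<open>B\<close>.\<close>

definition pair_sol :: "complex poly mat \<Rightarrow> complex poly mat \<Rightarrow>
    ((nat \<Rightarrow> nat \<Rightarrow> complex) \<times> (nat \<Rightarrow> nat \<Rightarrow> complex)) set" where
  "pair_sol A B = {(U, V). U \<in> supported (dim_row A) (dim_col B) \<and> V \<in> supported (dim_row B) (dim_col A) \<and>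
     (\<forall>i<dim_col A. \<forall>j<dim_col B. left_term B V i j + right_term A U i j = 0) \<and>
     (\<forall>i<dim_col B. \<forall>j<dim_col A. left_term A U i j + right_term B V i j = 0)}"

text \<open>The equation \<open>U\<^sup>T A\<^sub>0 + A\<^sub>1\<^sup>T U = 0\<close>.\<close>

definition self_sol :: "complex poly mat \<Rightarrow> (nat \<Rightarrow> nat \<Rightarrow> complex) set" where
  "self_sol A = {U \<in> supported (dim_row A) (dim_col A).
     \<forall>i<dim_col A. \<forall>j<dim_col A. left_term A U i j + right_term A U i j = 0}"

lemma left_term_linear [simp]:
  "left_term B (U + V) i j = left_term B U i j + left_term B V i j"
  "left_term B (cscale c U) i j = c * left_term B U i j"
  by (auto simp: left_term_def sum.distrib algebra_simps sum_distrib_left)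

lemma right_term_linear [simp]:
  "right_term B (U + V) i j = right_term B U i j + right_term B V i j"
  "right_term B (cscale c U) i j = c * right_term B U i j"
  by (auto simp: right_term_def sum.distrib algebra_simps sum_distrib_left)

lemma subspace_self_sol: "cvec.subspace (self_sol A)"
proof (rule cvec.subspaceI)
  show "0 \<in> self_sol A" by (auto simp: self_sol_def supported_def left_term_def right_term_def)
next
  fix U V assume "U \<in> self_sol A" "V \<in> self_sol A"
  then show "U + V \<in> self_sol A"
    by (auto simp: self_sol_def supported_def) (metis (no_types, lifting) add.commute add.left_commute add.right_neutral)
next
  fix c U assume "U \<in> self_sol A"
  then show "cscale c U \<in> self_sol A"
    by (auto simp: self_sol_def supported_def simp flip: distrib_left)
qed

lemma has_dim_pair_sol_swap:
  assumes "has_dim (pair_sol A B) d" shows "has_dim (pair_sol B A) d"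
proof (rule has_dim_bij[OF _ _ assms])
  show "clinear_on (pair_sol B A) prod.swap" by (auto simp: clinear_on_def)
  show "bij_betw prod.swap (pair_sol B A) (pair_sol A B)"
    by (rule bij_betw_byWitness[where f' = prod.swap]) (auto simp: pair_sol_def)
qed

section \<open>Direct sums of pencils\<close>

definition direct_sum :: "complex poly mat \<Rightarrow> complex poly mat \<Rightarrow> complex poly mat" where
  "direct_sum A B = four_block_mat A (0\<^sub>m (dim_row A) (dim_col B)) (0\<^sub>m (dim_row B) (dim_col A)) B"

lemma diag_block_mat_Cons_direct_sum: "diag_block_mat (A # As) = direct_sum A (diag_block_mat As)"
  by (simp add: direct_sum_def Let_def)

lemma dim_direct_sum [simp]:
  "dim_row (direct_sum A B) = dim_row A + dim_row B" "dim_col (direct_sum A B) = dim_col A + dim_col B"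
  by (auto simp: direct_sum_def)

lemma sum_lessThan_add:
  fixes f :: "nat \<Rightarrow> 'a :: comm_monoid_add"
  shows "(\<Sum>k<a + b. f k) = (\<Sum>k<a. f k) + (\<Sum>k<b. f (a + k))"
  by (induction b) (auto simp: add_ac)

lemma entry_direct_sum:
  assumes "i < dim_row A + dim_row B" "j < dim_col A + dim_col B"
  shows "const_entry (direct_sum A B) i j = (if i < dim_row A then if j < dim_col A then const_entry A i j else 0
      else if j < dim_col A then 0 else const_entry B (i - dim_row A) (j - dim_col A))"
    "mu_entry (direct_sum A B) i j = (if i < dim_row A then if j < dim_col A then mu_entry A i j else 0
      else if j < dim_col A then 0 else mu_entry B (i - dim_row A) (j - dim_col A))"
  using assms by (auto simp: const_entry_def mu_entry_def direct_sum_def)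

lemma left_term_direct_sum:
  assumes "j < dim_col A + dim_col B"
  shows "left_term (direct_sum A B) V i j = (if j < dim_col A then left_term A V i j
    else left_term B (\<lambda>k. V (dim_row A + k)) i (j - dim_col A))"
  using assms by (auto simp: left_term_def sum_lessThan_add entry_direct_sum)

lemma right_term_direct_sum:
  assumes "i < dim_col A + dim_col B"
  shows "right_term (direct_sum A B) V i j = (if i < dim_col A then right_term A V i j
    else right_term B (\<lambda>k. V (dim_row A + k)) (i - dim_col A) j)"
  using assms by (auto simp: right_term_def sum_lessThan_add entry_direct_sum)

text \<open>\<open>block r0 c0 r c U\<close> is the submatrix of format \<open>r \<times> c\<close> whose corner sits at position \<open>(r0, c0)\<close>;
  \<open>glue\<close> is the inverse operation for a division into four blocks.\<close>

definition block :: "nat \<Rightarrow> nat \<Rightarrow> nat \<Rightarrow> nat \<Rightarrow> (nat \<Rightarrow> nat \<Rightarrow> complex) \<Rightarrow> nat \<Rightarrow> nat \<Rightarrow> complex" where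
  "block r0 c0 r c U = (\<lambda>i j. if i < r \<and> j < c then U (r0 + i) (c0 + j) else 0)"

definition glue :: "nat \<Rightarrow> nat \<Rightarrow> (nat \<Rightarrow> nat \<Rightarrow> complex) \<Rightarrow> (nat \<Rightarrow> nat \<Rightarrow> complex) \<Rightarrow>
    (nat \<Rightarrow> nat \<Rightarrow> complex) \<Rightarrow> (nat \<Rightarrow> nat \<Rightarrow> complex) \<Rightarrow> nat \<Rightarrow> nat \<Rightarrow> complex" where
  "glue r c U11 U12 U21 U22 = (\<lambda>i j. if i < r then if j < c then U11 i j else U12 i (j - c)
     else if j < c then U21 (i - r) j else U22 (i - r) (j - c))"

lemma left_term_block: "i < c \<Longrightarrow> left_term B (block r0 c0 (dim_row B) c V) i j = left_term B (\<lambda>k. V (r0 + k)) (c0 + i) j"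
  by (auto simp: left_term_def block_def)

lemma right_term_block: "j < c \<Longrightarrow> right_term B (block r0 c0 (dim_row B) c V) i j = right_term B (\<lambda>k. V (r0 + k)) i (c0 + j)"
  by (auto simp: right_term_def block_def)

lemma left_term_glue:
  "left_term A (glue (dim_row A) c U11 U12 U21 U22) i j = (if i < c then left_term A U11 i j else left_term A U12 (i - c) j)"
  "left_term B (\<lambda>k. glue r c U11 U12 U21 U22 (r + k)) i j = (if i < c then left_term B U21 i j else left_term B U22 (i - c) j)"
  by (auto simp: left_term_def glue_def)

lemma right_term_glue:
  "right_term A (glue (dim_row A) c U11 U12 U21 U22) i j = (if j < c then right_term A U11 i j else right_term A U12 i (j - c))"
  "right_term B (\<lambda>k. glue r c U11 U12 U21 U22 (r + k)) i j = (if j < c then right_term B U21 i j else right_term B U22 i (j - c))"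
  by (auto simp: right_term_def glue_def)

lemma block_linear:
  "block r0 c0 r c (U + V) = block r0 c0 r c U + block r0 c0 r c V"
  "block r0 c0 r c (cscale x U) = cscale x (block r0 c0 r c U)"
  by (auto simp: block_def fun_eq_iff)

lemma block_supported: "block r0 c0 r c U \<in> supported r c"
  by (auto simp: block_def supported_def)

lemma glue_supported:
  assumes "U11 \<in> supported r c" "U12 \<in> supported r c'" "U21 \<in> supported r' c" "U22 \<in> supported r' c'"
  shows "glue r c U11 U12 U21 U22 \<in> supported (r + r') (c + c')"
  using assms by (auto simp: glue_def supported_def not_less less_diff_conv2 le_diff_conv2 add.commute)

lemma glue_blocks:
  assumes "U \<in> supported (r + r') (c + c')"
  shows "glue r c (block 0 0 r c U) (block 0 c r c' U) (block r 0 r' c U) (block r c r' c' U) = U"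
  using assms by (auto simp: glue_def block_def supported_def fun_eq_iff not_less)

lemma block_glue:
  "U11 \<in> supported r c \<Longrightarrow> block 0 0 r c (glue r c U11 U12 U21 U22) = U11"
  "U12 \<in> supported r c' \<Longrightarrow> block 0 c r c' (glue r c U11 U12 U21 U22) = U12"
  "U21 \<in> supported r' c \<Longrightarrow> block r 0 r' c (glue r c U11 U12 U21 U22) = U21"
  "U22 \<in> supported r' c' \<Longrightarrow> block r c r' c' (glue r c U11 U12 U21 U22) = U22"
  by (auto simp: glue_def block_def supported_def fun_eq_iff)

text \<open>The four blocks of the equation for \<open>A \<oplus> B\<close> decouple: the diagonal ones are the equations for \<open>A\<close>
  and for \<open>B\<close>, and the off-diagonal ones are the two equations of the pair.\<close>

lemma has_dim_self_sol_direct_sum: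
  assumes "has_dim (self_sol A) a" "has_dim (pair_sol A B) p" "has_dim (self_sol B) b"
  shows "has_dim (self_sol (direct_sum A B)) (a + p + b)"
proof -
  let ?r = "dim_row A" and ?c = "dim_col A" and ?r' = "dim_row B" and ?c' = "dim_col B"
  define f where "f U = ((block 0 0 ?r ?c U, (block 0 ?c ?r ?c' U, block ?r 0 ?r' ?c U)), block ?r ?c ?r' ?c' U)" for U
  define g where "g = (\<lambda>((U11, (U12, U21)), U22). glue ?r ?c U11 U12 U21 U22)"
  have fS: "f U \<in> (self_sol A \<times> pair_sol A B) \<times> self_sol B" if "U \<in> self_sol (direct_sum A B)" for U
  proof -
    have eq: "left_term (direct_sum A B) U i j + right_term (direct_sum A B) U i j = 0" if "i < ?c + ?c'" "j < ?c + ?c'" for i j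
      using \<open>U \<in> self_sol (direct_sum A B)\<close> that by (auto simp: self_sol_def)
    have "left_term A U i j + right_term A U i j = 0" if "i < ?c" "j < ?c" for i j
      using eq[of i j] that by (auto simp: left_term_direct_sum right_term_direct_sum)
    moreover have "left_term B (\<lambda>k. U (?r + k)) i j + right_term A U i (?c + j) = 0"
      "left_term A U (?c + j) i + right_term B (\<lambda>k. U (?r + k)) j i = 0" if "i < ?c" "j < ?c'" for i j
      using eq[of i "?c + j"] eq[of "?c + j" i] that by (auto simp: left_term_direct_sum right_term_direct_sum)
    moreover have "left_term B (\<lambda>k. U (?r + k)) (?c + i) j + right_term B (\<lambda>k. U (?r + k)) i (?c + j) = 0"
      if "i < ?c'" "j < ?c'" for i j
      using eq[of "?c + i" "?c + j"] that by (auto simp: left_term_direct_sum right_term_direct_sum)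
    ultimately show ?thesis
      by (auto simp: f_def self_sol_def pair_sol_def block_supported left_term_block right_term_block)
  qed
  have gS: "g x \<in> self_sol (direct_sum A B)" if "x \<in> (self_sol A \<times> pair_sol A B) \<times> self_sol B" for x
    using that
    by (auto simp: g_def self_sol_def pair_sol_def left_term_direct_sum right_term_direct_sum glue_supported left_term_glue right_term_glue)
  have "bij_betw f (self_sol (direct_sum A B)) ((self_sol A \<times> pair_sol A B) \<times> self_sol B)"
  proof (rule bij_betw_byWitness[where f' = g])
    show "\<forall>U\<in>self_sol (direct_sum A B). g (f U) = U"
      by (auto simp: f_def g_def self_sol_def glue_blocks)
    show "\<forall>x\<in>(self_sol A \<times> pair_sol A B) \<times> self_sol B. f (g x) = x"
      by (auto simp: f_def g_def self_sol_def pair_sol_def block_glue)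
  qed (use fS gS in blast)+
  moreover have "clinear_on (self_sol (direct_sum A B)) f"
    by (auto simp: clinear_on_def f_def block_linear)
  ultimately show ?thesis
    using has_dim_bij has_dim_Times[OF has_dim_Times[OF assms(1,2)] assms(3)] by blast
qed

text \<open>Here \<open>U\<close> is divided by columns only and \<open>V\<close> by rows only, which is why the blocks of height or
  width \<open>0\<close> in \<open>glue\<close> are filled with \<open>0\<close>.\<close>

lemma has_dim_pair_sol_direct_sum:
  assumes "has_dim (pair_sol X A) a" "has_dim (pair_sol X B) b"
  shows "has_dim (pair_sol X (direct_sum A B)) (a + b)"
proof -
  let ?r = "dim_row A" and ?c = "dim_col A" and ?r' = "dim_row B" and ?c' = "dim_col B"
  let ?q = "dim_row X" and ?p = "dim_col X"
  define f where "f = (\<lambda>(U, V). ((block 0 0 ?q ?c U, block 0 0 ?r ?p V), (block 0 ?c ?q ?c' U, block ?r 0 ?r' ?p V)))"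
  define g where "g = (\<lambda>((U1, V1), (U2, V2)). (glue ?q ?c U1 U2 0 0, glue ?r ?p V1 0 V2 0))"
  have 0: "0 \<in> supported 0 k" "0 \<in> supported k 0" for k by (auto simp: supported_def)
  have fS: "f x \<in> pair_sol X A \<times> pair_sol X B" if x: "x \<in> pair_sol X (direct_sum A B)" for x
  proof (cases x)
    case [simp]: (Pair U V)
    have eq: "left_term (direct_sum A B) V i j + right_term X U i j = 0" if "i < ?p" "j < ?c + ?c'" for i j
      using x that by (auto simp: pair_sol_def)
    have eq': "left_term X U i j + right_term (direct_sum A B) V i j = 0" if "j < ?p" "i < ?c + ?c'" for i j
      using x that by (auto simp: pair_sol_def)
    have "left_term A V i j + right_term X U i j = 0" "left_term X U j i + right_term A V j i = 0" if "i < ?p" "j < ?c" for i j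
      using eq[of i j] eq'[of i j] that by (auto simp: left_term_direct_sum right_term_direct_sum)
    moreover have "left_term B (\<lambda>k. V (?r + k)) i j + right_term X U i (?c + j) = 0"
      "left_term X U (?c + j) i + right_term B (\<lambda>k. V (?r + k)) j i = 0" if "i < ?p" "j < ?c'" for i j
      using eq[of i "?c + j"] eq'[of i "?c + j"] that by (auto simp: left_term_direct_sum right_term_direct_sum)
    ultimately show ?thesis
      by (auto simp: f_def pair_sol_def block_supported left_term_block right_term_block)
  qed
  have gS: "g x \<in> pair_sol X (direct_sum A B)" if "x \<in> pair_sol X A \<times> pair_sol X B" for x
    using that glue_supported[OF _ _ 0(1) 0(1), of _ ?q ?c _ ?c'] glue_supported[OF _ 0(2) _ 0(2), of _ ?r ?p _ ?r']
    by (auto simp: g_def pair_sol_def left_term_direct_sum right_term_direct_sum left_term_glue right_term_glue)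
  have "bij_betw f (pair_sol X (direct_sum A B)) (pair_sol X A \<times> pair_sol X B)"
  proof (rule bij_betw_byWitness[where f' = g])
    show "\<forall>x\<in>pair_sol X (direct_sum A B). g (f x) = x"
      by (auto simp: f_def g_def pair_sol_def supported_def glue_def block_def fun_eq_iff not_less)
    show "\<forall>x\<in>pair_sol X A \<times> pair_sol X B. f (g x) = x"
      by (auto simp: f_def g_def pair_sol_def block_glue)
  qed (use fS gS in blast)+
  moreover have "clinear_on (pair_sol X (direct_sum A B)) f"
    by (auto simp: clinear_on_def f_def block_linear)
  ultimately show ?thesis
    using has_dim_bij has_dim_Times[OF assms] by blast
qed

section \<open>Invariance under strict equivalence\<close>

definition const_part :: "complex poly mat \<Rightarrow> complex mat" where
  "const_part M = mat (dim_row M) (dim_col M) (\<lambda>(i, j). const_entry M i j)"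

definition mu_part :: "complex poly mat \<Rightarrow> complex mat" where
  "mu_part M = mat (dim_row M) (dim_col M) (\<lambda>(i, j). mu_entry M i j)"

definition to_mat :: "nat \<Rightarrow> nat \<Rightarrow> (nat \<Rightarrow> nat \<Rightarrow> complex) \<Rightarrow> complex mat" where
  "to_mat r c U = mat r c (\<lambda>(i, j). U i j)"

definition of_mat :: "complex mat \<Rightarrow> nat \<Rightarrow> nat \<Rightarrow> complex" where
  "of_mat A = (\<lambda>i j. if i < dim_row A \<and> j < dim_col A then A $$ (i, j) else 0)"

lemma part_carrier [simp]:
  "const_part M \<in> carrier_mat (dim_row M) (dim_col M)" "mu_part M \<in> carrier_mat (dim_row M) (dim_col M)"
  "dim_row (const_part M) = dim_row M" "dim_col (const_part M) = dim_col M"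
  "dim_row (mu_part M) = dim_row M" "dim_col (mu_part M) = dim_col M"
  by (auto simp: const_part_def mu_part_def)

lemma to_mat_carrier [simp]: "to_mat r c U \<in> carrier_mat r c"
  "dim_row (to_mat r c U) = r" "dim_col (to_mat r c U) = c"
  by (auto simp: to_mat_def)

lemma of_mat_supported: "A \<in> carrier_mat r c \<Longrightarrow> of_mat A \<in> supported r c"
  by (auto simp: of_mat_def supported_def)

lemma of_mat_to_mat: "U \<in> supported r c \<Longrightarrow> of_mat (to_mat r c U) = U"
  by (auto simp: of_mat_def to_mat_def supported_def fun_eq_iff)

lemma to_mat_of_mat: "A \<in> carrier_mat r c \<Longrightarrow> to_mat r c (of_mat A) = A"
  by (auto simp: of_mat_def to_mat_def)

lemma to_mat_linear: "to_mat r c (U + V) = to_mat r c U + to_mat r c V"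
  "to_mat r c (cscale x U) = x \<cdot>\<^sub>m to_mat r c U"
  by (auto simp: to_mat_def)

lemma of_mat_linear: "A \<in> carrier_mat r c \<Longrightarrow> B \<in> carrier_mat r c \<Longrightarrow> of_mat (A + B) = of_mat A + of_mat B"
  "of_mat (x \<cdot>\<^sub>m A) = cscale x (of_mat A)"
  by (auto simp: of_mat_def fun_eq_iff)

definition pencil_form :: "complex mat \<Rightarrow> complex mat \<Rightarrow> complex mat \<Rightarrow> complex mat \<Rightarrow> complex mat" where
  "pencil_form B V A U = transpose_mat V * B + transpose_mat A * U"

lemma pencil_form_eq_0:
  "pencil_form (const_part B) (to_mat (dim_row B) a V) (mu_part A) (to_mat (dim_row A) b U) = 0\<^sub>m a b \<longleftrightarrow>
    (\<forall>i<a. \<forall>j<b. left_term B V i j + right_term A U i j = 0)"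
  if "a = dim_col A" "b = dim_col B"
proof -
  have "pencil_form (const_part B) (to_mat (dim_row B) a V) (mu_part A) (to_mat (dim_row A) b U)
      = mat a b (\<lambda>(i, j). left_term B V i j + right_term A U i j)"
    using that by (intro eq_matI) (auto simp: pencil_form_def const_part_def mu_part_def to_mat_def left_term_def right_term_def
        scalar_prod_def atLeast0LessThan intro!: arg_cong2[where f = "(+)"] sum.cong)
  also have "\<dots> = 0\<^sub>m a b \<longleftrightarrow> (\<forall>i<a. \<forall>j<b. left_term B V i j + right_term A U i j = 0)"
    by (auto simp: mat_eq_iff)
  finally show ?thesis .
qed

lemma self_sol_form: "self_sol A = {U \<in> supported (dim_row A) (dim_col A).
    pencil_form (const_part A) (to_mat (dim_row A) (dim_col A) U) (mu_part A) (to_mat (dim_row A) (dim_col A) U)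
      = 0\<^sub>m (dim_col A) (dim_col A)}"
  by (simp add: self_sol_def pencil_form_eq_0)

lemma pair_sol_form: "pair_sol A B = {(U, V). U \<in> supported (dim_row A) (dim_col B) \<and> V \<in> supported (dim_row B) (dim_col A) \<and>
    pencil_form (const_part B) (to_mat (dim_row B) (dim_col A) V) (mu_part A) (to_mat (dim_row A) (dim_col B) U)
      = 0\<^sub>m (dim_col A) (dim_col B) \<and>
    pencil_form (const_part A) (to_mat (dim_row A) (dim_col B) U) (mu_part B) (to_mat (dim_row B) (dim_col A) V)
      = 0\<^sub>m (dim_col B) (dim_col A)}"
  by (simp add: pair_sol_def pencil_form_eq_0)

definition mat_inverses :: "nat \<Rightarrow> complex mat \<Rightarrow> complex mat \<Rightarrow> bool" where
  "mat_inverses r P P' \<longleftrightarrow> P \<in> carrier_mat r r \<and> P' \<in> carrier_mat r r \<and> P * P' = 1\<^sub>m r \<and> P' * P = 1\<^sub>m r"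

definition equiv_by :: "complex poly mat \<Rightarrow> complex poly mat \<Rightarrow> complex mat \<Rightarrow> complex mat \<Rightarrow> complex mat \<Rightarrow> complex mat \<Rightarrow> bool" where
  "equiv_by M N P P' Q Q' \<longleftrightarrow> dim_row N = dim_row M \<and> dim_col N = dim_col M \<and>
     mat_inverses (dim_row M) P P' \<and> mat_inverses (dim_col M) Q Q' \<and>
     const_part N = P * const_part M * Q \<and> mu_part N = P * mu_part M * Q"

lemma mat_mult_assoc:
  fixes A :: "complex mat"
  assumes "dim_col A = dim_row B" "dim_col B = dim_row C"
  shows "A * B * C = A * (B * C)"
  using assms by (intro assoc_mult_mat[of A "dim_row A" "dim_row B" B "dim_row C" C "dim_col C"]) auto

lemma mat_inverses_cancel:
  assumes "mat_inverses r P P'"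
  shows "dim_row X = r \<Longrightarrow> P' * (P * X) = X" "dim_col X = r \<Longrightarrow> X * P * P' = X"
proof -
  have P: "P \<in> carrier_mat r r" "P' \<in> carrier_mat r r" "P * P' = 1\<^sub>m r" "P' * P = 1\<^sub>m r"
    using assms by (auto simp: mat_inverses_def)
  show "P' * (P * X) = X" if "dim_row X = r"
    using P that mat_mult_assoc[of P' P X] left_mult_one_mat[of X r "dim_col X"] by auto
  show "X * P * P' = X" if "dim_col X = r"
    using P that mat_mult_assoc[of X P P'] right_mult_one_mat[of X "dim_row X" r] by auto
qed

lemma mult_inverses:
  assumes "mat_inverses r P P'" "mat_inverses c Q Q'" "A \<in> carrier_mat r c"
  shows "P' * (P * A * Q) * Q' = A"
proof -
  have "dim_col P = r" "dim_row P = r" "dim_row P' = r" "dim_col P' = r"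
    "dim_row Q = c" "dim_col Q = c" "dim_row Q' = c" "dim_col Q' = c" "dim_row A = r" "dim_col A = c"
    using assms by (auto simp: mat_inverses_def)
  then show ?thesis
    using mat_inverses_cancel(1)[OF assms(1), of A] mat_inverses_cancel(2)[OF assms(2), of A]
    by (simp add: mat_mult_assoc)
qed

lemma equiv_by_sym: "equiv_by M N P P' Q Q' \<Longrightarrow> equiv_by N M P' P Q' Q"
  using mult_inverses[of "dim_row M" P P' "dim_col M" Q Q' "const_part M"] mult_inverses[of "dim_row M" P P' "dim_col M" Q Q' "mu_part M"]
  by (auto simp: equiv_by_def mat_inverses_def)

lemma equiv_by_refl: "equiv_by M M (1\<^sub>m (dim_row M)) (1\<^sub>m (dim_row M)) (1\<^sub>m (dim_col M)) (1\<^sub>m (dim_col M))"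
  by (auto simp: equiv_by_def mat_inverses_def)

text \<open>If \<open>A\<^sub>2 = P A Q\<close> and \<open>B\<^sub>2 = R B S\<close>, then the substitution \<open>V \<mapsto> R\<^sup>-\<^sup>T V Q\<close>, \<open>U \<mapsto> P\<^sup>-\<^sup>T U S\<close> multiplies
  \<open>V\<^sup>T B\<^sub>0 + A\<^sub>1\<^sup>T U\<close> by \<open>Q\<^sup>T\<close> from the left and by \<open>S\<close> from the right. Both equations of a pair, and the
  equation of a single pencil, are instances.\<close>

lemma pencil_form_equiv:
  assumes A: "equiv_by A A2 P P' Q Q'" and B: "equiv_by B B2 R R' S S'"
    and V: "V \<in> carrier_mat (dim_row B) (dim_col A)" and U: "U \<in> carrier_mat (dim_row A) (dim_col B)"
    and 0: "pencil_form (const_part B) V (mu_part A) U = 0\<^sub>m (dim_col A) (dim_col B)"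
  shows "pencil_form (const_part B2) (transpose_mat R' * V * Q) (mu_part A2) (transpose_mat P' * U * S) = 0\<^sub>m (dim_col A) (dim_col B)"
proof -
  let ?T = "transpose_mat"
  let ?ra = "dim_row A" and ?ca = "dim_col A" and ?rb = "dim_row B" and ?cb = "dim_col B"
  have c: "P \<in> carrier_mat ?ra ?ra" "P' \<in> carrier_mat ?ra ?ra" "Q \<in> carrier_mat ?ca ?ca"
    "R \<in> carrier_mat ?rb ?rb" "R' \<in> carrier_mat ?rb ?rb" "S \<in> carrier_mat ?cb ?cb"
    and e: "R' * R = 1\<^sub>m ?rb" "P' * P = 1\<^sub>m ?ra" "const_part B2 = R * const_part B * S" "mu_part A2 = P * mu_part A * Q"
    using A B by (auto simp: equiv_by_def mat_inverses_def)
  have d: "dim_row P = ?ra" "dim_col P = ?ra" "dim_row P' = ?ra" "dim_col P' = ?ra"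
    "dim_row Q = ?ca" "dim_col Q = ?ca" "dim_row R = ?rb" "dim_col R = ?rb" "dim_row R' = ?rb" "dim_col R' = ?rb"
    "dim_row S = ?cb" "dim_col S = ?cb" "dim_row V = ?rb" "dim_col V = ?ca" "dim_row U = ?ra" "dim_col U = ?cb"
    using c V U by auto
  have T: "?T (X * Y) = ?T Y * ?T X" if "dim_col X = dim_row Y" for X Y :: "complex mat"
    using that by (intro transpose_mult[of X "dim_row X" "dim_row Y" Y "dim_col Y"]) auto
  have RR: "mat_inverses ?rb R R'" and PP: "mat_inverses ?ra P P'"
    using A B by (auto simp: equiv_by_def)
  have PT: "?T P * (?T P' * X) = X" if "dim_row X = ?ra" for X
  proof -
    have "?T P * ?T P' = 1\<^sub>m ?ra" using T[of P' P] e(2) d by simp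
    then show ?thesis using that d mat_mult_assoc[of "?T P" "?T P'" X] left_mult_one_mat[of X ?ra "dim_col X"] by auto
  qed
  have 1: "?T (?T R' * V * Q) * const_part B2 = ?T Q * (?T V * const_part B) * S"
    by (simp add: e(3) T d mat_mult_assoc mat_inverses_cancel(1)[OF RR])
  have 2: "?T (mu_part A2) * (?T P' * U * S) = ?T Q * (?T (mu_part A) * U) * S"
    by (simp add: e(4) T d mat_mult_assoc PT)
  note c = c V U part_carrier(1)[of B] part_carrier(2)[of A]
  have "pencil_form (const_part B2) (?T R' * V * Q) (mu_part A2) (?T P' * U * S) = ?T Q * pencil_form (const_part B) V (mu_part A) U * S"
  proof -
    define E F where "E = ?T V * const_part B" and "F = ?T (mu_part A) * U"
    have "E \<in> carrier_mat ?ca ?cb" "F \<in> carrier_mat ?ca ?cb" "?T Q \<in> carrier_mat ?ca ?ca"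
      using c unfolding E_def F_def by auto
    then have "?T Q * E * S + ?T Q * F * S = ?T Q * (E + F) * S"
      using c by (simp add: mult_add_distrib_mat[of _ ?ca ?ca _ ?cb] add_mult_distrib_mat[of _ ?ca ?cb])
    then show ?thesis unfolding pencil_form_def 1 2 E_def F_def .
  qed
  then show ?thesis using 0 c by simp
qed

text \<open>The substitution \<open>U \<mapsto> P\<^sup>T U Q\<close> on entries. It is applied with \<open>P\<close> inverted.\<close>

definition sandwich :: "complex mat \<Rightarrow> complex mat \<Rightarrow> (nat \<Rightarrow> nat \<Rightarrow> complex) \<Rightarrow> nat \<Rightarrow> nat \<Rightarrow> complex" where
  "sandwich P Q U = of_mat (transpose_mat P * to_mat (dim_row P) (dim_row Q) U * Q)"

lemma sandwich_linear:
  assumes "P \<in> carrier_mat r r" "Q \<in> carrier_mat c c"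
  shows "sandwich P Q (U + V) = sandwich P Q U + sandwich P Q V"
    "sandwich P Q (cscale x U) = cscale x (sandwich P Q U)"
proof -
  have T: "transpose_mat P \<in> carrier_mat r r" using assms by simp
  show "sandwich P Q (U + V) = sandwich P Q U + sandwich P Q V"
    using assms T unfolding sandwich_def to_mat_linear
    by (simp add: mult_add_distrib_mat[of _ r r _ c] add_mult_distrib_mat[of _ r c]
        of_mat_linear(1)[OF mult_carrier_mat[OF mult_carrier_mat[OF T]] mult_carrier_mat[OF mult_carrier_mat[OF T]], OF to_mat_carrier(1) assms(2) to_mat_carrier(1) assms(2)])
  show "sandwich P Q (cscale x U) = cscale x (sandwich P Q U)"
    using assms T unfolding sandwich_def to_mat_linear
    by (simp add: of_mat_linear(2)[symmetric] mult_smult_distrib[of _ r r _ c] mult_smult_assoc_mat[of _ r c])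
qed

lemma sandwich_supported:
  "P \<in> carrier_mat r r \<Longrightarrow> Q \<in> carrier_mat c c \<Longrightarrow> sandwich P Q U \<in> supported r c"
  unfolding sandwich_def by (intro of_mat_supported mult_carrier_mat[of _ r c] mult_carrier_mat[of _ r r]) auto

lemma to_mat_sandwich:
  "P \<in> carrier_mat r r \<Longrightarrow> Q \<in> carrier_mat c c \<Longrightarrow>
    to_mat r c (sandwich P Q U) = transpose_mat P * to_mat r c U * Q"
  unfolding sandwich_def by (subst to_mat_of_mat) auto

lemma sandwich_sandwich:
  assumes "mat_inverses r P P'" "mat_inverses c Q Q'" "U \<in> supported r c"
  shows "sandwich P Q' (sandwich P' Q U) = U"
proof -
  have c: "P \<in> carrier_mat r r" "P' \<in> carrier_mat r r" "Q \<in> carrier_mat c c" "Q' \<in> carrier_mat c c"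
    using assms by (auto simp: mat_inverses_def)
  have "transpose_mat P' * transpose_mat P = 1\<^sub>m r" "transpose_mat P * transpose_mat P' = 1\<^sub>m r"
    using assms(1) transpose_mult[of P r r P' r] transpose_mult[of P' r r P r]
    unfolding mat_inverses_def by (metis transpose_one)+
  then have "mat_inverses r (transpose_mat P') (transpose_mat P)"
    using c by (simp add: mat_inverses_def)
  then have "transpose_mat P * (transpose_mat P' * to_mat r c U * Q) * Q' = to_mat r c U"
    using assms by (intro mult_inverses) auto
  then show ?thesis
    using c to_mat_sandwich[OF c(2,3), of U] assms(3) by (simp add: sandwich_def[of P Q'] of_mat_to_mat)
qed

lemma has_dim_self_sol_equiv:
  assumes E: "equiv_by A B P P' Q Q'" and d: "has_dim (self_sol B) d"
  shows "has_dim (self_sol A) d"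
proof (rule has_dim_bij[OF _ _ d])
  note E' = equiv_by_sym[OF E]
  let ?r = "dim_row A" and ?c = "dim_col A"
  have i: "mat_inverses ?r P P'" "mat_inverses ?c Q Q'" "mat_inverses ?r P' P" "mat_inverses ?c Q' Q"
    and dims: "dim_row B = ?r" "dim_col B = ?c"
    using E by (auto simp: equiv_by_def mat_inverses_def)
  have c: "P \<in> carrier_mat ?r ?r" "P' \<in> carrier_mat ?r ?r" "Q \<in> carrier_mat ?c ?c" "Q' \<in> carrier_mat ?c ?c"
    using i by (auto simp: mat_inverses_def)
  show "clinear_on (self_sol A) (sandwich P' Q)"
    using sandwich_linear[OF c(2,3)] by (auto simp: clinear_on_def)
  show "bij_betw (sandwich P' Q) (self_sol A) (self_sol B)"
  proof (rule bij_betw_byWitness[where f' = "sandwich P Q'"])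
    show "\<forall>U\<in>self_sol A. sandwich P Q' (sandwich P' Q U) = U"
      using i sandwich_sandwich by (auto simp: self_sol_def)
    show "\<forall>U\<in>self_sol B. sandwich P' Q (sandwich P Q' U) = U"
      using i sandwich_sandwich dims by (auto simp: self_sol_def)
    show "sandwich P' Q ` self_sol A \<subseteq> self_sol B"
      using pencil_form_equiv[OF E E, OF to_mat_carrier(1) to_mat_carrier(1)] c
      by (auto simp: self_sol_form dims sandwich_supported to_mat_sandwich)
    show "sandwich P Q' ` self_sol B \<subseteq> self_sol A"
      using pencil_form_equiv[OF E' E', OF to_mat_carrier(1) to_mat_carrier(1)] c
      by (auto simp: self_sol_form dims sandwich_supported to_mat_sandwich)
  qed
qed

lemma has_dim_pair_sol_equiv:
  assumes E: "equiv_by A B P P' Q Q'" and d: "has_dim (pair_sol X B) d"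
  shows "has_dim (pair_sol X A) d"
proof (rule has_dim_bij[OF _ _ d])
  note E' = equiv_by_sym[OF E]
  let ?r = "dim_row A" and ?c = "dim_col A" and ?q = "dim_row X" and ?p = "dim_col X"
  have i: "mat_inverses ?r P P'" "mat_inverses ?c Q Q'" "mat_inverses ?r P' P" "mat_inverses ?c Q' Q"
     "mat_inverses ?q (1\<^sub>m ?q) (1\<^sub>m ?q)" "mat_inverses ?p (1\<^sub>m ?p) (1\<^sub>m ?p)"
    and dims: "dim_row B = ?r" "dim_col B = ?c"
    using E by (auto simp: equiv_by_def mat_inverses_def)
  have c: "P \<in> carrier_mat ?r ?r" "P' \<in> carrier_mat ?r ?r" "Q \<in> carrier_mat ?c ?c" "Q' \<in> carrier_mat ?c ?c"
    "1\<^sub>m ?q \<in> carrier_mat ?q ?q" "1\<^sub>m ?p \<in> carrier_mat ?p ?p"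
    using i by (auto simp: mat_inverses_def)
  let ?f = "\<lambda>P' Q. map_prod (sandwich (1\<^sub>m ?q) Q) (sandwich P' (1\<^sub>m ?p))"
  show "clinear_on (pair_sol X A) (?f P' Q)"
    using sandwich_linear[OF c(5,3)] sandwich_linear[OF c(2,6)] by (auto simp: clinear_on_def)
  show "bij_betw (?f P' Q) (pair_sol X A) (pair_sol X B)"
  proof (rule bij_betw_byWitness[where f' = "?f P Q'"])
    show "\<forall>U\<in>pair_sol X A. ?f P Q' (?f P' Q U) = U"
      using i sandwich_sandwich by (auto simp: pair_sol_def)
    show "\<forall>U\<in>pair_sol X B. ?f P' Q (?f P Q' U) = U"
      using i sandwich_sandwich dims by (auto simp: pair_sol_def)
    show "?f P' Q ` pair_sol X A \<subseteq> pair_sol X B"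
      using pencil_form_equiv[OF E equiv_by_refl[of X], OF to_mat_carrier(1) to_mat_carrier(1)]
        pencil_form_equiv[OF equiv_by_refl[of X] E, OF to_mat_carrier(1) to_mat_carrier(1)] c
      by (auto simp: pair_sol_form dims sandwich_supported to_mat_sandwich simp del: transpose_one right_mult_one_mat left_mult_one_mat)
    show "?f P Q' ` pair_sol X B \<subseteq> pair_sol X A"
      using pencil_form_equiv[OF E' equiv_by_refl[of X], OF to_mat_carrier(1) to_mat_carrier(1)]
        pencil_form_equiv[OF equiv_by_refl[of X] E', OF to_mat_carrier(1) to_mat_carrier(1)] c
      by (auto simp: pair_sol_form dims sandwich_supported to_mat_sandwich simp del: transpose_one right_mult_one_mat left_mult_one_mat)
  qed
qed

lemma pencil_dim:
  assumes "dim_row A = dim_row B" "dim_col A = dim_col B"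
  shows "dim_row (pencil A B) = dim_row A" "dim_col (pencil A B) = dim_col A"
  using assms by (auto simp: pencil_def const_mat_def)

lemma entry_pencil:
  assumes "dim_row A = dim_row B" "dim_col A = dim_col B" "i < dim_row A" "j < dim_col A"
  shows "const_entry (pencil A B) i j = A $$ (i, j)" "mu_entry (pencil A B) i j = B $$ (i, j)"
  using assms by (auto simp: pencil_def const_mat_def const_entry_def mu_entry_def)

lemma const_mat_dim [simp]: "dim_row (const_mat A) = dim_row A" "dim_col (const_mat A) = dim_col A"
  by (auto simp: const_mat_def)

lemma coeff_const_mult:
  assumes "P \<in> carrier_mat r r'" "N \<in> carrier_mat r' c" "i < r" "j < c"
  shows "coeff ((const_mat P * N) $$ (i, j)) k = (\<Sum>l<r'. P $$ (i, l) * coeff (N $$ (l, j)) k)"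
proof -
  have "(const_mat P * N) $$ (i, j) = (\<Sum>l<r'. [:P $$ (i, l):] * N $$ (l, j))"
    using assms by (simp add: const_mat_def scalar_prod_def atLeast0LessThan)
  then show ?thesis by (simp add: coeff_sum)
qed

lemma coeff_mult_const:
  assumes "N \<in> carrier_mat r c" "Q \<in> carrier_mat c c'" "i < r" "j < c'"
  shows "coeff ((N * const_mat Q) $$ (i, j)) k = (\<Sum>l<c. coeff (N $$ (i, l)) k * Q $$ (l, j))"
proof -
  have "(N * const_mat Q) $$ (i, j) = (\<Sum>l<c. [:Q $$ (l, j):] * N $$ (i, l))"
    using assms by (simp add: const_mat_def scalar_prod_def atLeast0LessThan mult.commute)
  then show ?thesis by (simp add: coeff_sum mult.commute)
qed

text \<open>Multiplication by constant matrices acts on each coefficient of the pencil separately.\<close>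

lemma part_const_mult:
  assumes "P \<in> carrier_mat r r" "M \<in> carrier_mat r c" "Q \<in> carrier_mat c c"
  shows "const_part (const_mat P * M * const_mat Q) = P * const_part M * Q"
    and "mu_part (const_mat P * M * const_mat Q) = P * mu_part M * Q"
proof -
  have c: "const_mat P * N \<in> carrier_mat r c" "N * const_mat Q \<in> carrier_mat r c" if "N \<in> carrier_mat r c" for N
    using that assms by (auto simp: const_mat_def)
  have l: "const_part (const_mat P * N) = P * const_part N" "mu_part (const_mat P * N) = P * mu_part N" if N: "N \<in> carrier_mat r c" for N
  proof -
    have PK: "(P * mat r c h) $$ (i, j) = (\<Sum>l<r. P $$ (i, l) * h (l, j))" if "i < r" "j < c" for h i j
      using that assms(1) by (simp add: scalar_prod_def atLeast0LessThan)
    have d: "dim_row (const_mat P * N) = r" "dim_col (const_mat P * N) = c" "dim_row N = r" "dim_col N = c" "dim_row P = r"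
      using N assms by auto
    show "const_part (const_mat P * N) = P * const_part N" "mu_part (const_mat P * N) = P * mu_part N"
      by (rule eq_matI; simp add: const_part_def mu_part_def d const_entry_def mu_entry_def PK
          coeff_const_mult[OF assms(1) N] sum_negf del: index_mult_mat(1))+
  qed
  have r: "const_part (N * const_mat Q) = const_part N * Q" "mu_part (N * const_mat Q) = mu_part N * Q" if N: "N \<in> carrier_mat r c" for N
  proof -
    have QK: "(mat r c h * Q) $$ (i, j) = (\<Sum>l<c. h (i, l) * Q $$ (l, j))" if "i < r" "j < c" for h i j
      using that assms(3) by (simp add: scalar_prod_def atLeast0LessThan)
    have d: "dim_row (N * const_mat Q) = r" "dim_col (N * const_mat Q) = c" "dim_row N = r" "dim_col N = c" "dim_col Q = c"
      using N assms by auto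
    show "const_part (N * const_mat Q) = const_part N * Q" "mu_part (N * const_mat Q) = mu_part N * Q"
      by (rule eq_matI; simp add: const_part_def mu_part_def d const_entry_def mu_entry_def QK
          coeff_mult_const[OF N assms(3)] sum_negf del: index_mult_mat(1))+
  qed
  show "const_part (const_mat P * M * const_mat Q) = P * const_part M * Q" "mu_part (const_mat P * M * const_mat Q) = P * mu_part M * Q"
    using r[OF c(1)[OF assms(2)]] l[OF assms(2)] by auto
qed

lemma strictly_equivalent_imp_equiv_by:
  assumes "strictly_equivalent M N"
  obtains P P' Q Q' where "equiv_by M N P P' Q Q'"
proof -
  obtain P Q where PQ: "P \<in> carrier_mat (dim_row M) (dim_row M)" "Q \<in> carrier_mat (dim_col M) (dim_col M)"
    "invertible_mat P" "invertible_mat Q" and N: "N = const_mat P * M * const_mat Q"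
    using assms by (auto simp: strictly_equivalent_def)
  have inv: "\<exists>X'. mat_inverses r X X'" if X: "invertible_mat X" "X \<in> carrier_mat r r" for X r
  proof -
    obtain X' where "inverts_mat X X'" "inverts_mat X' X"
      using X(1) by (auto simp: invertible_mat_def)
    then have X': "X * X' = 1\<^sub>m r" "X' * X = 1\<^sub>m (dim_row X')"
      using X(2) by (simp_all add: inverts_mat_def)
    have "dim_col (X * X') = r" "dim_col (X' * X) = dim_row X'"
      by (simp_all only: X' index_one_mat)
    then have "X' \<in> carrier_mat r r" using X(2) by auto
    then have "mat_inverses r X X'" using X' X(2) unfolding mat_inverses_def by (metis carrier_matD(1))
    then show ?thesis ..
  qed
  obtain P' Q' where "mat_inverses (dim_row M) P P'" "mat_inverses (dim_col M) Q Q'"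
    using inv PQ by blast
  moreover have "dim_row N = dim_row M" "dim_col N = dim_col M"
    using PQ by (auto simp: N)
  moreover have "const_part N = P * const_part M * Q" "mu_part N = P * mu_part M * Q"
    unfolding N by (rule part_const_mult[OF PQ(1) carrier_matI[OF refl refl] PQ(2)])+
  ultimately have "equiv_by M N P P' Q Q'"
    unfolding equiv_by_def by blast
  then show thesis by (rule that)
qed

text \<open>For \<open>A = J\<close> and \<open>B = J\<^sup>T\<close> the equation of the pencil is the original equation. Since its
  coefficients are real, it holds for a complex matrix if and only if it holds for the real part and
  for the imaginary part.\<close>

lemma self_sol_pencil_transpose:
  assumes J: "J \<in> carrier_mat n n"
  shows "self_sol (pencil (map_mat complex_of_real J) (map_mat complex_of_real (transpose_mat J)))
    = complexification n n (solutions n J)" (is "self_sol ?M = _")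
proof -
  have d: "dim_row ?M = n" "dim_col ?M = n" using J by (auto simp: pencil_dim)
  have eq: "left_term ?M U i j + right_term ?M U i j
      = (\<Sum>k<n. U k i * of_real (J $$ (k, j))) + (\<Sum>k<n. of_real (J $$ (i, k)) * U k j)"
    if "i < n" "j < n" for U i j
    using that J d by (simp add: left_term_def right_term_def entry_pencil)
  have sol: "mat n n (\<lambda>(i, j). h i j) \<in> solutions n J \<longleftrightarrow>
    (\<forall>i<n. \<forall>j<n. (\<Sum>k<n. h k i * J $$ (k, j)) + (\<Sum>k<n. J $$ (i, k) * h k j) = 0)" for h
    using J by (auto simp: solutions_def mat_eq_iff scalar_prod_def atLeast0LessThan)
  have "left_term ?M U i j + right_term ?M U i j = 0 \<longleftrightarrow>
      (\<Sum>k<n. Re (U k i) * J $$ (k, j)) + (\<Sum>k<n. J $$ (i, k) * Re (U k j)) = 0 \<and>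
      (\<Sum>k<n. Im (U k i) * J $$ (k, j)) + (\<Sum>k<n. J $$ (i, k) * Im (U k j)) = 0"
    if "i < n" "j < n" for U i j
    unfolding eq[OF that] by (simp add: complex_eq_iff)
  then show ?thesis
    unfolding self_sol_def complexification_def sol d by blast
qed

section \<open>Realified blocks\<close>

lemma part_four_block_mat:
  assumes "A \<in> carrier_mat r c" "B \<in> carrier_mat r c'" "C \<in> carrier_mat r' c" "D \<in> carrier_mat r' c'"
  shows "const_part (four_block_mat A B C D) = four_block_mat (const_part A) (const_part B) (const_part C) (const_part D)"
    "mu_part (four_block_mat A B C D) = four_block_mat (mu_part A) (mu_part B) (mu_part C) (mu_part D)"
  using assms by (auto simp: const_part_def mu_part_def const_entry_def mu_entry_def intro!: eq_matI)

lemma part_zero: "const_part (0\<^sub>m r c) = 0\<^sub>m r c" "mu_part (0\<^sub>m r c) = 0\<^sub>m r c"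
  by (auto simp: const_part_def mu_part_def const_entry_def mu_entry_def intro!: eq_matI)

definition cnj_pencil :: "complex poly mat \<Rightarrow> complex poly mat" where
  "cnj_pencil M = map_mat (map_poly cnj) M"

text \<open>The columns of \<open>[I, I; \<i> I, -\<i> I]\<close> span the two common invariant subspaces of all matrices
  \<open>[A, B; -B, A]\<close>. On these subspaces the matrix acts as \<open>A + \<i> B\<close> and as \<open>A - \<i> B\<close>.\<close>

definition splitter :: "nat \<Rightarrow> complex mat" where
  "splitter r = four_block_mat (1\<^sub>m r) (1\<^sub>m r) (\<i> \<cdot>\<^sub>m 1\<^sub>m r) ((-\<i>) \<cdot>\<^sub>m 1\<^sub>m r)"

definition splitter_inv :: "nat \<Rightarrow> complex mat" where
  "splitter_inv r = four_block_mat ((1/2) \<cdot>\<^sub>m 1\<^sub>m r) ((-\<i>/2) \<cdot>\<^sub>m 1\<^sub>m r) ((1/2) \<cdot>\<^sub>m 1\<^sub>m r) ((\<i>/2) \<cdot>\<^sub>m 1\<^sub>m r)"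

lemma smult_one_mult:
  fixes X :: "complex mat"
  assumes "X \<in> carrier_mat r c"
  shows "(a \<cdot>\<^sub>m 1\<^sub>m r) * X = a \<cdot>\<^sub>m X" "X * (a \<cdot>\<^sub>m 1\<^sub>m c) = a \<cdot>\<^sub>m X"
  using assms mult_smult_assoc_mat[of "1\<^sub>m r" r r X c a] mult_smult_distrib[of X r c "1\<^sub>m c" c a] by auto

lemma splitter_four_block:
  assumes A: "A \<in> carrier_mat r c" and B: "B \<in> carrier_mat r c"
  shows "splitter_inv r * four_block_mat A B (- B) A * splitter c
    = four_block_mat (A + \<i> \<cdot>\<^sub>m B) (0\<^sub>m r c) (0\<^sub>m r c) (A - \<i> \<cdot>\<^sub>m B)"
proof -
  let ?E = "(1/2) \<cdot>\<^sub>m A + (-\<i>/2) \<cdot>\<^sub>m (-B)" and ?F = "(1/2) \<cdot>\<^sub>m B + (-\<i>/2) \<cdot>\<^sub>m A"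
  let ?G = "(1/2) \<cdot>\<^sub>m A + (\<i>/2) \<cdot>\<^sub>m (-B)" and ?H = "(1/2) \<cdot>\<^sub>m B + (\<i>/2) \<cdot>\<^sub>m A"
  have mB: "- B \<in> carrier_mat r c" using B by simp
  have c: "?E \<in> carrier_mat r c" "?F \<in> carrier_mat r c" "?G \<in> carrier_mat r c" "?H \<in> carrier_mat r c"
    using A B by auto
  have sc: "x \<cdot>\<^sub>m 1\<^sub>m k \<in> carrier_mat k k" for x :: complex and k by simp
  have 1: "splitter_inv r * four_block_mat A B (- B) A = four_block_mat ?E ?F ?G ?H"
    unfolding splitter_inv_def mult_four_block_mat[OF sc sc sc sc A B mB A]
    by (simp only: smult_one_mult(1)[OF A] smult_one_mult(1)[OF B] smult_one_mult(1)[OF mB])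
  have 2: "four_block_mat ?E ?F ?G ?H * splitter c = four_block_mat (?E + \<i> \<cdot>\<^sub>m ?F) (?E + (-\<i>) \<cdot>\<^sub>m ?F) (?G + \<i> \<cdot>\<^sub>m ?H) (?G + (-\<i>) \<cdot>\<^sub>m ?H)"
    unfolding splitter_def mult_four_block_mat[OF c one_carrier_mat one_carrier_mat sc sc]
    by (simp only: smult_one_mult(2)[OF c(2)] smult_one_mult(2)[OF c(4)] right_mult_one_mat[OF c(1)] right_mult_one_mat[OF c(3)])
  have 3: "?E + \<i> \<cdot>\<^sub>m ?F = A + \<i> \<cdot>\<^sub>m B" "?E + (-\<i>) \<cdot>\<^sub>m ?F = 0\<^sub>m r c"
    "?G + \<i> \<cdot>\<^sub>m ?H = 0\<^sub>m r c" "?G + (-\<i>) \<cdot>\<^sub>m ?H = A - \<i> \<cdot>\<^sub>m B"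
    using A B by (auto intro!: eq_matI simp: algebra_simps)
  show ?thesis unfolding 1 2 3 ..
qed

lemma splitter_inverses: "mat_inverses (r + r) (splitter_inv r) (splitter r)"
proof -
  have c: "splitter_inv r \<in> carrier_mat (r + r) (r + r)" "splitter r \<in> carrier_mat (r + r) (r + r)"
    by (auto simp: splitter_def splitter_inv_def)
  have "splitter_inv r * four_block_mat (1\<^sub>m r) (0\<^sub>m r r) (- 0\<^sub>m r r) (1\<^sub>m r) * splitter r
      = four_block_mat (1\<^sub>m r + \<i> \<cdot>\<^sub>m 0\<^sub>m r r) (0\<^sub>m r r) (0\<^sub>m r r) (1\<^sub>m r - \<i> \<cdot>\<^sub>m 0\<^sub>m r r)"
    by (rule splitter_four_block) auto
  moreover have "- 0\<^sub>m r r = (0\<^sub>m r r :: complex mat)" "1\<^sub>m r + \<i> \<cdot>\<^sub>m 0\<^sub>m r r = (1\<^sub>m r :: complex mat)"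
    "1\<^sub>m r - \<i> \<cdot>\<^sub>m 0\<^sub>m r r = (1\<^sub>m r :: complex mat)"
    by (auto intro!: eq_matI)
  ultimately have 1: "splitter_inv r * splitter r = 1\<^sub>m (r + r)"
    using c(1) four_block_one_mat[of r r, where ?'a = complex] by simp
  then show ?thesis using c mat_mult_left_right_inverse[OF c 1] unfolding mat_inverses_def by blast
qed

lemma mat_inverses_sym: "mat_inverses r P P' \<Longrightarrow> mat_inverses r P' P"
  by (auto simp: mat_inverses_def)

text \<open>Real and imaginary parts of a pencil are taken coefficientwise, so the same change of basis works
  for both coefficients and splits the realified pencil into the pencil and its conjugate.\<close>

lemma realification_equiv:
  "equiv_by (realification M) (direct_sum M (cnj_pencil M)) (splitter_inv (dim_row M)) (splitter (dim_row M))
     (splitter (dim_col M)) (splitter_inv (dim_col M))"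
proof -
  let ?r = "dim_row M" and ?c = "dim_col M"
  have dims: "re_pencil M \<in> carrier_mat ?r ?c" "im_pencil M \<in> carrier_mat ?r ?c" "cnj_pencil M \<in> carrier_mat ?r ?c"
    "M \<in> carrier_mat ?r ?c"
    by (auto simp: re_pencil_def im_pencil_def cnj_pencil_def)
  have c: "const_part (re_pencil M) \<in> carrier_mat ?r ?c" "const_part (im_pencil M) \<in> carrier_mat ?r ?c"
    "mu_part (re_pencil M) \<in> carrier_mat ?r ?c" "mu_part (im_pencil M) \<in> carrier_mat ?r ?c"
    by (simp_all add: const_part_def mu_part_def re_pencil_def im_pencil_def)
  have K: "const_part M = const_part (re_pencil M) + \<i> \<cdot>\<^sub>m const_part (im_pencil M)" "mu_part M = mu_part (re_pencil M) + \<i> \<cdot>\<^sub>m mu_part (im_pencil M)"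
    "const_part (cnj_pencil M) = const_part (re_pencil M) - \<i> \<cdot>\<^sub>m const_part (im_pencil M)"
    "mu_part (cnj_pencil M) = mu_part (re_pencil M) - \<i> \<cdot>\<^sub>m mu_part (im_pencil M)"
    by (rule eq_matI; simp add: const_part_def mu_part_def const_entry_def mu_entry_def re_pencil_def im_pencil_def cnj_pencil_def
        coeff_map_poly complex_eq_iff)+
  have neg: "const_part (- im_pencil M) = - const_part (im_pencil M)" "mu_part (- im_pencil M) = - mu_part (im_pencil M)"
    by (auto simp: const_part_def mu_part_def const_entry_def mu_entry_def intro!: eq_matI)
  have "const_part (realification M) = four_block_mat (const_part (re_pencil M)) (const_part (im_pencil M)) (- const_part (im_pencil M)) (const_part (re_pencil M))"
    "mu_part (realification M) = four_block_mat (mu_part (re_pencil M)) (mu_part (im_pencil M)) (- mu_part (im_pencil M)) (mu_part (re_pencil M))"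
    unfolding realification_def part_four_block_mat[OF dims(1,2) uminus_carrier_mat[OF dims(2)] dims(1)] neg by (rule refl)+
  moreover have "const_part (direct_sum M (cnj_pencil M)) = four_block_mat (const_part M) (0\<^sub>m ?r ?c) (0\<^sub>m ?r ?c) (const_part (cnj_pencil M))"
    "mu_part (direct_sum M (cnj_pencil M)) = four_block_mat (mu_part M) (0\<^sub>m ?r ?c) (0\<^sub>m ?r ?c) (mu_part (cnj_pencil M))"
    unfolding direct_sum_def carrier_matD[OF dims(3)] part_four_block_mat[OF dims(4) zero_carrier_mat zero_carrier_mat dims(3)] part_zero by (rule refl)+
  moreover have "dim_row (realification M) = ?r + ?r" "dim_col (realification M) = ?c + ?c"
    "dim_row (direct_sum M (cnj_pencil M)) = ?r + ?r" "dim_col (direct_sum M (cnj_pencil M)) = ?c + ?c"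
    by (simp_all add: realification_def re_pencil_def cnj_pencil_def)
  ultimately show ?thesis
    unfolding equiv_by_def K
    using splitter_four_block[OF c(1,2)] splitter_four_block[OF c(3,4)] splitter_inverses[of ?r]
      mat_inverses_sym[OF splitter_inverses[of ?c]] by (simp only: simp_thms)
qed

section \<open>Entries of the elementary blocks\<close>

text \<open>The row above, with the convention that a row of zeros lies above the first one. All elementary
  blocks act by scalars and shifts, and this convention removes the case distinction at the border.\<close>

definition shift :: "(nat \<Rightarrow> nat \<Rightarrow> complex) \<Rightarrow> nat \<Rightarrow> nat \<Rightarrow> complex" where
  "shift U i j = (if i = 0 then 0 else U (i - 1) j)"

lemma shift_simps [simp]: "shift U 0 j = 0" "shift U (Suc i) j = U i j"
  by (auto simp: shift_def)

abbreviation L_T :: "nat \<Rightarrow> complex poly mat" where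
  "L_T r \<equiv> transpose_mat (L r)"

lemma block_dims [simp]:
  "dim_row (J_fin r z) = r" "dim_col (J_fin r z) = r" "dim_row (J_inf r) = r" "dim_col (J_inf r) = r"
  "dim_row (L r) = r" "dim_col (L r) = Suc r"
  by (auto simp: J_fin_def J_inf_def L_def pencil_dim)

lemma entry_transpose:
  assumes "i < dim_col M" "j < dim_row M"
  shows "const_entry (transpose_mat M) i j = const_entry M j i" "mu_entry (transpose_mat M) i j = mu_entry M j i"
  using assms by (auto simp: const_entry_def mu_entry_def)

lemma block_entries:
  "i < r \<Longrightarrow> j < r \<Longrightarrow> const_entry (J_fin r z) i j = (if i = j then z else if Suc i = j then 1 else 0)"
  "i < r \<Longrightarrow> j < r \<Longrightarrow> mu_entry (J_fin r z) i j = (if i = j then 1 else 0)"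
  "i < r \<Longrightarrow> j < r \<Longrightarrow> const_entry (J_inf r) i j = (if i = j then 1 else 0)"
  "i < r \<Longrightarrow> j < r \<Longrightarrow> mu_entry (J_inf r) i j = (if Suc i = j then 1 else 0)"
  "i < r \<Longrightarrow> j < Suc r \<Longrightarrow> const_entry (L r) i j = (if Suc i = j then 1 else 0)"
  "i < r \<Longrightarrow> j < Suc r \<Longrightarrow> mu_entry (L r) i j = (if i = j then 1 else 0)"
  unfolding J_fin_def J_inf_def L_def by (auto simp: entry_pencil jordan_block_def)

text \<open>Every column of an elementary block has at most two nonzero entries, at the positions \<open>j\<close> and
  \<open>j - 1\<close>.\<close>

lemma sum_pick:
  fixes f :: "nat \<Rightarrow> complex"
  shows "(\<Sum>k<r. f k * (if k = j then x else 0)) = (if j < r then f j * x else 0)"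
    "(\<Sum>k<r. (if k = j then x else 0) * f k) = (if j < r then x * f j else 0)"
    "(\<Sum>k<r. f k * (if Suc k = j then x else 0)) = (if 0 < j \<and> j \<le> r then f (j - 1) * x else 0)"
    "(\<Sum>k<r. (if Suc k = j then x else 0) * f k) = (if 0 < j \<and> j \<le> r then x * f (j - 1) else 0)"
proof -
  have *: "(if k = j then x else 0) = (if j = k then x else 0)" for k by auto
  show 1: "(\<Sum>k<r. f k * (if k = j then x else 0)) = (if j < r then f j * x else 0)" for j
    by (simp add: if_distrib cong: if_cong)
  then show "(\<Sum>k<r. (if k = j then x else 0) * f k) = (if j < r then x * f j else 0)"
    by (simp add: mult.commute)
  show 2: "(\<Sum>k<r. f k * (if Suc k = j then x else 0)) = (if 0 < j \<and> j \<le> r then f (j - 1) * x else 0)"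
    using 1[of "j - 1"] by (cases j) (auto simp: Suc_le_eq)
  then show "(\<Sum>k<r. (if Suc k = j then x else 0) * f k) = (if 0 < j \<and> j \<le> r then x * f (j - 1) else 0)"
    by (simp add: mult.commute)
qed

lemma terms_J_fin [simp]:
  "j < r \<Longrightarrow> left_term (J_fin r z) V i j = z * V j i + shift V j i"
  "i < r \<Longrightarrow> right_term (J_fin r z) U i j = U i j"
proof -
  assume j: "j < r"
  have "left_term (J_fin r z) V i j = (\<Sum>k<r. V k i * (if k = j then z else 0) + V k i * (if Suc k = j then 1 else 0))"
    unfolding left_term_def using j by (intro sum.cong) (auto simp: block_entries)
  then show "left_term (J_fin r z) V i j = z * V j i + shift V j i"
    using j by (auto simp: sum.distrib sum_pick shift_def)
next
  assume i: "i < r"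
  have "right_term (J_fin r z) U i j = (\<Sum>k<r. (if k = i then 1 else 0) * U k j)"
    unfolding right_term_def using i by (intro sum.cong) (auto simp: block_entries)
  then show "right_term (J_fin r z) U i j = U i j" using i by (simp add: sum_pick)
qed

lemma terms_J_inf [simp]:
  "j < r \<Longrightarrow> left_term (J_inf r) V i j = V j i"
  "i < r \<Longrightarrow> right_term (J_inf r) U i j = shift U i j"
proof -
  assume j: "j < r"
  have "left_term (J_inf r) V i j = (\<Sum>k<r. V k i * (if k = j then 1 else 0))"
    unfolding left_term_def using j by (intro sum.cong) (auto simp: block_entries)
  then show "left_term (J_inf r) V i j = V j i" using j by (simp add: sum_pick)
next
  assume i: "i < r"
  have "right_term (J_inf r) U i j = (\<Sum>k<r. (if Suc k = i then 1 else 0) * U k j)"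
    unfolding right_term_def using i by (intro sum.cong) (auto simp: block_entries)
  then show "right_term (J_inf r) U i j = shift U i j"
    using i by (simp add: sum_pick shift_def)
qed

lemma terms_L [simp]:
  "j < Suc r \<Longrightarrow> left_term (L r) V i j = shift V j i"
  "i < Suc r \<Longrightarrow> right_term (L r) U i j = (if i < r then U i j else 0)"
proof -
  assume j: "j < Suc r"
  have "left_term (L r) V i j = (\<Sum>k<r. V k i * (if Suc k = j then 1 else 0))"
    unfolding left_term_def using j by (intro sum.cong) (auto simp: block_entries)
  then show "left_term (L r) V i j = shift V j i" using j by (simp add: sum_pick shift_def)
next
  assume i: "i < Suc r"
  have "right_term (L r) U i j = (\<Sum>k<r. (if k = i then 1 else 0) * U k j)"
    unfolding right_term_def using i by (intro sum.cong) (auto simp: block_entries)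
  then show "right_term (L r) U i j = (if i < r then U i j else 0)"
    using i by (simp add: sum_pick)
qed

lemma terms_L_T [simp]:
  "j < r \<Longrightarrow> left_term (L_T r) V i j = V (Suc j) i"
  "i < r \<Longrightarrow> right_term (L_T r) U i j = U i j"
proof -
  assume j: "j < r"
  have "left_term (L_T r) V i j = (\<Sum>k<Suc r. V k i * (if k = Suc j then 1 else 0))"
    unfolding left_term_def using j by (intro sum.cong) (auto simp: block_entries entry_transpose)
  then show "left_term (L_T r) V i j = V (Suc j) i" using j by (simp add: sum_pick del: sum.lessThan_Suc)
next
  assume i: "i < r"
  have "right_term (L_T r) U i j = (\<Sum>k<Suc r. (if k = i then 1 else 0) * U k j)"
    unfolding right_term_def using i by (intro sum.cong) (auto simp: block_entries entry_transpose)
  then show "right_term (L_T r) U i j = U i j"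
    using i by (simp add: sum_pick del: sum.lessThan_Suc)
qed

text \<open>In the applications \<open>\<phi>\<close> reads off the entries of a solution that can be prescribed freely, and \<open>g\<close>
  computes the solution from them.\<close>

lemma has_dim_coordsI:
  assumes "clinear_on S \<phi>"
    and "\<And>u. u \<in> S \<Longrightarrow> \<phi> u \<in> coords d" "\<And>x. x \<in> coords d \<Longrightarrow> g x \<in> S"
    and "\<And>u. u \<in> S \<Longrightarrow> g (\<phi> u) = u" "\<And>x. x \<in> coords d \<Longrightarrow> \<phi> (g x) = x"
  shows "has_dim S d"
  unfolding has_dim_def using assms by (intro exI[of _ \<phi>] conjI bij_betw_byWitness[where f' = g]) auto

lemma has_dim_pair_sol_trivial:
  assumes "\<And>U V i j. (U, V) \<in> pair_sol A B \<Longrightarrow> i < dim_row A \<Longrightarrow> j < dim_col B \<Longrightarrow> U i j = 0"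
    "\<And>U V i j. (U, V) \<in> pair_sol A B \<Longrightarrow> i < dim_col A \<Longrightarrow> j < dim_row B \<Longrightarrow> V j i = 0"
  shows "has_dim (pair_sol A B) 0"
proof -
  have "(0, 0) \<in> pair_sol A B" by (auto simp: pair_sol_def supported_def left_term_def right_term_def)
  moreover have "U = 0 \<and> V = 0" if "(U, V) \<in> pair_sol A B" for U V
  proof -
    have "U \<in> supported (dim_row A) (dim_col B)" "V \<in> supported (dim_row B) (dim_col A)"
      using that by (auto simp: pair_sol_def)
    then show ?thesis using assms[OF that] unfolding supported_def fun_eq_iff zero_fun_apply by blast
  qed
  ultimately have "pair_sol A B = {0}" by (auto simp: zero_prod_def)
  then show ?thesis using has_dim_zero by simp
qed

lemma has_dim_self_sol_trivial:
  assumes "\<And>U i j. U \<in> self_sol A \<Longrightarrow> i < dim_row A \<Longrightarrow> j < dim_col A \<Longrightarrow> U i j = 0"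
  shows "has_dim (self_sol A) 0"
proof -
  have "0 \<in> self_sol A" using subspace_self_sol by (rule cvec.subspace_0)
  moreover have "U = 0" if "U \<in> self_sol A" for U
  proof -
    have "U \<in> supported (dim_row A) (dim_col A)" using that by (auto simp: self_sol_def)
    then show ?thesis using assms[OF that] unfolding supported_def fun_eq_iff zero_fun_apply by blast
  qed
  ultimately have "self_sol A = {0}" by auto
  then show ?thesis using has_dim_zero by simp
qed

lemma pair_solD:
  assumes "(U, V) \<in> pair_sol A B"
  shows "\<And>i j. i < dim_col A \<Longrightarrow> j < dim_col B \<Longrightarrow> left_term B V i j + right_term A U i j = 0"
    "\<And>i j. i < dim_col A \<Longrightarrow> j < dim_col B \<Longrightarrow> left_term A U j i + right_term B V j i = 0"
    "\<And>i j. \<not> (i < dim_row A \<and> j < dim_col B) \<Longrightarrow> U i j = 0"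
    "\<And>i j. \<not> (j < dim_row B \<and> i < dim_col A) \<Longrightarrow> V j i = 0"
  using assms by (auto simp: pair_sol_def supported_def)

lemma self_solD:
  assumes "U \<in> self_sol A"
  shows "\<And>i j. i < dim_col A \<Longrightarrow> j < dim_col A \<Longrightarrow> left_term A U i j + right_term A U i j = 0"
    "\<And>i j. \<not> (i < dim_row A \<and> j < dim_col A) \<Longrightarrow> U i j = 0"
  using assms by (auto simp: self_sol_def supported_def)

section \<open>Blocks and pairs of blocks with no nonzero solution\<close>

text \<open>In the following lemmas the equations at position \<open>(i, j)\<close> express \<open>U\<^sub>i\<^sub>j\<close> and \<open>V\<^sub>j\<^sub>i\<close> by each other and by
  entries with a smaller sum of indices, and the latter vanish by induction. For two Jordan blocks a
  linear system with determinant \<open>1 - x y\<close> remains.\<close>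

lemma eq_neg_mult_cancel:
  fixes u v x y :: complex
  assumes "x * v + u = 0" "y * u + v = 0" "x * y \<noteq> 1"
  shows "u = 0 \<and> v = 0"
proof -
  have "u = - (x * v)" "v = - (y * u)" using assms(1,2) by (auto simp: add_eq_0_iff add_eq_0_iff2)
  then have "u = x * y * u" "v = x * y * v" by (metis minus_mult_minus mult.assoc mult_minus_right minus_minus mult.commute)+
  then show ?thesis using assms(3) by (metis mult_cancel_right1)
qed

lemma pair_sol_fin_fin_trivial:
  assumes "z * w \<noteq> 1"
  shows "has_dim (pair_sol (J_fin r z) (J_fin s w)) 0"
proof -
  have "U i j = 0 \<and> V j i = 0"
    if S: "(U, V) \<in> pair_sol (J_fin r z) (J_fin s w)" and "i < r" "j < s" for U V i j
    using that(2,3)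
  proof (induction "i + j" arbitrary: i j rule: less_induct)
    case less
    have "shift U i j = 0" "shift V j i = 0" using less by (cases i; cases j; simp)+
    then show ?case using pair_solD(1,2)[OF S, of i j] less.prems assms
      by (intro eq_neg_mult_cancel[of w _ _ z]) (auto simp: mult.commute)
  qed
  then show ?thesis by (intro has_dim_pair_sol_trivial) auto
qed

lemma pair_sol_fin_inf_trivial:
  assumes "z \<noteq> 0"
  shows "has_dim (pair_sol (J_fin r z) (J_inf s)) 0"
proof -
  have "U i j = 0 \<and> V j i = 0"
    if S: "(U, V) \<in> pair_sol (J_fin r z) (J_inf s)" and "i < r" "j < s" for U V i j
    using that(2,3)
  proof (induction "i + j" arbitrary: i j rule: less_induct)
    case less
    have "shift U i j = 0" "shift V j i = 0" using less by (cases i; cases j; simp)+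
    then show ?case using pair_solD(1,2)[OF S, of i j] less.prems assms by auto
  qed
  then show ?thesis by (intro has_dim_pair_sol_trivial) auto
qed

lemma pair_sol_inf_inf_trivial: "has_dim (pair_sol (J_inf r) (J_inf s)) 0"
proof -
  have "U i j = 0 \<and> V j i = 0"
    if S: "(U, V) \<in> pair_sol (J_inf r) (J_inf s)" and "i < r" "j < s" for U V i j
    using that(2,3)
  proof (induction "i + j" arbitrary: i j rule: less_induct)
    case less
    have "shift U i j = 0" "shift V j i = 0" using less by (cases i; cases j; simp)+
    then show ?case using pair_solD(1,2)[OF S, of i j] less.prems by auto
  qed
  then show ?thesis by (intro has_dim_pair_sol_trivial) auto
qed

lemma pair_sol_L_L_trivial: "has_dim (pair_sol (L r) (L s)) 0"
proof -
  have "U i j = 0 \<and> V j i = 0"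
    if S: "(U, V) \<in> pair_sol (L r) (L s)" and "i < Suc r" "j < Suc s" for U V i j
    using that(2,3)
  proof (induction "i + j" arbitrary: i j rule: less_induct)
    case less
    have "shift U i j = 0" "shift V j i = 0" using less by (cases i; cases j; simp)+
    then show ?case using pair_solD(1,2)[OF S, of i j] pair_solD(3)[OF S, of i j] pair_solD(4)[OF S, of j i] less.prems
      by (auto split: if_splits)
  qed
  then show ?thesis by (intro has_dim_pair_sol_trivial) auto
qed

lemma pair_sol_L_fin_trivial: "has_dim (pair_sol (L r) (J_fin s z)) 0"
proof -
  have "U i j = 0 \<and> V j i = 0"
    if S: "(U, V) \<in> pair_sol (L r) (J_fin s z)" and "i < Suc r" "j < s" for U V i j
    using that(2,3)
  proof (induction "i + j" arbitrary: i j rule: less_induct)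
    case less
    have "shift U i j = 0" "shift V j i = 0" using less by (cases i; cases j; simp)+
    then show ?case using pair_solD(1,2)[OF S, of i j] pair_solD(3)[OF S, of i j] less.prems
      by (auto split: if_splits)
  qed
  then show ?thesis by (intro has_dim_pair_sol_trivial) auto
qed

text \<open>Here the recurrence \<open>V\<^sub>j\<^sub>,\<^sub>i\<^sub>-\<^sub>1 = V\<^sub>j\<^sub>-\<^sub>1\<^sub>,\<^sub>i\<close> keeps the sum of the indices. The induction runs over the rows of \<open>V\<close>;
  the last column of \<open>V\<close> vanishes because \<open>U\<close> has no row with index \<open>r\<close>.\<close>

lemma pair_sol_L_inf_trivial: "has_dim (pair_sol (L r) (J_inf s)) 0"
proof -
  have V0: "V j i = 0" if S: "(U, V) \<in> pair_sol (L r) (J_inf s)" and "i \<le> r" "j < s" for U V i j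
    using that(2,3)
  proof (induction j arbitrary: i)
    case 0
    show ?case using pair_solD(1)[OF S, of i 0] pair_solD(2)[OF S, of "Suc i" 0] 0
      by (cases "i = r") auto
  next
    case (Suc j)
    then show ?case using pair_solD(1)[OF S, of i "Suc j"] pair_solD(2)[OF S, of "Suc i" "Suc j"] Suc.IH[of "Suc i"]
      by (cases "i = r") auto
  qed
  have "U i j = 0" if S: "(U, V) \<in> pair_sol (L r) (J_inf s)" and "i < r" "j < s" for U V i j
    using pair_solD(1)[OF S, of i j] V0[OF S, of i j] that by auto
  then show ?thesis using V0 by (intro has_dim_pair_sol_trivial) (auto simp: less_Suc_eq_le)
qed

lemma self_sol_fin_trivial:
  assumes "z * z \<noteq> 1"
  shows "has_dim (self_sol (J_fin r z)) 0"
proof -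
  have "U i j = 0 \<and> U j i = 0" if S: "U \<in> self_sol (J_fin r z)" and "i < r" "j < r" for U i j
    using that(2,3)
  proof (induction "i + j" arbitrary: i j rule: less_induct)
    case less
    have "shift U i j = 0" "shift U j i = 0" using less by (cases i; cases j; simp)+
    then show ?case using self_solD(1)[OF S, of i j] self_solD(1)[OF S, of j i] less.prems assms
      by (intro eq_neg_mult_cancel[of z _ _ z]) auto
  qed
  then show ?thesis by (intro has_dim_self_sol_trivial) auto
qed

lemma self_sol_inf_trivial: "has_dim (self_sol (J_inf r)) 0"
proof -
  have "U i j = 0 \<and> U j i = 0" if S: "U \<in> self_sol (J_inf r)" and "i < r" "j < r" for U i j
    using that(2,3)
  proof (induction "i + j" arbitrary: i j rule: less_induct)
    case less
    have "shift U i j = 0" "shift U j i = 0" using less by (cases i; cases j; simp)+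
    then show ?case using self_solD(1)[OF S, of i j] self_solD(1)[OF S, of j i] less.prems by auto
  qed
  then show ?thesis by (intro has_dim_self_sol_trivial) auto
qed

lemma self_sol_L_trivial: "has_dim (self_sol (L r)) 0"
proof -
  have "U i j = 0 \<and> U j i = 0" if S: "U \<in> self_sol (L r)" and "i < Suc r" "j < Suc r" for U i j
    using that(2,3)
  proof (induction "i + j" arbitrary: i j rule: less_induct)
    case less
    have "shift U i j = 0" "shift U j i = 0" using less by (cases i; cases j; simp)+
    then show ?case using self_solD(1)[OF S, of i j] self_solD(1)[OF S, of j i]
      self_solD(2)[OF S, of i j] self_solD(2)[OF S, of j i] less.prems
      by (auto split: if_splits)
  qed
  then show ?thesis by (intro has_dim_self_sol_trivial) auto
qed

section \<open>Pairs of blocks with nonzero solutions\<close>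

text \<open>Let \<open>z w = 1\<close>. Eliminating \<open>U\<close> from the two equations leaves \<open>V\<^sub>j\<^sub>,\<^sub>i = -z (V\<^sub>j\<^sub>-\<^sub>1\<^sub>,\<^sub>i + z V\<^sub>j\<^sub>-\<^sub>1\<^sub>,\<^sub>i\<^sub>+\<^sub>1)\<close> for \<open>i < r - 1\<close>.
  Hence the last column \<open>x\<close> of \<open>V\<close> determines \<open>V\<close>. In row \<open>0\<close> every other entry vanishes.\<close>

fun fin_row :: "complex \<Rightarrow> nat \<Rightarrow> (nat \<Rightarrow> complex) \<Rightarrow> nat \<Rightarrow> nat \<Rightarrow> complex" where
  "fin_row z r x 0 i = (if Suc i = r then x 0 else 0)"
| "fin_row z r x (Suc j) i = (if Suc i = r then x (Suc j) else if Suc i < r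
     then - z * (fin_row z r x j i + z * fin_row z r x j (Suc i)) else 0)"

lemma fin_row_zero: "i + j + 1 < r \<Longrightarrow> fin_row z r x j i = 0"
  by (induction j arbitrary: i) auto

lemma fin_row_antidiagonal: "i + j + 1 = r \<Longrightarrow> fin_row z r x j i = (- z * z) ^ j * x 0"
  by (induction j arbitrary: i) (auto simp: fin_row_zero)

lemma fin_row_last: "0 < r \<Longrightarrow> fin_row z r x j (r - Suc 0) = x j"
  by (cases j) auto

definition fin_sol_V :: "complex \<Rightarrow> nat \<Rightarrow> nat \<Rightarrow> (nat \<Rightarrow> complex) \<Rightarrow> nat \<Rightarrow> nat \<Rightarrow> complex" where
  "fin_sol_V z r s x j i = (if j < s \<and> i < r then fin_row z r x j i else 0)"

definition fin_sol_U :: "complex \<Rightarrow> nat \<Rightarrow> nat \<Rightarrow> (nat \<Rightarrow> nat \<Rightarrow> complex) \<Rightarrow> nat \<Rightarrow> nat \<Rightarrow> complex" where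
  "fin_sol_U w r s V i j = (if i < r \<and> j < s then - w * V j i - shift V j i else 0)"

text \<open>The elimination leaves one more condition: the first column of \<open>V\<close> vanishes above its last entry.
  It holds because all entries before the antidiagonal through the upper right corner are zero, and
  for \<open>s \<le> r\<close> this antidiagonal meets the first column in the last row or not at all.\<close>

lemma fin_sol_UV_pair_sol:
  assumes zw: "z * w = 1" and sr: "s \<le> r"
  shows "(fin_sol_U w r s (fin_sol_V z r s x), fin_sol_V z r s x) \<in> pair_sol (J_fin r z) (J_fin s w)"
proof -
  let ?V = "fin_sol_V z r s x" and ?U = "fin_sol_U w r s (fin_sol_V z r s x)"
  have 1: "w * ?V j i + shift ?V j i + ?U i j = 0" if "i < r" "j < s" for i j
    using that by (simp add: fin_sol_U_def)
  have 2: "shift ?U i j = z * shift ?V j i" if "i < r" "j < s" for i j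
  proof (cases i)
    case 0
    then show ?thesis using that sr
      by (cases j) (auto simp: fin_sol_V_def fin_row_zero)
  next
    case [simp]: (Suc i')
    show ?thesis
    proof (cases j)
      case 0
      then show ?thesis using that by (auto simp: fin_sol_U_def fin_sol_V_def)
    next
      case [simp]: (Suc j')
      define y where "y = fin_row z r x j' i' + z * fin_row z r x j' (Suc i')"
      have "?V j i' = - z * y" using that by (simp add: fin_sol_V_def y_def)
      moreover have "- w * (- z * y) = z * w * y" by (simp add: algebra_simps)
      ultimately have "- w * ?V j i' = y" using zw by simp
      moreover have "?V j' i' = y - z * ?V j' i" using that by (simp add: fin_sol_V_def y_def)
      ultimately have "- w * ?V j i' - ?V j' i' = z * ?V j' i" by (simp only: diff_diff_eq2 add_diff_cancel_left')
      then show ?thesis using that by (simp add: fin_sol_U_def)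
    qed
  qed
  have "z * ?U i j + shift ?U i j + ?V j i = 0" if "i < r" "j < s" for i j
  proof -
    have "?U i j = - (w * ?V j i) - shift ?V j i" using that by (simp add: fin_sol_U_def)
    then have "z * ?U i j = z * (- (w * ?V j i) - shift ?V j i)" by (rule arg_cong)
    then have "z * ?U i j = - (z * w * ?V j i) - z * shift ?V j i" by (simp add: algebra_simps)
    then show ?thesis using 2[OF that] zw by simp
  qed
  then show ?thesis using 1
    by (auto simp: pair_sol_def supported_def fin_sol_U_def[of w r s ?V] fin_sol_V_def[of z r s x])
qed

lemma pair_sol_fin_finD:
  assumes zw: "z * w = 1" and S: "(U, V) \<in> pair_sol (J_fin r z) (J_fin s w)" and ij: "i < r" "j < s"
  shows "U i j = - w * V j i - shift V j i" "V j i = fin_row z r (\<lambda>k. V k (r - 1)) j i"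
proof -
  define x where "x k = V k (r - 1)" for k
  have U: "U i j = - w * V j i - shift V j i" if "i < r" "j < s" for i j
    using pair_solD(1)[OF S, of i j] that by (simp add: eq_neg_iff_add_eq_0 algebra_simps)
  have sh: "shift U i j = z * shift V j i" if "i < r" "j < s" for i j
  proof -
    have "z * U i j = - (z * w * V j i) - z * shift V j i" unfolding U[OF that] by (simp add: algebra_simps)
    then show ?thesis using pair_solD(2)[OF S, of i j] that zw by simp
  qed
  have V: "V j i = fin_row z r x j i" if "i < r" "j < s" for i j
    using that
  proof (induction j arbitrary: i)
    case 0
    then show ?case
    proof (cases "Suc i = r")
      case False
      then have "- w * V 0 i = 0" using sh[of "Suc i" 0] U[of i 0] 0 by simp
      then show ?thesis using False zw by auto
    qed (auto simp: x_def)
  next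
    case (Suc j)
    show ?case
    proof (cases "Suc i = r")
      case False
      then have "- w * V (Suc j) i - V j i = z * V j (Suc i)" using sh[of "Suc i" "Suc j"] U[of i "Suc j"] Suc.prems by simp
      then have "z * (- w * V (Suc j) i - V j i) = z * (z * V j (Suc i))" by simp
      then have "- (z * w * V (Suc j) i) = z * V j i + z * (z * V j (Suc i))" by (simp add: algebra_simps)
      then have "V (Suc j) i = - (z * V j i + z * (z * V j (Suc i)))" unfolding zw by (metis minus_minus mult_1)
      then show ?thesis using False Suc by (simp add: algebra_simps)
    qed (use Suc.prems in \<open>auto simp: x_def\<close>)
  qed
  show "U i j = - w * V j i - shift V j i" by (rule U[OF ij])
  have "x = (\<lambda>k. V k (r - 1))" by (simp add: x_def fun_eq_iff)
  then show "V j i = fin_row z r (\<lambda>k. V k (r - 1)) j i" using V[OF ij] by simp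
qed

lemma pair_sol_fin_fin:
  assumes zw: "z * w = 1" and sr: "s \<le> r"
  shows "has_dim (pair_sol (J_fin r z) (J_fin s w)) s"
proof (rule has_dim_coordsI[where \<phi> = "\<lambda>(U, V) k. V k (r - 1)"
      and g = "\<lambda>x. (fin_sol_U w r s (fin_sol_V z r s x), fin_sol_V z r s x)"])
  show "clinear_on (pair_sol (J_fin r z) (J_fin s w)) (\<lambda>(U, V) k. V k (r - 1))"
    by (auto simp: clinear_on_def fun_eq_iff)
  show "(case u of (U, V) \<Rightarrow> \<lambda>k. V k (r - 1)) \<in> coords s"
    if "u \<in> pair_sol (J_fin r z) (J_fin s w)" for u
    using that by (auto simp: pair_sol_def supported_def coords_def)
  show "(case (fin_sol_U w r s (fin_sol_V z r s x), fin_sol_V z r s x) of (U, V) \<Rightarrow> \<lambda>k. V k (r - 1)) = x"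
    if "x \<in> coords s" for x
    using that sr by (auto simp: coords_def fun_eq_iff fin_sol_V_def fin_row_last)
  show "(fin_sol_U w r s (fin_sol_V z r s ((\<lambda>(U, V) k. V k (r - 1)) u)), fin_sol_V z r s ((\<lambda>(U, V) k. V k (r - 1)) u)) = u"
    if u: "u \<in> pair_sol (J_fin r z) (J_fin s w)" for u
  proof (cases u)
    case [simp]: (Pair U V)
    define x where "x k = V k (r - 1)" for k
    have S: "(U, V) \<in> pair_sol (J_fin r z) (J_fin s w)" using u by simp
    have U: "U i j = - w * V j i - shift V j i" and V: "V j i = fin_row z r x j i" if "i < r" "j < s" for i j
      using pair_sol_fin_finD[OF zw S that] by (auto simp: x_def[abs_def])
    have "fin_sol_V z r s x = V"
      using V pair_solD(4)[OF S] by (auto simp: fin_sol_V_def fun_eq_iff)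
    moreover have "fin_sol_U w r s V = U"
      using U pair_solD(3)[OF S] by (auto simp: fin_sol_U_def fun_eq_iff)
    moreover have "(\<lambda>(U, V) k. V k (r - 1)) u = x" by (simp add: x_def fun_eq_iff)
    ultimately show ?thesis by simp
  qed
qed (use fin_sol_UV_pair_sol[OF assms] in auto)

text \<open>A matrix with this property is constant on every antidiagonal.\<close>

lemma hankel:
  fixes V :: "nat \<Rightarrow> nat \<Rightarrow> complex"
  assumes step: "\<And>j i. Suc j < s \<Longrightarrow> Suc i < r \<Longrightarrow> V (Suc j) i = V j (Suc i)"
    and "j < s" "i < r" "j' < s" "i' < r" "i + j = i' + j'"
  shows "V j i = V j' i'"
proof -
  have *: "V (j + k) i = V j (i + k)" if "j + k < s" "i + k < r" for j i k
    using that
  proof (induction k arbitrary: i)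
    case (Suc k)
    then show ?case using step[of "j + k" i] Suc.IH[of "Suc i"] by simp
  qed simp
  show ?thesis
  proof (cases "j \<le> j'")
    case True
    then have "i' + (j' - j) = i" "j + (j' - j) = j'" using assms by auto
    then show ?thesis using *[of j "j' - j" i'] assms by simp
  next
    case False
    then have "i + (j - j') = i'" "j' + (j - j') = j" using assms by auto
    then show ?thesis using *[of j' "j - j'" i] assms by simp
  qed
qed

text \<open>The Hankel matrix whose antidiagonals with index sum below \<open>max r s - 1\<close> are zero, while the later
  ones carry \<open>x 0, x 1, \<dots>\<close> in turn.\<close>

definition hankel_V :: "nat \<Rightarrow> nat \<Rightarrow> (nat \<Rightarrow> complex) \<Rightarrow> nat \<Rightarrow> nat \<Rightarrow> complex" where
  "hankel_V r s x j i = (if j < s \<and> i < r \<and> max r s \<le> Suc (i + j) then x (Suc (i + j) - max r s) else 0)"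

text \<open>The equations give \<open>U = -V\<^sup>T\<close> and make \<open>V\<close> a Hankel matrix whose first row and first column vanish
  except for their last entries. There are \<open>r + s - 1\<close> antidiagonals, and \<open>max r s - 1\<close> of them are
  forced to be zero.\<close>

lemma pair_sol_fin_inf:
  "has_dim (pair_sol (J_fin r 0) (J_inf s)) (min r s)"
proof (rule has_dim_coordsI[where \<phi> = "\<lambda>(U, V) k. if s \<le> r then V k (r - 1) else V (s - 1) k"
      and g = "\<lambda>x. (\<lambda>i j. - hankel_V r s x j i, hankel_V r s x)"])
  let ?S = "pair_sol (J_fin r 0) (J_inf s)" and ?\<phi> = "\<lambda>(U, V) k. if s \<le> r then V k (r - 1) else V (s - 1) k"
  show "clinear_on ?S ?\<phi>"
    by (auto simp: clinear_on_def fun_eq_iff)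
  show "?\<phi> u \<in> coords (min r s)" if "u \<in> ?S" for u
    using that by (auto simp: pair_sol_def supported_def coords_def)
  show "?\<phi> (\<lambda>i j. - hankel_V r s x j i, hankel_V r s x) = x" if "x \<in> coords (min r s)" for x
    using that by (auto simp: coords_def fun_eq_iff hankel_V_def)
  show "(\<lambda>i j. - hankel_V r s x j i, hankel_V r s x) \<in> ?S" if "x \<in> coords (min r s)" for x
  proof -
    have "shift (hankel_V r s x) j i = shift (\<lambda>i j. hankel_V r s x j i) i j" if "i < r" "j < s" for i j
      using that by (cases i; cases j) (auto simp: hankel_V_def)
    moreover have "shift (\<lambda>i j. - hankel_V r s x j i) i j = - shift (\<lambda>i j. hankel_V r s x j i) i j" for i j
      by (auto simp: shift_def)
    ultimately show ?thesis by (auto simp: pair_sol_def supported_def) (auto simp: hankel_V_def)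
  qed
  show "(\<lambda>i j. - hankel_V r s (?\<phi> u) j i, hankel_V r s (?\<phi> u)) = u" if u: "u \<in> ?S" for u
  proof (cases u)
    case [simp]: (Pair U V)
    have S: "(U, V) \<in> ?S" using u by simp
    have U: "U i j = - V j i" if "i < r" "j < s" for i j
      using pair_solD(1)[OF S, of i j] that by (simp add: eq_neg_iff_add_eq_0 add.commute)
    have sh: "shift U i j + shift V j i = 0" if "i < r" "j < s" for i j
      using pair_solD(2)[OF S, of i j] that by simp
    have step: "V (Suc j) i = V j (Suc i)" if "Suc j < s" "Suc i < r" for i j
      using sh[of "Suc i" "Suc j"] U[of i "Suc j"] that by (simp add: neg_eq_iff_add_eq_0)
    have V0: "V 0 i = 0" if "Suc i < r" "0 < s" for i
      using sh[of "Suc i" 0] U[of i 0] that by simp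
    have V0': "V j 0 = 0" if "Suc j < s" "0 < r" for j
      using sh[of 0 "Suc j"] that by simp
    have "V j i = hankel_V r s (?\<phi> u) j i" if ij: "i < r" "j < s" for i j
    proof (cases "max r s \<le> Suc (i + j)")
      case True
      show ?thesis
      proof (cases "s \<le> r")
        case True
        then have "V j i = V (Suc (i + j) - r) (r - 1)"
          using \<open>max r s \<le> Suc (i + j)\<close> ij by (intro hankel[where V = V and s = s and r = r, OF step]) auto
        then show ?thesis using True \<open>max r s \<le> Suc (i + j)\<close> ij by (simp add: hankel_V_def max_def)
      next
        case False
        then have "V j i = V (s - 1) (Suc (i + j) - s)"
          using \<open>max r s \<le> Suc (i + j)\<close> ij by (intro hankel[where V = V and s = s and r = r, OF step]) auto
        then show ?thesis using False \<open>max r s \<le> Suc (i + j)\<close> ij by (simp add: hankel_V_def max_def)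
      qed
    next
      case False
      have "V j i = 0"
      proof (cases "Suc (i + j) < r")
        case True
        then have "V j i = V 0 (i + j)" using ij by (intro hankel[where V = V and s = s and r = r, OF step]) auto
        then show ?thesis using V0[of "i + j"] True ij by simp
      next
        case r: False
        then have "V j i = V (i + j) 0" using ij False by (intro hankel[where V = V and s = s and r = r, OF step]) auto
        then show ?thesis using V0'[of "i + j"] r False ij by simp
      qed
      then show ?thesis using False by (simp only: hankel_V_def if_False simp_thms)
    qed
    then have "hankel_V r s (?\<phi> u) j i = V j i" for i j
      using pair_solD(4)[OF S, of j i] by (cases "i < r \<and> j < s") (auto simp: hankel_V_def)
    then have V: "hankel_V r s (?\<phi> u) = V" by blast
    moreover have "(\<lambda>i j. - V j i) = U"
    proof (intro ext)
      show "- V j i = U i j" for i j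
        using U[of i j] pair_solD(3)[OF S, of i j] pair_solD(4)[OF S, of j i] by (cases "i < r \<and> j < s") auto
    qed
    ultimately show ?thesis by (simp only: V Pair)
  qed
qed

text \<open>Again \<open>V\<close> is a Hankel matrix, of format \<open>(s + 1) \<times> (r + 1)\<close>. The first \<open>s\<close> entries of the first column
  and the last \<open>s\<close> entries of the last column vanish. This leaves the antidiagonals with index sum
  from \<open>s\<close> to \<open>r\<close>.\<close>

lemma pair_sol_L_LT: "has_dim (pair_sol (L r) (L_T s)) (Suc r - s)"
proof -
  let ?S = "pair_sol (L r) (L_T s)" and ?\<phi> = "\<lambda>(U, V) k. if k < Suc r - s then V s k else 0 :: complex"
  define h where "h x j i = (if j \<le> s \<and> i \<le> r \<and> s \<le> i + j \<and> i + j \<le> r then x (i + j - s) else 0)" 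
    for x :: "nat \<Rightarrow> complex" and j i
  define g where "g x = (\<lambda>i j. if i < r \<and> j < s then - h x (Suc j) i else 0, h x)" for x
  show ?thesis
  proof (rule has_dim_coordsI[where \<phi> = ?\<phi> and g = g])
    show "clinear_on ?S ?\<phi>" by (auto simp: clinear_on_def fun_eq_iff)
    show "?\<phi> u \<in> coords (Suc r - s)" if "u \<in> ?S" for u
      using that by (auto simp: coords_def split: prod.splits)
    show "?\<phi> (g x) = x" if "x \<in> coords (Suc r - s)" for x
      using that by (auto simp: coords_def fun_eq_iff g_def h_def)
    show "g x \<in> ?S" if "x \<in> coords (Suc r - s)" for x
    proof -
      have "h x (Suc j) r = 0" "h x j 0 = 0" if "j < s" for j using that by (auto simp: h_def)
      moreover have "h x (Suc j) i = h x j (Suc i)" if "j < s" "i < r" for i j using that by (auto simp: h_def)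
      ultimately have "shift (\<lambda>i j. if i < r \<and> j < s then - h x (Suc j) i else 0) i j + h x j i = 0" if "i \<le> r" "j < s" for i j
        using that by (cases i) auto
      moreover have "h x (Suc j) i + (if i < r then (if i < r \<and> j < s then - h x (Suc j) i else 0) else 0) = 0" if "i \<le> r" "j < s" for i j
        using that \<open>\<And>j. j < s \<Longrightarrow> h x (Suc j) r = 0\<close> by (cases "i = r") auto
      moreover have "h x \<in> supported (Suc s) (Suc r)" by (auto simp: h_def supported_def)
      ultimately show ?thesis by (auto simp: g_def pair_sol_def less_Suc_eq_le) (auto simp: supported_def)
    qed
    show "g (?\<phi> u) = u" if u: "u \<in> ?S" for u
    proof (cases u)
      case [simp]: (Pair U V)
      have S: "(U, V) \<in> ?S" using u by simp
      have U: "U i j = - V (Suc j) i" if "i < r" "j < s" for i j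
        using pair_solD(1)[OF S, of i j] that by (simp add: eq_neg_iff_add_eq_0 add.commute)
      have Vr: "V (Suc j) r = 0" if "j < s" for j
        using pair_solD(1)[OF S, of r j] that by simp
      have sh: "shift U i j + V j i = 0" if "i \<le> r" "j < s" for i j
        using pair_solD(2)[OF S, of i j] that by simp
      have V0: "V j 0 = 0" if "j < s" for j using sh[of 0 j] that by simp
      have step: "V (Suc j) i = V j (Suc i)" if "Suc j < Suc s" "Suc i < Suc r" for i j
        using sh[of "Suc i" j] U[of i j] that by simp
      have "V j i = h (?\<phi> u) j i" if ij: "i \<le> r" "j \<le> s" for i j
      proof -
        consider "i + j < s" | "s \<le> i + j" "i + j \<le> r" | "r < i + j" "s \<le> i + j" by linarith
        then show ?thesis
        proof cases
          case 1
          then have "V j i = V (i + j) 0" using ij by (intro hankel[where V = V and s = "Suc s" and r = "Suc r", OF step]) auto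
          then show ?thesis using 1 V0 by (simp add: h_def)
        next
          case 2
          then have "V j i = V s (i + j - s)" using ij by (intro hankel[where V = V and s = "Suc s" and r = "Suc r", OF step]) auto
          then show ?thesis using 2 ij by (simp add: h_def less_Suc_eq_le Suc_diff_le)
        next
          case 3
          then have "V j i = V (Suc (i + j - r - 1)) r" using ij by (intro hankel[where V = V and s = "Suc s" and r = "Suc r", OF step]) auto
          then show ?thesis using 3 ij Vr[of "i + j - r - 1"] by (simp add: h_def)
        qed
      qed
      then have "h (?\<phi> u) j i = V j i" for i j
        using pair_solD(4)[OF S, of j i] by (cases "i \<le> r \<and> j \<le> s") (auto simp: h_def)
      then have V: "h (?\<phi> u) = V" by blast
      moreover have "(\<lambda>i j. if i < r \<and> j < s then - V (Suc j) i else 0) = U"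
        using U pair_solD(3)[OF S] by (auto simp: fun_eq_iff)
      ultimately show ?thesis unfolding g_def V by simp
    qed
  qed
qed

text \<open>Each equation has the form \<open>U\<^sub>i\<^sub>j = -V\<^sub>j\<^sub>+\<^sub>1\<^sub>,\<^sub>i\<close> or \<open>V\<^sub>j\<^sub>i = -U\<^sub>i\<^sub>+\<^sub>1\<^sub>,\<^sub>j\<close>. Following these steps from any entry, one ends in the
  last row of \<open>U\<close> or in the last row of \<open>V\<close>, and these rows are free.\<close>

lemma pair_sol_LT_LT: "has_dim (pair_sol (L_T r) (L_T s)) (r + s)"
proof -
  let ?S = "pair_sol (L_T r) (L_T s)"
    and ?\<phi> = "\<lambda>(U, V) k. if k < s then U r k else if k < s + r then V s (k - s) else 0 :: complex"
  \<comment> \<open>Closed forms of the endpoint: the steps move along the diagonal, so from \<open>U\<^sub>i\<^sub>j\<close> the last row of \<open>U\<close> is reached first if and only if \<open>r - i < s - j\<close>.\<close>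
  define G where "G x i j = (if i \<le> r \<and> j < s then
      if j + r < s + i then x (j + r - i) else - x (s + (i + s - Suc j)) else 0)" for x :: "nat \<Rightarrow> complex" and i j
  define H where "H x j i = (if j \<le> s \<and> i < r then
      if i + s < r + j then x (s + (i + s - j)) else - x (j + r - Suc i) else 0)" for x :: "nat \<Rightarrow> complex" and j i
  have GH: "G x i j = - H x (Suc j) i" "H x j i = - G x (Suc i) j" if "i < r" "j < s" for x i j
    using that by (auto simp: G_def H_def)
  show ?thesis
  proof (rule has_dim_coordsI[where \<phi> = ?\<phi> and g = "\<lambda>x. (G x, H x)"])
    show "clinear_on ?S ?\<phi>" by (auto simp: clinear_on_def fun_eq_iff)
    show "?\<phi> u \<in> coords (r + s)" if "u \<in> ?S" for u
      using that by (auto simp: coords_def split: prod.splits)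
    show "?\<phi> (G x, H x) = x" if "x \<in> coords (r + s)" for x
      using that by (auto simp: coords_def fun_eq_iff G_def H_def)
    show "(G x, H x) \<in> ?S" if "x \<in> coords (r + s)" for x
      using GH[of _ _ x] by (auto simp: pair_sol_def) (auto simp: supported_def G_def H_def)
    show "(G (?\<phi> u), H (?\<phi> u)) = u" if u: "u \<in> ?S" for u
    proof (cases u)
      case [simp]: (Pair U V)
      have S: "(U, V) \<in> ?S" using u by simp
      have U: "U i j = - V (Suc j) i" if "i < r" "j < s" for i j
        using pair_solD(1)[OF S, of i j] that by (simp add: eq_neg_iff_add_eq_0 add.commute)
      have V: "V j i = - U (Suc i) j" if "i < r" "j < s" for i j
        using pair_solD(2)[OF S, of i j] that by (simp add: eq_neg_iff_add_eq_0 add.commute)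
      have "(j < s \<longrightarrow> U i j = G (?\<phi> u) i j) \<and> (i < r \<longrightarrow> V j i = H (?\<phi> u) j i)" if "i \<le> r" "j \<le> s" for i j
        using that
      proof (induction "r - i + (s - j)" arbitrary: i j rule: less_induct)
        case less
        have "U i j = G (?\<phi> u) i j" if "j < s"
        proof (cases "i = r")
          case True
          then show ?thesis using that by (simp add: G_def)
        next
          case False
          then show ?thesis using less.hyps[of i "Suc j"] less.prems that U[of i j] GH(1)[of i j] by simp
        qed
        moreover have "V j i = H (?\<phi> u) j i" if "i < r"
        proof (cases "j = s")
          case True
          then show ?thesis using that by (simp add: H_def)
        next
          case False
          then show ?thesis using less.hyps[of "Suc i" j] less.prems that V[of i j] GH(2)[of i j] by simp
        qed
        ultimately show ?case by blast
      qed
      then have "G (?\<phi> u) = U" "H (?\<phi> u) = V"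
        using pair_solD(3,4)[OF S] by (auto simp: G_def H_def fun_eq_iff less_Suc_eq_le)
      then show ?thesis by (simp only: Pair)
    qed
  qed
qed

text \<open>The case \<open>U = V\<close> of the preceding argument: \<open>U\<^sub>i\<^sub>j = -U\<^sub>j\<^sub>+\<^sub>1\<^sub>,\<^sub>i\<close> leads from any entry to the last row.\<close>

lemma self_sol_LT: "has_dim (self_sol (L_T r)) r"
proof -
  let ?S = "self_sol (L_T r)" and ?\<phi> = "\<lambda>U k. if k < r then U r k else 0 :: complex"
  define G where "G x i j = (if i \<le> r \<and> j < r then
      if j < i then x (j + r - i) else - x (i + r - Suc j) else 0)" for x :: "nat \<Rightarrow> complex" and i j
  have GG: "G x i j = - G x (Suc j) i" if "i < r" "j < r" for x i j
    using that by (auto simp: G_def)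
  show ?thesis
  proof (rule has_dim_coordsI[where \<phi> = ?\<phi> and g = G])
    show "clinear_on ?S ?\<phi>" by (auto simp: clinear_on_def fun_eq_iff)
    show "?\<phi> u \<in> coords r" if "u \<in> ?S" for u
      using that by (auto simp: coords_def)
    show "?\<phi> (G x) = x" if "x \<in> coords r" for x
      using that by (auto simp: coords_def fun_eq_iff G_def)
    show "G x \<in> ?S" if "x \<in> coords r" for x
      using GG[of _ _ x] by (auto simp: self_sol_def) (auto simp: supported_def G_def)
    show "G (?\<phi> U) = U" if S: "U \<in> ?S" for U
    proof -
      have U: "U i j = - U (Suc j) i" if "i < r" "j < r" for i j
        using self_solD(1)[OF S, of i j] that by (simp add: eq_neg_iff_add_eq_0 add.commute)
      have "U i j = G (?\<phi> U) i j" if "i \<le> r" "j < r" for i j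
        using that
      proof (induction "r - i + (r - j)" arbitrary: i j rule: less_induct)
        case less
        show ?case
        proof (cases "i = r")
          case True
          then show ?thesis using less.prems by (simp add: G_def)
        next
          case False
          then show ?thesis using less.hyps[of "Suc j" i] less.prems U[of i j] GG[of i j] by simp
        qed
      qed
      then show ?thesis
        using self_solD(2)[OF S] by (auto simp: G_def fun_eq_iff less_Suc_eq_le)
    qed
  qed
qed

text \<open>Row \<open>r - k\<close> of \<open>U\<close>, computed upwards from the free last row.\<close>

fun LT_fin_row :: "complex \<Rightarrow> (nat \<Rightarrow> complex) \<Rightarrow> nat \<Rightarrow> nat \<Rightarrow> complex" where
  "LT_fin_row z x 0 j = x j"
| "LT_fin_row z x (Suc k) j = z * LT_fin_row z x k j + (if j = 0 then 0 else LT_fin_row z x k (j - 1))"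

lemma pair_sol_LT_fin: "has_dim (pair_sol (L_T r) (J_fin s z)) s"
proof -
  let ?S = "pair_sol (L_T r) (J_fin s z)" and ?\<phi> = "\<lambda>(U, V) k. U r k :: complex"
  define G where "G x i j = (if i \<le> r \<and> j < s then LT_fin_row z x (r - i) j else 0)" for x i j
  define H where "H x j i = (if j < s \<and> i < r then - G x (Suc i) j else 0)" for x j i
  have GG: "G x i j = z * G x (Suc i) j + (if j = 0 then 0 else G x (Suc i) (j - 1))" if "i < r" "j < s" for x i j
  proof -
    have "r - i = Suc (r - Suc i)" using that by simp
    then show ?thesis using that by (auto simp: G_def)
  qed
  show ?thesis
  proof (rule has_dim_coordsI[where \<phi> = ?\<phi> and g = "\<lambda>x. (G x, H x)"])
    show "clinear_on ?S ?\<phi>" by (auto simp: clinear_on_def fun_eq_iff)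
    show "?\<phi> u \<in> coords s" if "u \<in> ?S" for u
      using that by (auto simp: coords_def pair_sol_def supported_def)
    show "?\<phi> (G x, H x) = x" if "x \<in> coords s" for x
      using that by (auto simp: coords_def fun_eq_iff G_def)
    show "(G x, H x) \<in> ?S" if "x \<in> coords s" for x
    proof -
      have "z * H x j i + shift (H x) j i + G x i j = 0" if "i < r" "j < s" for i j
        using GG[OF that, of x] that by (auto simp: H_def shift_def)
      then show ?thesis by (auto simp: pair_sol_def H_def[of x _ _]) (auto simp: supported_def G_def H_def)
    qed
    show "(G (?\<phi> u), H (?\<phi> u)) = u" if u: "u \<in> ?S" for u
    proof (cases u)
      case [simp]: (Pair U V)
      have S: "(U, V) \<in> ?S" using u by simp
      have V: "V j i = - U (Suc i) j" if "i < r" "j < s" for i j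
        using pair_solD(2)[OF S, of i j] that by (simp add: eq_neg_iff_add_eq_0 add.commute)
      have U: "U i j = z * U (Suc i) j + (if j = 0 then 0 else U (Suc i) (j - 1))" if "i < r" "j < s" for i j
      proof -
        have "(z * V j i + shift V j i) + U i j = 0"
          using pair_solD(1)[OF S, of i j] that by simp
        then have "U i j = - (z * V j i + shift V j i)" by (rule add_eq_0_iff[THEN iffD1])
        then show ?thesis using V that by (simp add: shift_def)
      qed
      have "U (r - k) j = LT_fin_row z (U r) k j" if "k \<le> r" "j < s" for k j
        using that
      proof (induction k arbitrary: j)
        case (Suc k)
        then have "Suc (r - Suc k) = r - k" by simp
        then show ?case using U[of "r - Suc k" j] Suc by auto
      qed simp
      from this[of "r - _"] have "U i j = G (U r) i j" if "i \<le> r" "j < s" for i j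
        using that by (simp add: G_def) (metis diff_diff_cancel diff_le_self)
      then have GU: "G (U r) = U"
        using pair_solD(3)[OF S] by (auto simp: G_def fun_eq_iff less_Suc_eq_le)
      moreover have "H (U r) = V"
        using V pair_solD(4)[OF S] by (auto simp: H_def GU fun_eq_iff)
      moreover have "?\<phi> u = U r" by (simp add: fun_eq_iff)
      ultimately show ?thesis by (simp only: Pair)
    qed
  qed
qed

text \<open>Here \<open>U\<^sub>i\<^sub>+\<^sub>1\<^sub>,\<^sub>j = U\<^sub>i\<^sub>,\<^sub>j\<^sub>-\<^sub>1\<close>, so that \<open>U\<close> is an upper triangular Toeplitz matrix, given by its first row.\<close>

lemma pair_sol_LT_inf: "has_dim (pair_sol (L_T r) (J_inf s)) s"
proof -
  let ?S = "pair_sol (L_T r) (J_inf s)" and ?\<phi> = "\<lambda>(U, V) k. U 0 k :: complex"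
  define G where "G x i j = (if i \<le> r \<and> i \<le> j \<and> j < s then x (j - i) else 0)" for x :: "nat \<Rightarrow> complex" and i j
  define H where "H x j i = (if j < s \<and> i < r then - G x i j else 0)" for x j i
  show ?thesis
  proof (rule has_dim_coordsI[where \<phi> = ?\<phi> and g = "\<lambda>x. (G x, H x)"])
    show "clinear_on ?S ?\<phi>" by (auto simp: clinear_on_def fun_eq_iff)
    show "?\<phi> u \<in> coords s" if "u \<in> ?S" for u
      using that by (auto simp: coords_def pair_sol_def supported_def)
    show "?\<phi> (G x, H x) = x" if "x \<in> coords s" for x
      using that by (auto simp: coords_def fun_eq_iff G_def)
    show "(G x, H x) \<in> ?S" if "x \<in> coords s" for x
    proof -
      have "G x (Suc i) j + shift (H x) j i = 0" if "i < r" "j < s" for i j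
        using that by (cases j) (auto simp: H_def G_def)
      then show ?thesis by (auto simp: pair_sol_def H_def[of x _ _]) (auto simp: supported_def G_def H_def)
    qed
    show "(G (?\<phi> u), H (?\<phi> u)) = u" if u: "u \<in> ?S" for u
    proof (cases u)
      case [simp]: (Pair U V)
      have S: "(U, V) \<in> ?S" using u by simp
      have V: "V j i = - U i j" if "i < r" "j < s" for i j
        using pair_solD(1)[OF S, of i j] that by (simp add: eq_neg_iff_add_eq_0 add.commute)
      have U: "U (Suc i) j = - shift V j i" if "i < r" "j < s" for i j
        using pair_solD(2)[OF S, of i j] that by (simp add: eq_neg_iff_add_eq_0 add.commute)
      have "U i j = G (U 0) i j" if "i \<le> r" "j < s" for i j
        using that
      proof (induction i arbitrary: j)
        case 0
        then show ?case by (simp add: G_def)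
      next
        case (Suc i)
        then show ?case using U[of i j] V[of i "j - 1"] by (cases j) (auto simp: G_def)
      qed
      then have "G (U 0) i j = U i j" for i j
        using pair_solD(3)[OF S, of i j] by (cases "i \<le> r \<and> j < s") (auto simp: G_def)
      then have GU: "G (U 0) = U" by blast
      moreover have "H (U 0) = V"
        using V pair_solD(4)[OF S] by (auto simp: H_def GU fun_eq_iff)
      moreover have "?\<phi> u = U 0" by (simp add: fun_eq_iff)
      ultimately show ?thesis by (simp only: Pair)
    qed
  qed
qed

section \<open>Single blocks for the eigenvalues 1 and -1\<close>

lemma self_sol_imp_pair_sol: "U \<in> self_sol A \<Longrightarrow> (U, U) \<in> pair_sol A A"
  by (auto simp: self_sol_def pair_sol_def)

lemma pair_sol_imp_self_sol: "(U, V) \<in> pair_sol A A \<Longrightarrow> U + V \<in> self_sol A"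
proof -
  assume S: "(U, V) \<in> pair_sol A A"
  have "left_term A U i j + left_term A V i j + (right_term A U i j + right_term A V i j) = 0"
    if "i < dim_col A" "j < dim_col A" for i j
  proof -
    have "(left_term A V i j + right_term A U i j) + (left_term A U i j + right_term A V i j) = 0"
      using pair_solD(1)[OF S that] pair_solD(2)[OF S that(2,1)] by simp
    then show ?thesis by (simp add: algebra_simps)
  qed
  then show ?thesis using S by (auto simp: self_sol_def pair_sol_def supported_def)
qed

text \<open>A solution of size \<open>r + 1\<close> vanishes before the main antidiagonal, and on it the entries are
  \<open>\<plusminus>U\<^sub>0\<^sub>r\<close>. If \<open>U\<^sub>0\<^sub>r = 0\<close>, then the first row and column vanish, and deleting them leaves a solution of
  size \<open>r\<close>.\<close>

lemma self_sol_fin_kernel: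
  assumes zz: "z * z = 1" and d: "has_dim (self_sol (J_fin r z)) d"
  shows "has_dim {U \<in> self_sol (J_fin (Suc r) z). U 0 r = 0} d"
proof (rule has_dim_bij[OF _ _ d])
  let ?S = "{U \<in> self_sol (J_fin (Suc r) z). U 0 r = 0}"
  let ?\<phi> = "\<lambda>U i j. U (Suc i) (Suc j) :: complex"
  let ?g = "\<lambda>U i j. shift (\<lambda>i'. shift (\<lambda>j' _. U i' j') j) i 0 :: complex"
  have U0: "U 0 i = 0" "U i 0 = 0" if U: "U \<in> ?S" for U i
  proof -
    have S: "(U, U) \<in> pair_sol (J_fin (Suc r) z) (J_fin (Suc r) z)"
      using U self_sol_imp_pair_sol by auto
    have row: "U j i = fin_row z (Suc r) (\<lambda>k. U k r) j i" if "i \<le> r" "j \<le> r" for i j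
      using pair_sol_fin_finD(2)[OF zz S, of i j] that by simp
    show "U 0 i = 0" using row[of i 0] U self_solD(2)[of U "J_fin (Suc r) z" 0 i] by (cases "i \<le> r") auto
    consider "i < r" | "i = r" | "r < i" by linarith
    then show "U i 0 = 0"
    proof cases
      case 1
      then show ?thesis using row[of 0 i] by (simp add: fin_row_zero)
    next
      case 2
      then show ?thesis using row[of 0 i] U by (simp add: fin_row_antidiagonal)
    next
      case 3
      then show ?thesis using U self_solD(2)[of U "J_fin (Suc r) z" i 0] by auto
    qed
  qed
  show "clinear_on ?S ?\<phi>" by (auto simp: clinear_on_def fun_eq_iff)
  show "bij_betw ?\<phi> ?S (self_sol (J_fin r z))"
  proof (rule bij_betw_byWitness[where f' = ?g])
    show "\<forall>U\<in>?S. ?g (?\<phi> U) = U"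
    proof (intro ballI ext)
      show "?g (?\<phi> U) i j = U i j" if "U \<in> ?S" for U i j
        using U0[OF that] by (cases i; cases j) auto
    qed
    show "\<forall>U\<in>self_sol (J_fin r z). ?\<phi> (?g U) = U" by auto
    show "?\<phi> ` ?S \<subseteq> self_sol (J_fin r z)"
    proof (rule image_subsetI)
      fix U assume U: "U \<in> ?S"
      then have S: "U \<in> self_sol (J_fin (Suc r) z)" by simp
      have "z * U (Suc j) (Suc i) + shift (?\<phi> U) j i + U (Suc i) (Suc j) = 0" if "i < r" "j < r" for i j
        using self_solD(1)[OF S, of "Suc i" "Suc j"] that U0[OF U] by (cases j) auto
      then show "?\<phi> U \<in> self_sol (J_fin r z)"
        using self_solD(2)[OF S] by (auto simp: self_sol_def supported_def)
    qed
    show "?g ` self_sol (J_fin r z) \<subseteq> ?S"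
    proof (rule image_subsetI)
      fix U assume S: "U \<in> self_sol (J_fin r z)"
      have "z * ?g U j i + shift (?g U) j i + ?g U i j = 0" if "i < Suc r" "j < Suc r" for i j
      proof (cases "i = 0 \<or> j = 0")
        case True
        then show ?thesis by (cases i; cases j) (auto simp: shift_def)
      next
        case False
        then obtain i' j' where [simp]: "i = Suc i'" "j = Suc j'" by (metis not0_implies_Suc)
        show ?thesis using self_solD(1)[OF S, of i' j'] that by (cases j') auto
      qed
      moreover have "?g U i j = 0" if "\<not> (i < Suc r \<and> j < Suc r)" for i j
        using that self_solD(2)[OF S] by (cases i; cases j) auto
      then have "?g U \<in> supported (Suc r) (Suc r)" unfolding supported_def by blast
      ultimately show "?g U \<in> ?S" by (auto simp: self_sol_def)
    qed
  qed
qed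

text \<open>The sign along the antidiagonal gives \<open>U\<^sub>r\<^sub>0 = (-1)\<^sup>r U\<^sub>0\<^sub>r\<close>, and the equation at \<open>(r, 0)\<close> says
  \<open>U\<^sub>r\<^sub>0 = -z U\<^sub>0\<^sub>r\<close>. So the corner entry can be nonzero for only one of the two eigenvalues.\<close>

lemma self_sol_fin_corner:
  assumes zz: "z * z = 1" and U: "U \<in> self_sol (J_fin (Suc r) z)"
  shows "(z + (-1) ^ r) * U 0 r = 0"
proof -
  have S: "(U, U) \<in> pair_sol (J_fin (Suc r) z) (J_fin (Suc r) z)" using U self_sol_imp_pair_sol by auto
  have "U r 0 = fin_row z (Suc r) (\<lambda>k. U k r) r 0"
    using pair_sol_fin_finD(2)[OF zz S, of 0 r] by simp
  then have "U r 0 = (-1) ^ r * U 0 r" using zz by (simp add: fin_row_antidiagonal)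
  then show ?thesis using self_solD(1)[OF U, of r 0] by (simp add: algebra_simps)
qed

text \<open>If the signs agree, symmetrizing a solution of the pair of equations for two equal blocks gives
  a solution with nonzero corner entry.\<close>

lemma self_sol_fin_corner_exists:
  assumes "z * z = 1" "z = - ((-1) ^ r)"
  obtains U where "U \<in> self_sol (J_fin (Suc r) z)" "U 0 r = 1"
proof -
  let ?V = "fin_sol_V z (Suc r) (Suc r) (\<lambda>k. if k = 0 then 1 else 0)"
  let ?U = "fin_sol_U z (Suc r) (Suc r) ?V"
  have "?U + ?V \<in> self_sol (J_fin (Suc r) z)"
    using fin_sol_UV_pair_sol[OF assms(1) order_refl] by (rule pair_sol_imp_self_sol)
  \<comment> \<open>Both \<open>U\<close> and \<open>V\<close> have the corner entry \<open>1\<close>.\<close>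
  then have S: "cscale (1/2) (?U + ?V) \<in> self_sol (J_fin (Suc r) z)"
    by (rule cvec.subspace_scale[OF subspace_self_sol])
  have V: "?V 0 r = 1" by (simp add: fin_sol_V_def)
  have "?V r 0 = (-1) ^ r" using assms(1) by (simp add: fin_sol_V_def fin_row_antidiagonal)
  moreover have "shift ?V r 0 = 0" by (cases r) (auto simp: fin_sol_V_def fin_row_zero)
  ultimately have "?U 0 r = - (z * (-1) ^ r)" by (simp add: fin_sol_U_def)
  then have "?U 0 r = 1" using assms by simp
  with V have "cscale (1/2) (?U + ?V) 0 r = 1" by simp
  with S show thesis by (rule that)
qed

text \<open>Passing from size \<open>r\<close> to size \<open>r + 1\<close>, the corner entry adds one dimension exactly if
  \<open>z = -(-1)\<^sup>r\<close>, that is, at every other step.\<close>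

lemma self_sol_fin_sign:
  assumes "z = 1 \<or> z = -1"
  shows "has_dim (self_sol (J_fin r z)) (if z = 1 then r div 2 else Suc r div 2)"
proof (induction r)
  case 0
  have "has_dim (self_sol (J_fin 0 z)) 0" by (rule has_dim_self_sol_trivial) auto
  then show ?case by (cases "z = 1") auto
next
  case (Suc r)
  let ?d = "\<lambda>r. if z = 1 then r div 2 else Suc r div 2"
  have zz: "z * z = 1" using assms by auto
  note ker = self_sol_fin_kernel[OF zz Suc.IH]
  show ?case
  proof (cases "z = (-1) ^ r")
    case True
    then have "U 0 r = 0" if "U \<in> self_sol (J_fin (Suc r) z)" for U
      using self_sol_fin_corner[OF zz that] by simp
    then have "{U \<in> self_sol (J_fin (Suc r) z). U 0 r = 0} = self_sol (J_fin (Suc r) z)" by blast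
    moreover have "?d (Suc r) = ?d r"
      using True assms by (cases "even r") auto
    ultimately show ?thesis using ker by simp
  next
    case False
    then have z: "z = - ((-1) ^ r)" using assms by (cases "even r") auto
    obtain U where U: "U \<in> self_sol (J_fin (Suc r) z)" "U 0 r = 1"
      using self_sol_fin_corner_exists[OF zz z] by blast
    have "has_dim (self_sol (J_fin (Suc r) z)) (Suc (?d r))"
      by (rule has_dim_Suc[where lf = "\<lambda>U. U 0 r" and ?u0.0 = U, OF subspace_self_sol _ U ker])
        (auto simp: clinear_on_def)
    moreover have "?d (Suc r) = Suc (?d r)"
      using z assms by (cases "even r") auto
    ultimately show ?thesis by simp
  qed
qed

section \<open>Decomposition into elementary blocks\<close>

datatype kblock = Fin nat complex | Inf nat | Sing nat | SingT nat

fun block_pencil :: "kblock \<Rightarrow> complex poly mat" where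
  "block_pencil (Fin r z) = J_fin r z"
| "block_pencil (Inf r) = J_inf r"
| "block_pencil (Sing r) = L r"
| "block_pencil (SingT r) = L_T r"

fun block_rows :: "kblock \<Rightarrow> nat" where
  "block_rows (Fin r z) = r"
| "block_rows (Inf r) = r"
| "block_rows (Sing r) = r"
| "block_rows (SingT r) = Suc r"

fun self_dim :: "kblock \<Rightarrow> nat" where
  "self_dim (Fin r z) = (if z = 1 then r div 2 else if z = -1 then Suc r div 2 else 0)"
| "self_dim (Inf r) = 0"
| "self_dim (Sing r) = 0"
| "self_dim (SingT r) = r"

text \<open>Subtraction is truncated: \<open>Suc r - s\<close> stands for \<open>max 0 (r + 1 - s)\<close>.\<close>

fun pair_dim :: "kblock \<Rightarrow> kblock \<Rightarrow> nat" where
  "pair_dim (Fin r z) (Fin s w) = (if z * w = 1 then min r s else 0)"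
| "pair_dim (Fin r z) (Inf s) = (if z = 0 then min r s else 0)"
| "pair_dim (Inf s) (Fin r z) = (if z = 0 then min r s else 0)"
| "pair_dim (Inf r) (Inf s) = 0"
| "pair_dim (Sing r) (Sing s) = 0"
| "pair_dim (Sing r) (SingT s) = Suc r - s"
| "pair_dim (SingT s) (Sing r) = Suc r - s"
| "pair_dim (SingT r) (SingT s) = r + s"
| "pair_dim (SingT r) y = block_rows y"
| "pair_dim x (SingT s) = block_rows x"
| "pair_dim (Sing r) y = 0"
| "pair_dim x (Sing s) = 0"

lemma has_dim_self_sol_block_pencil: "has_dim (self_sol (block_pencil x)) (self_dim x)"
proof (cases x)
  case [simp]: (Fin r z)
  show ?thesis
  proof (cases "z = 1 \<or> z = -1")
    case True
    then show ?thesis using self_sol_fin_sign[OF True, of r] by auto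
  next
    case False
    then have "z * z \<noteq> 1" by (simp add: square_eq_1_iff)
    then show ?thesis using False self_sol_fin_trivial by auto
  qed
qed (auto simp: self_sol_inf_trivial self_sol_L_trivial self_sol_LT)

lemma has_dim_pair_sol_fin_fin: "has_dim (pair_sol (J_fin r z) (J_fin s w)) (if z * w = 1 then min r s else 0)"
proof (cases "z * w = 1")
  case zw: True
  show ?thesis
  proof (cases "s \<le> r")
    case True
    then show ?thesis using pair_sol_fin_fin[OF zw True] zw by simp
  next
    case False
    then show ?thesis
      using has_dim_pair_sol_swap[OF pair_sol_fin_fin[of w z r s]] zw by (simp add: mult.commute)
  qed
qed (simp add: pair_sol_fin_fin_trivial)

lemma has_dim_pair_sol_block_pencil: "has_dim (pair_sol (block_pencil x) (block_pencil y)) (pair_dim x y)"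
proof -
  have fi: "has_dim (pair_sol (J_fin r z) (J_inf s)) (if z = 0 then min r s else 0)" for r z s
    using pair_sol_fin_inf pair_sol_fin_inf_trivial by auto
  note base = has_dim_pair_sol_fin_fin fi pair_sol_inf_inf_trivial pair_sol_L_L_trivial pair_sol_L_LT
    pair_sol_LT_LT pair_sol_LT_fin pair_sol_LT_inf pair_sol_L_fin_trivial pair_sol_L_inf_trivial
  show ?thesis
    by (cases x; cases y; simp only: block_pencil.simps pair_dim.simps block_rows.simps)
      (intro base base[THEN has_dim_pair_sol_swap])+
qed

lemma pair_dim_commute: "pair_dim x y = pair_dim y x"
  by (cases x; cases y) (auto simp: mult.commute)

text \<open>The dimension that belongs to a direct sum of elementary blocks.\<close>

fun sol_dim :: "kblock list \<Rightarrow> nat" where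
  "sol_dim [] = 0"
| "sol_dim (x # xs) = self_dim x + sum_list (map (pair_dim x) xs) + sol_dim xs"

definition cross_dim :: "kblock list \<Rightarrow> kblock list \<Rightarrow> nat" where
  "cross_dim xs ys = (\<Sum>x\<leftarrow>xs. \<Sum>y\<leftarrow>ys. pair_dim x y)"

lemma cross_dim_simps [simp]:
  "cross_dim [] ys = 0" "cross_dim (x # xs) ys = (\<Sum>y\<leftarrow>ys. pair_dim x y) + cross_dim xs ys"
  "cross_dim (xs @ xs') ys = cross_dim xs ys + cross_dim xs' ys" "cross_dim xs (ys @ ys') = cross_dim xs ys + cross_dim xs ys'"
  by (auto simp: cross_dim_def sum_list_addf)

lemma cross_dim_zero: "(\<And>x y. x \<in> set xs \<Longrightarrow> y \<in> set ys \<Longrightarrow> pair_dim x y = 0) \<Longrightarrow> cross_dim xs ys = 0"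
  by (auto simp: cross_dim_def)

lemma cross_dim_commute: "(\<Sum>y\<leftarrow>ys. \<Sum>x\<leftarrow>xs. pair_dim y x) = cross_dim xs ys"
  by (induction xs) (auto simp: sum_list_addf pair_dim_commute)

lemma sol_dim_append: "sol_dim (xs @ ys) = sol_dim xs + cross_dim xs ys + sol_dim ys"
  by (induction xs) auto

text \<open>The pencil behaves like the direct sum of the elementary blocks \<open>xs\<close>, alone and in pairs with any
  other pencil. The condition on pairs is additive in \<open>h\<close> instead of fixing the dimensions, so that it
  can be applied with an arbitrary \<open>X\<close>. The number of rows is recorded because \<open>D_I\<close> refers to \<open>n\<close>.\<close>

definition decomposes :: "complex poly mat \<Rightarrow> kblock list \<Rightarrow> bool" where
  "decomposes M xs \<longleftrightarrow> dim_row M = sum_list (map block_rows xs) \<and> has_dim (self_sol M) (sol_dim xs) \<and>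
     (\<forall>X h. (\<forall>y\<in>set xs. has_dim (pair_sol X (block_pencil y)) (h y)) \<longrightarrow>
        has_dim (pair_sol X M) (sum_list (map h xs)))"

lemma decomposes_block_pencil: "decomposes (block_pencil x) [x]"
proof -
  have "dim_row (block_pencil x) = block_rows x" by (cases x) auto
  then show ?thesis using has_dim_self_sol_block_pencil[of x] by (auto simp: decomposes_def)
qed

lemma decomposes_empty: "decomposes (0\<^sub>m 0 0) []"
proof -
  have "has_dim (self_sol (0\<^sub>m 0 0)) 0" by (rule has_dim_self_sol_trivial) auto
  moreover have "has_dim (pair_sol X (0\<^sub>m 0 0)) 0" for X by (rule has_dim_pair_sol_trivial) auto
  ultimately show ?thesis by (auto simp: decomposes_def)
qed

text \<open>Decompose \<open>A\<close> against the elementary blocks of \<open>B\<close>, and then \<open>B\<close> against \<open>A\<close>.\<close>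

lemma decomposes_pair_sol:
  assumes "decomposes A xs" "decomposes B ys"
  shows "has_dim (pair_sol A B) (cross_dim xs ys)"
proof -
  have "has_dim (pair_sol (block_pencil y) A) (\<Sum>x\<leftarrow>xs. pair_dim y x)" for y
    using assms(1) has_dim_pair_sol_block_pencil unfolding decomposes_def by blast
  then have "has_dim (pair_sol A (block_pencil y)) (\<Sum>x\<leftarrow>xs. pair_dim y x)" for y
    by (rule has_dim_pair_sol_swap)
  then have "has_dim (pair_sol A B) (\<Sum>y\<leftarrow>ys. \<Sum>x\<leftarrow>xs. pair_dim y x)"
    using assms(2)[unfolded decomposes_def, THEN conjunct2, THEN conjunct2, rule_format,
        of A "\<lambda>y. \<Sum>x\<leftarrow>xs. pair_dim y x"] by blast
  then show ?thesis by (simp only: cross_dim_commute)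
qed

lemma decomposes_direct_sum:
  assumes "decomposes A xs" "decomposes B ys"
  shows "decomposes (direct_sum A B) (xs @ ys)"
  using assms has_dim_self_sol_direct_sum[OF _ decomposes_pair_sol[OF assms]] has_dim_pair_sol_direct_sum
  unfolding decomposes_def by (auto simp: sol_dim_append)

lemma decomposes_diag_block_mat:
  "list_all2 decomposes Ms xss \<Longrightarrow> decomposes (diag_block_mat Ms) (concat xss)"
proof (induction rule: list_all2_induct)
  case Nil
  then show ?case using decomposes_empty by simp
next
  case (Cons M Ms xs xss)
  then show ?case unfolding diag_block_mat_Cons_direct_sum using decomposes_direct_sum by simp
qed

lemma decomposes_equiv: "equiv_by A B P P' Q Q' \<Longrightarrow> decomposes B xs \<Longrightarrow> decomposes A xs"
  using has_dim_self_sol_equiv has_dim_pair_sol_equiv unfolding decomposes_def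
  by (metis (no_types, lifting) equiv_by_def)

lemma cnj_pencil_J_fin: "cnj_pencil (J_fin r z) = J_fin r (cnj z)"
  unfolding cnj_pencil_def J_fin_def pencil_def const_mat_def
  by (rule eq_matI) (auto simp: jordan_block_def poly_eq_iff coeff_map_poly coeff_pCons split: nat.splits)

lemma decomposes_realification: "decomposes (realification (J_fin r z)) [Fin r z, Fin r (cnj z)]"
proof -
  have "decomposes (direct_sum (J_fin r z) (cnj_pencil (J_fin r z))) [Fin r z, Fin r (cnj z)]"
    unfolding cnj_pencil_J_fin using decomposes_direct_sum[OF decomposes_block_pencil[of "Fin r z"] decomposes_block_pencil[of "Fin r (cnj z)"]] by simp
  then show ?thesis by (rule decomposes_equiv[OF realification_equiv])
qed

section \<open>Counting\<close>

definition pairs_below :: "nat \<Rightarrow> (nat \<times> nat) set" where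
  "pairs_below n = {(j, k). j < k \<and> k < n}"

lemma finite_pairs_below [simp]: "finite (pairs_below n)"
  by (rule finite_subset[of _ "{..<n} \<times> {..<n}"]) (auto simp: pairs_below_def)

lemma Collect_pairs_below: "{(j, k). j < k \<and> k < n} = pairs_below n"
  by (simp add: pairs_below_def)

lemma sum_pairs_below_Suc:
  fixes g :: "nat \<times> nat \<Rightarrow> 'a :: comm_monoid_add"
  shows "sum g (pairs_below (Suc n)) = sum g (pairs_below n) + (\<Sum>j<n. g (j, n))"
proof -
  have "pairs_below (Suc n) = pairs_below n \<union> (\<lambda>j. (j, n)) ` {..<n}"
    by (auto simp: pairs_below_def)
  moreover have "sum g ((\<lambda>j. (j, n)) ` {..<n}) = (\<Sum>j<n. g (j, n))"
    by (subst sum.reindex) (auto simp: inj_on_def)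
  moreover have "sum g (pairs_below n \<union> (\<lambda>j. (j, n)) ` {..<n}) = sum g (pairs_below n) + sum g ((\<lambda>j. (j, n)) ` {..<n})"
    by (rule sum.union_disjoint) (simp, simp, auto simp: pairs_below_def)
  ultimately show ?thesis by simp
qed

definition family :: "(nat \<Rightarrow> kblock list) \<Rightarrow> nat \<Rightarrow> kblock list" where
  "family g n = concat (map g [0..<n])"

lemma family_simps: "family g 0 = []" "family g (Suc n) = family g n @ g n"
  by (auto simp: family_def)

lemma set_family: "x \<in> set (family g n) \<longleftrightarrow> (\<exists>j<n. x \<in> set (g j))"
  by (auto simp: family_def)

lemma cross_dim_family: "cross_dim (family g n) ys = (\<Sum>j<n. cross_dim (g j) ys)"
  by (induction n) (auto simp: family_simps)

lemma sol_dim_family: "sol_dim (family g n) = (\<Sum>j<n. sol_dim (g j)) + (\<Sum>(j, k)\<in>pairs_below n. cross_dim (g j) (g k))"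
proof (induction n)
  case 0
  then show ?case by (simp add: family_simps pairs_below_def)
next
  case (Suc n)
  then show ?case by (simp add: family_simps sol_dim_append sum_pairs_below_Suc cross_dim_family)
qed

lemma rows_family: "sum_list (map block_rows (family g n)) = (\<Sum>j<n. sum_list (map block_rows (g j)))"
  by (induction n) (auto simp: family_simps)

definition L_blocks where "L_blocks r = [Sing r, SingT r]"
definition Z_blocks where "Z_blocks r = [Fin r 0, Inf r]"
definition J_blocks where "J_blocks r z = [Fin r z, Fin r (1 / z)]"
text \<open>The four elementary blocks that a pair of realified blocks represents.\<close>

definition R_blocks where "R_blocks r z = [Fin r z, Fin r (cnj z), Fin r (1 / z), Fin r (1 / cnj z)]"

definition all_blocks where
  "all_blocks a s b t c m d n' e p \<alpha> f q lam =
     family (\<lambda>j. L_blocks (s j)) a @ family (\<lambda>j. Z_blocks (t j)) b @ family (\<lambda>j. [Fin (m j) 1]) c @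
     family (\<lambda>j. [Fin (n' j) (-1)]) d @ family (\<lambda>j. J_blocks (p j) (\<alpha> j)) e @ family (\<lambda>j. R_blocks (q j) (lam j)) f"

lemma decomposes_pair: "decomposes A xs \<Longrightarrow> decomposes B ys \<Longrightarrow> decomposes (diag_block_mat [A, B]) (xs @ ys)"
  using decomposes_diag_block_mat[of "[A, B]" "[xs, ys]"] by simp

lemma decomposes_K_pencil:
  "decomposes (K_pencil a s b t c m d n' e p \<alpha> f q lam) (all_blocks a s b t c m d n' e p \<alpha> f q lam)"
proof -
  have L: "decomposes (paired_L r) (L_blocks r)" for r
    unfolding paired_L_def L_blocks_def
    using decomposes_pair[OF decomposes_block_pencil[of "Sing r"] decomposes_block_pencil[of "SingT r"]] by simp
  have Z: "decomposes (paired_Z r) (Z_blocks r)" for r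
    unfolding paired_Z_def Z_blocks_def
    using decomposes_pair[OF decomposes_block_pencil[of "Fin r 0"] decomposes_block_pencil[of "Inf r"]] by simp
  have F: "decomposes (J_fin r z) [Fin r z]" for r z
    using decomposes_block_pencil[of "Fin r z"] by simp
  have J: "decomposes (paired_J r z) (J_blocks r z)" for r z
    unfolding paired_J_def J_blocks_def using decomposes_pair[OF F F, of r z r "1 / z"] by simp
  have R: "decomposes (paired_J_real r z) (R_blocks r z)" for r z
    unfolding paired_J_real_def R_blocks_def
    using decomposes_pair[OF decomposes_realification decomposes_realification, of r z r "1 / z"] by simp
  have f: "list_all2 decomposes (map M [0..<k]) (map g [0..<k])" if "\<And>j. decomposes (M j) (g j)" for M g k
    using that by (simp add: list_all2_conv_all_nth)
  have "decomposes (K_pencil a s b t c m d n' e p \<alpha> f q lam) (concat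
     (map (\<lambda>j. L_blocks (s j)) [0..<a] @ map (\<lambda>j. Z_blocks (t j)) [0..<b] @ map (\<lambda>j. [Fin (m j) 1]) [0..<c] @
      map (\<lambda>j. [Fin (n' j) (-1)]) [0..<d] @ map (\<lambda>j. J_blocks (p j) (\<alpha> j)) [0..<e] @
      map (\<lambda>j. R_blocks (q j) (lam j)) [0..<f]))"
    unfolding K_pencil_def
    by (intro decomposes_diag_block_mat list_all2_appendI f L Z F J R)
  then show ?thesis by (simp only: all_blocks_def family_def concat_append)
qed

text \<open>For two paired singular blocks the mixed pairs contribute \<open>max 0 (r + 1 - r') + max 0 (r' + 1 - r)\<close> and
  the two transposed blocks contribute \<open>r + r'\<close>. Together this is \<open>max (2r + 1) (2r' + 1)\<close>, and one more if
  \<open>r = r'\<close>, since then both truncated differences equal \<open>1\<close>.\<close>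

lemma count_L: "int (sol_dim (family (\<lambda>j. L_blocks (s j)) a)) = D_L a s"
proof -
  have c: "cross_dim (L_blocks r) (L_blocks r') = max (2 * r + 1) (2 * r' + 1) + (if r = r' then 1 else 0)" for r r'
    by (auto simp: L_blocks_def)
  have "(\<Sum>(j, k)\<in>pairs_below a. cross_dim (L_blocks (s j)) (L_blocks (s k)))
      = (\<Sum>(j, k)\<in>pairs_below a. max (2 * s j + 1) (2 * s k + 1)) + (\<Sum>(j, k)\<in>pairs_below a. if s j = s k then 1 else 0)"
    unfolding c by (simp only: case_prod_unfold sum.distrib)
  also have "(\<Sum>(j, k)\<in>pairs_below a. if s j = s k then 1 else 0) = card {x \<in> pairs_below a. s (fst x) = s (snd x)}"
    by (simp add: case_prod_unfold flip: sum.inter_filter)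
  also have "{x \<in> pairs_below a. s (fst x) = s (snd x)} = {(j, k). j < k \<and> k < a \<and> s j = s k}"
    by (auto simp: pairs_below_def)
  moreover have "sol_dim (L_blocks r) = r + 1" for r by (simp add: L_blocks_def)
  ultimately show ?thesis
    unfolding sol_dim_family D_L_def Collect_pairs_below by (simp add: case_prod_unfold)
qed

lemma count_Z: "int (sol_dim (family (\<lambda>j. Z_blocks (t j)) b)) = D_Z b t"
proof -
  have c: "cross_dim (Z_blocks r) (Z_blocks r') = min (2 * r) (2 * r')" for r r'
    by (auto simp: Z_blocks_def)
  have "sol_dim (Z_blocks r) = r" for r by (simp add: Z_blocks_def)
  then show ?thesis
    unfolding sol_dim_family D_Z_def Collect_pairs_below by (simp add: c case_prod_unfold)
qed

lemma count_plus1: "int (sol_dim (family (\<lambda>j. [Fin (m j) 1]) c)) = D_plus1 c m"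
proof -
  have f: "\<lfloor>real k / 2\<rfloor> = int (k div 2)" for k
    using floor_divide_of_nat_eq[of k 2, where ?'a = real] by simp
  have "cross_dim [Fin r 1] [Fin r' 1] = min r r'" for r r' by simp
  then show ?thesis
    unfolding sol_dim_family D_plus1_def Collect_pairs_below by (simp add: f case_prod_unfold del: cross_dim_simps)
qed

lemma count_minus1: "int (sol_dim (family (\<lambda>j. [Fin (n' j) (-1)]) d)) = D_minus1 d n'"
proof -
  have f: "\<lceil>real k / 2\<rceil> = int (Suc k div 2)" for k
  proof (cases "even k")
    case True
    then show ?thesis by auto
  next
    case False
    then obtain j where "k = 2 * j + 1" by (elim oddE)
    then show ?thesis by (simp add: ceiling_eq_iff)
  qed
  have "cross_dim [Fin r (-1)] [Fin r' (-1)] = min r r'" for r r' by simp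
  then show ?thesis
    unfolding sol_dim_family D_minus1_def Collect_pairs_below by (simp add: f case_prod_unfold del: cross_dim_simps)
qed

lemma sum_pairs_below_if:
  "(\<Sum>(j, k)\<in>pairs_below n. if P j k then h j k else 0) = (\<Sum>(j, k)\<in>{(j, k). j < k \<and> k < n \<and> P j k}. h j k :: nat)"
proof -
  have "(\<Sum>x\<in>pairs_below n. if P (fst x) (snd x) then h (fst x) (snd x) else 0)
      = (\<Sum>x\<in>{x \<in> pairs_below n. P (fst x) (snd x)}. h (fst x) (snd x))"
    by (simp add: sum.inter_filter)
  also have "{x \<in> pairs_below n. P (fst x) (snd x)} = {(j, k). j < k \<and> k < n \<and> P j k}"
    by (auto simp: pairs_below_def)
  finally show ?thesis by (simp add: case_prod_unfold)
qed

lemma minus_eq_one: "- z = 1 \<longleftrightarrow> z = (-1 :: complex)"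
  by (auto simp: minus_equation_iff)

lemma Omega_nz: "x \<in> Omega \<Longrightarrow> x \<noteq> 0 \<and> x * x \<noteq> 1 \<and> x \<noteq> 1 \<and> x \<noteq> -1"
  by (auto simp: Omega_def square_eq_1_iff)

text \<open>Two of the four products of eigenvalues can be \<open>1\<close> because \<open>x = y\<close>, and the other two because
  \<open>x y = 1\<close>. Both do not happen together, as \<open>x\<^sup>2 \<noteq> 1\<close>.\<close>

lemma cross_dim_J_blocks:
  assumes x: "x \<in> Omega" and y: "y \<in> Omega"
  shows "cross_dim (J_blocks r x) (J_blocks r' y) = (if alpha_equiv x y then min (2 * r) (2 * r') else 0)"
proof -
  have nz: "x \<noteq> 0" "x * x \<noteq> 1" "y \<noteq> 0" "y * y \<noteq> 1" using Omega_nz[OF x] Omega_nz[OF y] by auto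
  have e: "alpha_equiv x y \<longleftrightarrow> x = y \<or> x * y = 1"
    using nz by (auto simp: alpha_equiv_def doubleton_eq_iff field_simps)
  have "x * (1 / y) = 1 \<longleftrightarrow> x = y" "1 / x * y = 1 \<longleftrightarrow> x = y" "1 / x * (1 / y) = 1 \<longleftrightarrow> x * y = 1"
    using nz by (auto simp: field_simps)
  then show ?thesis
    unfolding e using nz by (cases "x = y") (auto simp: J_blocks_def)
qed

lemma count_alpha:
  assumes "\<And>j. j < e \<Longrightarrow> \<alpha> j \<in> Omega"
  shows "int (sol_dim (family (\<lambda>j. J_blocks (p j) (\<alpha> j)) e)) = D_alpha e p \<alpha>"
proof -
  have "sol_dim (J_blocks r x) = r" if "x \<in> Omega" for r x
    using Omega_nz[OF that] by (auto simp: J_blocks_def field_simps minus_eq_one)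
  then have "(\<Sum>j<e. sol_dim (J_blocks (p j) (\<alpha> j))) = (\<Sum>j<e. p j)"
    using assms by (intro sum.cong) auto
  moreover have "(\<Sum>(j, k)\<in>pairs_below e. cross_dim (J_blocks (p j) (\<alpha> j)) (J_blocks (p k) (\<alpha> k)))
    = (\<Sum>(j, k)\<in>pairs_below e. if alpha_equiv (\<alpha> j) (\<alpha> k) then min (2 * p j) (2 * p k) else 0)"
    using assms by (intro sum.cong) (auto simp: pairs_below_def cross_dim_J_blocks)
  ultimately show ?thesis
    unfolding sum_pairs_below_if by (simp add: sol_dim_family D_alpha_def case_prod_unfold)
qed

text \<open>The condition under which \<open>z\<close>, \<open>cnj z\<close>, \<open>1 / z\<close> and \<open>1 / cnj z\<close> are four different numbers.\<close>

definition generic :: "complex \<Rightarrow> bool" where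
  "generic z \<longleftrightarrow> z \<notin> \<real> \<and> cmod z \<noteq> 1"

lemma generic_neq:
  assumes "generic z"
  shows "z \<noteq> 0" "z \<noteq> cnj z" "z * z \<noteq> 1" "z * cnj z \<noteq> 1"
proof -
  have z: "z \<notin> \<real>" "cmod z \<noteq> 1" using assms by (auto simp: generic_def)
  show "z \<noteq> 0" "z \<noteq> cnj z" using z by (auto simp: Reals_cnj_iff)
  show "z * z \<noteq> 1" using z by (auto simp: square_eq_1_iff)
  show "z * cnj z \<noteq> 1"
  proof
    assume "z * cnj z = 1"
    then have "complex_of_real ((cmod z)\<^sup>2) = of_real 1" by (metis complex_norm_square of_real_1)
    then have "(cmod z)\<^sup>2 = 1" by (simp only: of_real_eq_iff)
    then show False using z norm_ge_zero[of z] by (simp add: power2_eq_1_iff)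
  qed
qed

text \<open>Each of the sixteen conditions on products of eigenvalues reduces to one of \<open>z w = 1\<close>,
  \<open>z (cnj w) = 1\<close>, \<open>z = w\<close> and \<open>z = cnj w\<close>, each of them four times. These exclude each other and together
  express \<open>lambda_equiv z w\<close>.\<close>

lemma cross_dim_R_blocks:
  assumes z: "generic z" and w: "generic w"
  shows "cross_dim (R_blocks r z) (R_blocks r' w) = (if lambda_equiv z w then min (4 * r) (4 * r') else 0)"
proof -
  note dz = generic_neq[OF z] and dw = generic_neq[OF w]
  have dz': "cnj z * cnj z \<noteq> 1" "cnj z \<noteq> 0" and dw': "cnj w * cnj w \<noteq> 1" "cnj w \<noteq> 0"
    using dz dw by (metis complex_cnj_mult complex_cnj_one complex_cnj_cnj, simp)+
  have e: "lambda_equiv z w \<longleftrightarrow> z = w \<or> z = cnj w \<or> z * w = 1 \<or> z * cnj w = 1"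
  proof
    assume "lambda_equiv z w"
    then have "z \<in> {w, cnj w, 1 / w, 1 / cnj w}" unfolding lambda_equiv_def by blast
    then show "z = w \<or> z = cnj w \<or> z * w = 1 \<or> z * cnj w = 1" using dw dw' by auto
  next
    assume "z = w \<or> z = cnj w \<or> z * w = 1 \<or> z * cnj w = 1"
    then have "z = w \<or> z = cnj w \<or> z = 1 / w \<or> z = 1 / cnj w" using dw dw' by (auto simp: field_simps)
    then show "lambda_equiv z w" by (auto simp: lambda_equiv_def)
  qed
  have m: "z * (1 / w) = 1 \<longleftrightarrow> z = w" "z * (1 / cnj w) = 1 \<longleftrightarrow> z = cnj w"
    "cnj z * w = 1 \<longleftrightarrow> z * cnj w = 1" "cnj z * cnj w = 1 \<longleftrightarrow> z * w = 1"
    "cnj z * (1 / w) = 1 \<longleftrightarrow> z = cnj w" "cnj z * (1 / cnj w) = 1 \<longleftrightarrow> z = w"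
    "1 / z * w = 1 \<longleftrightarrow> z = w" "1 / z * cnj w = 1 \<longleftrightarrow> z = cnj w"
    "1 / z * (1 / w) = 1 \<longleftrightarrow> z * w = 1" "1 / z * (1 / cnj w) = 1 \<longleftrightarrow> z * cnj w = 1"
    "1 / cnj z * w = 1 \<longleftrightarrow> z = cnj w" "1 / cnj z * cnj w = 1 \<longleftrightarrow> z = w"
    "1 / cnj z * (1 / w) = 1 \<longleftrightarrow> z * cnj w = 1" "1 / cnj z * (1 / cnj w) = 1 \<longleftrightarrow> z * w = 1"
  proof -
    have c: "cnj z * w = 1 \<longleftrightarrow> z * cnj w = 1" "cnj z * cnj w = 1 \<longleftrightarrow> z * w = 1" "cnj z = w \<longleftrightarrow> z = cnj w"
      by (metis complex_cnj_mult complex_cnj_one complex_cnj_cnj)+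
    have d: "x * (1 / y) = 1 \<longleftrightarrow> x = y" "1 / x * y = 1 \<longleftrightarrow> x = y" "1 / x * (1 / y) = 1 \<longleftrightarrow> x * y = 1"
      if "x \<noteq> 0" "y \<noteq> 0" for x y :: complex using that by (auto simp: field_simps)
    show "cnj z * w = 1 \<longleftrightarrow> z * cnj w = 1" "cnj z * cnj w = 1 \<longleftrightarrow> z * w = 1" by (fact c)+
    show "z * (1 / w) = 1 \<longleftrightarrow> z = w" "z * (1 / cnj w) = 1 \<longleftrightarrow> z = cnj w"
      "cnj z * (1 / w) = 1 \<longleftrightarrow> z = cnj w" "cnj z * (1 / cnj w) = 1 \<longleftrightarrow> z = w"
      "1 / z * w = 1 \<longleftrightarrow> z = w" "1 / z * cnj w = 1 \<longleftrightarrow> z = cnj w"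
      "1 / z * (1 / w) = 1 \<longleftrightarrow> z * w = 1" "1 / z * (1 / cnj w) = 1 \<longleftrightarrow> z * cnj w = 1"
      "1 / cnj z * w = 1 \<longleftrightarrow> z = cnj w" "1 / cnj z * cnj w = 1 \<longleftrightarrow> z = w"
      "1 / cnj z * (1 / w) = 1 \<longleftrightarrow> z * cnj w = 1" "1 / cnj z * (1 / cnj w) = 1 \<longleftrightarrow> z * w = 1"
      by (simp_all only: d[OF dz(1) dw(1)] d[OF dz(1) dw'(2)] d[OF dz'(2) dw(1)] d[OF dz'(2) dw'(2)] c complex_cnj_cancel_iff)
  qed
  define k where "k = min r r'"
  have "cross_dim (R_blocks r z) (R_blocks r' w) =
      (if z * w = 1 then 4 * k else 0) + (if z * cnj w = 1 then 4 * k else 0)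
      + (if z = w then 4 * k else 0) + (if z = cnj w then 4 * k else 0)"
    by (simp add: R_blocks_def m del: times_divide_eq_left times_divide_eq_right mult_1_right mult_1_left flip: k_def)
  also have "\<dots> = (if lambda_equiv z w then 4 * k else 0)"
  proof -
    have "\<not> (z = w \<and> z = cnj w)" "\<not> (z = w \<and> z * w = 1)" "\<not> (z = w \<and> z * cnj w = 1)"
      "\<not> (z = cnj w \<and> z * w = 1)" "\<not> (z = cnj w \<and> z * cnj w = 1)"
      using dw dw' by (auto simp: mult.commute)
    moreover have "\<not> (z * w = 1 \<and> z * cnj w = 1)" using dz(1) dw(2) by (metis mult_cancel_left)
    ultimately show ?thesis unfolding e by auto
  qed
  also have "4 * k = min (4 * r) (4 * r')" by (simp add: k_def)
  finally show ?thesis .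
qed

lemma sol_dim_R_blocks:
  assumes "generic z"
  shows "sol_dim (R_blocks r z) = 2 * r"
proof -
  note d = generic_neq[OF assms]
  have "cnj z * cnj z \<noteq> 1" using d(3) by (metis complex_cnj_mult complex_cnj_one complex_cnj_cnj)
  moreover have "z \<noteq> 1" "z \<noteq> -1" using d by auto
  moreover have "cnj z \<noteq> 1" "cnj z \<noteq> -1" using \<open>cnj z * cnj z \<noteq> 1\<close> by auto
  moreover have "z \<noteq> cnj z" "cnj z \<noteq> z" using d(2) by metis+
  ultimately show ?thesis using d(1,4) by (simp add: R_blocks_def field_simps minus_eq_one)
qed

lemma count_P:
  assumes "\<And>j. j < f \<Longrightarrow> generic (lam j)"
  shows "int (sol_dim (family (\<lambda>j. R_blocks (q j) (lam j)) f)) = D_P f q lam"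
proof -
  have "(\<Sum>j<f. sol_dim (R_blocks (q j) (lam j))) = (\<Sum>j<f. 2 * q j)"
    using assms by (intro sum.cong) (auto simp: sol_dim_R_blocks)
  moreover have "(\<Sum>(j, k)\<in>pairs_below f. cross_dim (R_blocks (q j) (lam j)) (R_blocks (q k) (lam k)))
    = (\<Sum>(j, k)\<in>pairs_below f. if lambda_equiv (lam j) (lam k) then min (4 * q j) (4 * q k) else 0)"
    using assms by (intro sum.cong) (auto simp: pairs_below_def cross_dim_R_blocks)
  ultimately show ?thesis
    unfolding sum_pairs_below_if by (simp add: sol_dim_family D_P_def case_prod_unfold)
qed

definition regular :: "kblock \<Rightarrow> bool" where
  "regular x \<longleftrightarrow> (\<exists>r z. x = Fin r z) \<or> (\<exists>r. x = Inf r)"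

lemma cross_dim_L_regular:
  assumes "\<And>y. y \<in> set ys \<Longrightarrow> regular y"
  shows "cross_dim (family (\<lambda>j. L_blocks (s j)) a) ys = a * sum_list (map block_rows ys)"
proof -
  have "pair_dim (Sing r) y = 0" "pair_dim (SingT r) y = block_rows y" if "y \<in> set ys" for r y
    using assms[OF that] by (auto simp: regular_def)
  then have "map (pair_dim (Sing r)) ys = map (\<lambda>_. 0) ys" "map (pair_dim (SingT r)) ys = map block_rows ys" for r by auto
  then have "cross_dim (L_blocks r) ys = sum_list (map block_rows ys)" for r
    by (simp add: L_blocks_def del: map_eq_conv)
  then show ?thesis by (simp add: cross_dim_family)
qed

text \<open>Eigenvalues from different families are never reciprocal, so the only pairs from different families
  that contribute are those of a singular block with a regular one.\<close>

lemma sol_dim_all_blocks: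
  assumes \<alpha>: "\<And>j. j < e \<Longrightarrow> \<alpha> j \<in> Omega" and lam: "\<And>j. j < f \<Longrightarrow> generic (lam j)"
    and n: "n = sum_list (map block_rows (all_blocks a s b t c m d n' e p \<alpha> f q lam))"
  shows "int (sol_dim (all_blocks a s b t c m d n' e p \<alpha> f q lam))
    = D_L a s + D_Z b t + D_plus1 c m + D_minus1 d n' + D_alpha e p \<alpha> + D_P f q lam + D_I n a s"
proof -
  define LL where "LL = family (\<lambda>j. L_blocks (s j)) a"
  define ZZ where "ZZ = family (\<lambda>j. Z_blocks (t j)) b"
  define P1 where "P1 = family (\<lambda>j. [Fin (m j) 1]) c"
  define M1 where "M1 = family (\<lambda>j. [Fin (n' j) (-1)]) d"
  define JJ where "JJ = family (\<lambda>j. J_blocks (p j) (\<alpha> j)) e"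
  define RR where "RR = family (\<lambda>j. R_blocks (q j) (lam j)) f"
  define reg where "reg = ZZ @ P1 @ M1 @ JJ @ RR"
  have all: "all_blocks a s b t c m d n' e p \<alpha> f q lam = LL @ reg"
    by (simp add: all_blocks_def LL_def ZZ_def P1_def M1_def JJ_def RR_def reg_def)
  have sZ: "x \<in> set ZZ \<Longrightarrow> (\<exists>r. x = Fin r 0) \<or> (\<exists>r. x = Inf r)" for x
    by (auto simp: ZZ_def set_family Z_blocks_def)
  have sP: "x \<in> set P1 \<Longrightarrow> \<exists>r. x = Fin r 1" for x by (auto simp: P1_def set_family)
  have sM: "x \<in> set M1 \<Longrightarrow> \<exists>r. x = Fin r (-1)" for x by (auto simp: M1_def set_family)
  have O: "1 / z \<in> Omega" if "z \<in> Omega" for z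
    using that by (auto simp: Omega_def norm_divide field_simps minus_eq_one)
  have c: "generic (cnj z)" if "generic z" for z using that by (auto simp: generic_def Reals_cnj_iff)
  have i: "generic (1 / z)" if "generic z" for z
  proof -
    have "1 / (1 / z) = z" by simp
    then have "1 / z \<notin> \<real>" using that by (metis Reals_1 Reals_divide generic_def)
    then show ?thesis using that by (auto simp: generic_def norm_divide)
  qed
  note G = c i i[OF c]
  have sJ: "x \<in> set JJ \<Longrightarrow> \<exists>r z. x = Fin r z \<and> z \<in> Omega" for x
    using \<alpha> O by (auto simp: JJ_def set_family J_blocks_def)
  have sR: "x \<in> set RR \<Longrightarrow> \<exists>r z. x = Fin r z \<and> generic z" for x
    using lam G by (auto simp: RR_def set_family R_blocks_def)
  have oz: "z \<noteq> 0 \<and> z \<noteq> 1 \<and> z \<noteq> -1" if "z \<in> Omega \<or> generic z" for z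
    using that Omega_nz generic_neq(1,3) by fastforce
  have neg1: "- 1 * z \<noteq> 1" if "z \<noteq> -1" for z :: complex using that by (simp add: minus_eq_one)
  have og: "z * w \<noteq> 1" if "z \<in> Omega" "generic w" for z w
  proof
    assume "z * w = 1"
    then have "w = 1 / z" by (metis mult_zero_left nonzero_mult_div_cancel_left zero_neq_one)
    then have "w \<in> Omega" using O[OF that(1)] by simp
    then show False using that(2) by (auto simp: Omega_def generic_def)
  qed
  have "cross_dim ZZ (P1 @ M1 @ JJ @ RR) = 0"
    by (rule cross_dim_zero) (use sZ sP sM sJ sR oz in \<open>fastforce\<close>)
  moreover have "cross_dim P1 (M1 @ JJ @ RR) = 0"
    by (rule cross_dim_zero) (use sP sM sJ sR oz in \<open>fastforce\<close>)
  moreover have "cross_dim M1 (JJ @ RR) = 0"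
    by (rule cross_dim_zero) (use sM sJ sR oz neg1 in \<open>fastforce\<close>)
  moreover have "cross_dim JJ RR = 0"
    by (rule cross_dim_zero) (use sJ sR og in \<open>fastforce\<close>)
  ultimately have reg: "sol_dim reg = sol_dim ZZ + sol_dim P1 + sol_dim M1 + sol_dim JJ + sol_dim RR"
    unfolding reg_def sol_dim_append by simp
  have "regular x" if "x \<in> set reg" for x
    using that sZ sP sM sJ sR unfolding reg_def regular_def set_append by blast
  then have "cross_dim LL reg = a * sum_list (map block_rows reg)"
    unfolding LL_def by (rule cross_dim_L_regular)
  moreover have "n = (\<Sum>j<a. 2 * s j + 1) + sum_list (map block_rows reg)"
    unfolding n all by (simp add: LL_def rows_family L_blocks_def mult_2)
  then have "int n = (\<Sum>j<a. int (2 * s j + 1)) + int (sum_list (map block_rows reg))"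
    by simp
  then have "D_I n a s = int a * int (sum_list (map block_rows reg))"
    by (simp only: D_I_def add_diff_cancel_left')
  ultimately have "int (sol_dim (LL @ reg)) = int (sol_dim LL) + D_I n a s + int (sol_dim reg)"
    by (simp add: sol_dim_append)
  then show ?thesis
    unfolding all reg
    using count_L[of s a] count_Z[of t b] count_plus1[of m c] count_minus1[of n' d] count_alpha[OF \<alpha>] count_P[OF lam]
    by (simp add: LL_def ZZ_def P1_def M1_def JJ_def RR_def)
qed

theorem theorem5p3:
  fixes n :: nat and J :: "real mat"
    and a b c d e f :: nat
    and s t m n' p q :: "nat \<Rightarrow> nat"
    and \<alpha> lam :: "nat \<Rightarrow> complex"
  assumes J: "J \<in> carrier_mat n n"
    and t: "\<And>j. j < b \<Longrightarrow> t j \<ge> 1"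
    and m: "\<And>j. j < c \<Longrightarrow> m j \<ge> 1"
    and n': "\<And>j. j < d \<Longrightarrow> n' j \<ge> 1"
    and p: "\<And>j. j < e \<Longrightarrow> p j \<ge> 1"
    and q: "\<And>j. j < f \<Longrightarrow> q j \<ge> 1"
    and \<alpha>: "\<And>j. j < e \<Longrightarrow> \<alpha> j \<in> Omega"
    and lam: "\<And>j. j < f \<Longrightarrow> lam j \<notin> \<real> \<and> cmod (lam j) \<noteq> 1"
    and K: "strictly_equivalent
              (pencil (map_mat complex_of_real J) (map_mat complex_of_real (transpose_mat J)))
              (K_pencil a s b t c m d n' e p \<alpha> f q lam)"
  shows "int (solutions_dim n J)
           = D_L a s + D_Z b t + D_plus1 c m + D_minus1 d n' + D_alpha e p \<alpha> + D_P f q lam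
             + D_I n a s"
proof -
  let ?M = "pencil (map_mat complex_of_real J) (map_mat complex_of_real (transpose_mat J))"
  let ?xs = "all_blocks a s b t c m d n' e p \<alpha> f q lam"
  obtain P P' Q Q' where "equiv_by ?M (K_pencil a s b t c m d n' e p \<alpha> f q lam) P P' Q Q'"
    using strictly_equivalent_imp_equiv_by[OF K] by blast
  then have "decomposes ?M ?xs" using decomposes_K_pencil by (rule decomposes_equiv)
  then have dim: "has_dim (self_sol ?M) (sol_dim ?xs)" and "dim_row ?M = sum_list (map block_rows ?xs)"
    by (auto simp: decomposes_def)
  then have n: "n = sum_list (map block_rows ?xs)" using J by (simp add: pencil_dim)
  have "solutions_dim n J = sol_dim ?xs"
    unfolding solutions_dim_def using dim
    by (intro real_dim_eq_complex_dim solutions_subspace J) (simp only: self_sol_pencil_transpose[OF J])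
  then show ?thesis
    using sol_dim_all_blocks[OF \<alpha> _ n] lam by (simp add: generic_def)
qed

end
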